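(* The following decision problems are in PSPACE: given a formula $A$ of the conditional language, decide whether $\mathsf{H}\mathsf{CK}\mathsf{MP}\mathsf{CEM}\vdash A$; and given such a formula $A$, decide whether $\mathsf{H}\mathsf{CK}\mathsf{ID}\mathsf{MP}\mathsf{CEM}\vdash A$.
   Context: Fix a countable set $V$ of propositional variables. Conditional formulas: $A ::= \bot\mid p\mid\neg A\mid A\land B\mid A\Rightarrow B$ ($p\in V$); $\top,\lor,\to,\leftrightarrow$ abbreviations. A rule is $\Gamma_1\dots\Gamma_n/\Gamma_0$ with finite multisets of formulas (sequents), read disjunctively via $\bigvee$. For a rule set $\mathsf{R}$, $\mathsf{H}\mathsf{R}\vdash A$ iff $A$ lies in the least set of formulas containing all substitution instances of propositional tautologies, closed under modus ponens, and containing $\bigvee\Gamma_0$ whenever it contains $\bigvee\Gamma_1,\dots,\bigvee\Gamma_n$ for $\Gamma_1\dots\Gamma_n/\Gamma_0\in\mathsf{R}$. $\mathsf{CK}\mathsf{MP}\mathsf{CEM}$ is the rule set of all instances of $(\mathsf{RCEA})$ $\frac{A\leftrightarrow A'}{(A\Rightarrow B)\leftrightarrow(A'\Rightarrow B)}$, $(\mathsf{RCK})$ $\frac{B_1\land\dots\land B_n\to B}{(A\Rightarrow B_1)\land\dots\land(A\Rightarrow B_n)\to(A\Rightarrow B)}$ ($n\ge0$; $n=0$ reads $B/(A\Rightarrow B)$), and the axioms $(\mathsf{MP})$ $(A\Rightarrow B)\to(A\to B)$ and $(\mathsf{CEM})$ $(A\Rightarrow B)\lor(A\Rightarrow\neg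 B)$; $\mathsf{CK}\mathsf{ID}\mathsf{MP}\mathsf{CEM}$ additionally contains all instances of the axiom $(\mathsf{ID})$ $A\Rightarrow A$. *)

theory Defs
  imports "HOL-Library.Multiset" "HOL-Library.Countable_Set"
    "HOL-Computational_Algebra.Polynomial"
begin

section \<open>Conditional formulas\<close>

text \<open>The countable set of propositional variables is the type \<open>'v\<close>; its countability
  is expressed by \<open>numbering\<close> below, which is needed anyway to write variables down.\<close>

datatype 'v fm =
    Bot ("\<^bold>\<bottom>")
  | Var 'v
  | Neg "'v fm" ("\<^bold>\<not> _" [80] 80)
  | Conj "'v fm" "'v fm" (infixr "\<^bold>\<and>" 70)
  | Cond "'v fm" "'v fm" (infixr "\<^bold>\<Rightarrow>" 60)

abbreviation Disj :: "'v fm \<Rightarrow> 'v fm \<Rightarrow> 'v fm" (infixr "\<^bold>\<or>" 65)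
  where "A \<^bold>\<or> B \<equiv> \<^bold>\<not> (\<^bold>\<not> A \<^bold>\<and> \<^bold>\<not> B)"

abbreviation Impl :: "'v fm \<Rightarrow> 'v fm \<Rightarrow> 'v fm" (infixr "\<^bold>\<longrightarrow>" 55)
  where "A \<^bold>\<longrightarrow> B \<equiv> \<^bold>\<not> (A \<^bold>\<and> \<^bold>\<not> B)"

abbreviation Equi :: "'v fm \<Rightarrow> 'v fm \<Rightarrow> 'v fm" (infix "\<^bold>\<longleftrightarrow>" 50)
  where "A \<^bold>\<longleftrightarrow> B \<equiv> (A \<^bold>\<longrightarrow> B) \<^bold>\<and> (B \<^bold>\<longrightarrow> A)"


section \<open>Hilbert systems given by rule sets\<close>

text \<open>Propositional formulas get their own supply of schematic letters (indexed by \<open>nat\<close>),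
  so that all propositional tautologies are available even when \<open>'v\<close> is finite.\<close>

datatype pfm = PBot | PVar nat | PNeg pfm | PConj pfm pfm

primrec peval :: "(nat \<Rightarrow> bool) \<Rightarrow> pfm \<Rightarrow> bool" where
  "peval \<nu> PBot = False"
| "peval \<nu> (PVar n) = \<nu> n"
| "peval \<nu> (PNeg P) = (\<not> peval \<nu> P)"
| "peval \<nu> (PConj P Q) = (peval \<nu> P \<and> peval \<nu> Q)"

definition tautology :: "pfm \<Rightarrow> bool"
  where "tautology P \<longleftrightarrow> (\<forall>\<nu>. peval \<nu> P)"

primrec psubst :: "(nat \<Rightarrow> 'v fm) \<Rightarrow> pfm \<Rightarrow> 'v fm" where
  "psubst \<sigma> PBot = \<^bold>\<bottom>"
| "psubst \<sigma> (PVar n) = \<sigma> n"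
| "psubst \<sigma> (PNeg P) = \<^bold>\<not> psubst \<sigma> P"
| "psubst \<sigma> (PConj P Q) = psubst \<sigma> P \<^bold>\<and> psubst \<sigma> Q"

type_synonym 'v sequent = "'v fm multiset"

text \<open>A rule is the pair of its premises and its conclusion.\<close>

type_synonym 'v rule = "'v sequent list \<times> 'v sequent"

fun disj_list :: "'v fm list \<Rightarrow> 'v fm" where
  "disj_list [] = \<^bold>\<bottom>"
| "disj_list [A] = A"
| "disj_list (A # B # As) = A \<^bold>\<or> disj_list (B # As)"

text \<open>The disjunction of a multiset is determined only up to the order of the disjuncts,
  hence a relation. The choice of order is immaterial for derivability, since the different
  disjunctions are propositionally equivalent.\<close>

definition disj_of :: "'v sequent \<Rightarrow> 'v fm \<Rightarrow> bool"
  where "disj_of \<Gamma> D \<longleftrightarrow> (\<exists>As. mset As = \<Gamma> \<and> D = disj_list As)"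

inductive derivable :: "'v rule set \<Rightarrow> 'v fm \<Rightarrow> bool" (infix "\<turnstile>\<^sub>H" 45)
  for R :: "'v rule set" where
  taut: "tautology P \<Longrightarrow> R \<turnstile>\<^sub>H psubst \<sigma> P"
| mp: "R \<turnstile>\<^sub>H A \<^bold>\<longrightarrow> B \<Longrightarrow> R \<turnstile>\<^sub>H A \<Longrightarrow> R \<turnstile>\<^sub>H B"
| rule: "(\<Gamma>s, \<Gamma>) \<in> R \<Longrightarrow> \<forall>\<Delta> \<in> set \<Gamma>s. \<exists>D. disj_of \<Delta> D \<and> R \<turnstile>\<^sub>H D
    \<Longrightarrow> disj_of \<Gamma> C \<Longrightarrow> R \<turnstile>\<^sub>H C"


section \<open>The conditional logics\<close>

fun conj_list :: "'v fm \<Rightarrow> 'v fm list \<Rightarrow> 'v fm" where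
  "conj_list A [] = A"
| "conj_list A (B # Bs) = A \<^bold>\<and> conj_list B Bs"

text \<open>\<open>B\<^sub>1 \<and> \<dots> \<and> B\<^sub>n \<rightarrow> B\<close>, which for \<open>n = 0\<close> is read as \<open>B\<close>.\<close>

fun impl_list :: "'v fm list \<Rightarrow> 'v fm \<Rightarrow> 'v fm" where
  "impl_list [] B = B"
| "impl_list (B\<^sub>1 # Bs) B = conj_list B\<^sub>1 Bs \<^bold>\<longrightarrow> B"

definition RCEA :: "'v rule set" where
  "RCEA = {([{# A \<^bold>\<longleftrightarrow> A' #}], {# (A \<^bold>\<Rightarrow> B) \<^bold>\<longleftrightarrow> (A' \<^bold>\<Rightarrow> B) #}) | A A' B. True}"

definition RCK :: "'v rule set" where
  "RCK = {([{# impl_list Bs B #}], {# impl_list (map (\<lambda>C. A \<^bold>\<Rightarrow> C) Bs) (A \<^bold>\<Rightarrow> B) #}) | A Bs B. True}"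

definition MP :: "'v rule set" where
  "MP = {([], {# (A \<^bold>\<Rightarrow> B) \<^bold>\<longrightarrow> (A \<^bold>\<longrightarrow> B) #}) | A B. True}"

definition CEM :: "'v rule set" where
  "CEM = {([], {# (A \<^bold>\<Rightarrow> B) \<^bold>\<or> (A \<^bold>\<Rightarrow> \<^bold>\<not> B) #}) | A B. True}"

definition ID :: "'v rule set" where
  "ID = {([], {# A \<^bold>\<Rightarrow> A #}) | A. True}"

definition CKMPCEM :: "'v rule set"
  where "CKMPCEM = RCEA \<union> RCK \<union> MP \<union> CEM"

definition CKIDMPCEM :: "'v rule set"
  where "CKIDMPCEM = CKMPCEM \<union> ID"


section \<open>Turing machines and PSPACE\<close>

text \<open>Deterministic Turing machines with finitely many one-way infinite tapes, over the input
  alphabet \<open>'a\<close>. Since existential quantification over types is not available, control states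
  and auxiliary tape symbols are drawn from \<open>nat\<close>; \<open>wf_tm\<close> makes both finite.\<close>

datatype 'a sym = Blank | Inp 'a | Work nat

datatype move = Go_Left | Stay | Go_Right

record 'a tm =
  ntapes :: nat
  states :: "nat set"
  symbols :: "'a sym set"
  start :: nat
  accept :: nat
  reject :: nat
  delta :: "nat \<Rightarrow> 'a sym list \<Rightarrow> nat \<times> ('a sym \<times> move) list"

definition wf_tm :: "'a tm \<Rightarrow> bool" where
  "wf_tm M \<longleftrightarrow>
     ntapes M \<ge> 1 \<and> finite (states M) \<and> finite (symbols M) \<and>
     Blank \<in> symbols M \<and> range Inp \<subseteq> symbols M \<and>
     start M \<in> states M \<and> accept M \<in> states M \<and> reject M \<in> states M \<and>
     accept M \<noteq> reject M \<and>
     (\<forall>q \<in> states M. \<forall>ss. length ss = ntapes M \<and> set ss \<subseteq> symbols M \<longrightarrow>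
        (case delta M q ss of (q', acts) \<Rightarrow>
           q' \<in> states M \<and> length acts = ntapes M \<and> fst ` set acts \<subseteq> symbols M))"

text \<open>A tape is its contents together with the head position.\<close>

type_synonym 'a tape = "(nat \<Rightarrow> 'a sym) \<times> nat"

type_synonym 'a config = "nat \<times> 'a tape list"

text \<open>A left move at the left end of the tape (position \<open>0\<close>) leaves the head in place.\<close>

fun move_head :: "move \<Rightarrow> nat \<Rightarrow> nat" where
  "move_head Go_Left h = h - 1"
| "move_head Stay h = h"
| "move_head Go_Right h = h + 1"

fun read_tape :: "'a tape \<Rightarrow> 'a sym" where
  "read_tape (f, h) = f h"

fun act_tape :: "'a sym \<times> move \<Rightarrow> 'a tape \<Rightarrow> 'a tape" where
  "act_tape (s, m) (f, h) = (f(h := s), move_head m h)"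

fun step :: "'a tm \<Rightarrow> 'a config \<Rightarrow> 'a config" where
  "step M (q, ts) =
     (if q = accept M \<or> q = reject M then (q, ts)
      else case delta M q (map read_tape ts) of (q', acts) \<Rightarrow> (q', map2 act_tape acts ts))"

definition initial :: "'a tm \<Rightarrow> 'a list \<Rightarrow> 'a config" where
  "initial M w =
     (start M,
      ((\<lambda>i. if i < length w then Inp (w ! i) else Blank), 0)
        # replicate (ntapes M - 1) ((\<lambda>_. Blank), 0))"

definition run :: "'a tm \<Rightarrow> 'a list \<Rightarrow> nat \<Rightarrow> 'a config"
  where "run M w t = (step M ^^ t) (initial M w)"

definition decides :: "'a tm \<Rightarrow> 'a list set \<Rightarrow> bool" where
  "decides M L \<longleftrightarrow>
     (\<forall>w. \<exists>t. fst (run M w t) = (if w \<in> L then accept M else reject M))"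

text \<open>On each tape (the input tape included), only the first \<open>s\<close> cells are ever visited.\<close>

definition space_bounded :: "'a tm \<Rightarrow> 'a list \<Rightarrow> nat \<Rightarrow> bool" where
  "space_bounded M w s \<longleftrightarrow> (\<forall>t. \<forall>(f, h) \<in> set (snd (run M w t)). h < s)"

definition PSPACE :: "'a::finite list set set" where
  "PSPACE = {L. \<exists>M (p :: nat poly). wf_tm M \<and> decides M L \<and>
                  (\<forall>w. space_bounded M w (poly p (length w)))}"


section \<open>Formulas as words\<close>

text \<open>Formulas are written in Polish notation, a variable being the letter \<open>TVar\<close> followed by
  its number in binary.\<close>

datatype letter = TBot | TVar | TNeg | TConj | TCond | Zero | One

instance letter :: finite
proof
  have "(UNIV :: letter set) \<subseteq> {TBot, TVar, TNeg, TConj, TCond, Zero, One}"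
    using letter.exhaust by blast
  then show "finite (UNIV :: letter set)"
    by (rule finite_subset) simp
qed

definition digit :: "nat \<Rightarrow> letter"
  where "digit b = (if b = 0 then Zero else One)"

fun binary :: "nat \<Rightarrow> letter list" where
  "binary n = (if n < 2 then [digit n] else binary (n div 2) @ [digit (n mod 2)])"

declare binary.simps [simp del]

text \<open>The variables are numbered by an initial segment of the natural numbers, i.e. by
  \<open>{..<n}\<close> or by all of \<open>\<nat>\<close>, so that the words encoding formulas are easy to recognise.\<close>

definition numbering :: "('v \<Rightarrow> nat) \<Rightarrow> bool" where
  "numbering num \<longleftrightarrow> inj num \<and> (\<forall>n \<in> range num. {..n} \<subseteq> range num)"

primrec encode :: "('v \<Rightarrow> nat) \<Rightarrow> 'v fm \<Rightarrow> letter list" where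
  "encode num \<^bold>\<bottom> = [TBot]"
| "encode num (Var v) = TVar # binary (num v)"
| "encode num (\<^bold>\<not> A) = TNeg # encode num A"
| "encode num (A \<^bold>\<and> B) = TConj # encode num A @ encode num B"
| "encode num (A \<^bold>\<Rightarrow> B) = TCond # encode num A @ encode num B"

text \<open>Every countable type has a numbering, and the encoding is unambiguous.\<close>

lemma ex_numbering: "\<exists>num :: 'v::countable \<Rightarrow> nat. numbering num"
proof (cases "finite (UNIV :: 'v set)")
  case True
  then obtain h :: "'v \<Rightarrow> nat" where "bij_betw h UNIV {0..<card (UNIV :: 'v set)}"
    using ex_bij_betw_finite_nat by blast
  then show ?thesis
    by (intro exI[of _ h]) (auto simp: numbering_def bij_betw_def)
next
  case False
  then have "bij_betw (to_nat_on (UNIV :: 'v set)) UNIV UNIV"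
    by (intro to_nat_on_infinite) auto
  then show ?thesis
    by (intro exI[of _ "to_nat_on UNIV"]) (auto simp: numbering_def bij_betw_def)
qed

lemma inj_binary: "binary m = binary n \<Longrightarrow> m = n"
proof -
  define val where "val = foldl (\<lambda>a c. 2 * a + (if c = One then 1 else 0 :: nat)) 0"
  have "val (binary n) = n" for n
  proof (induction n rule: binary.induct)
    case (1 n)
    show ?case
    proof (cases "n < 2")
      case True
      then show ?thesis by (subst binary.simps) (auto simp: val_def digit_def)
    next
      case False
      then show ?thesis
        using 1 by (subst binary.simps) (auto simp: val_def digit_def; presburger)
    qed
  qed
  then show "binary m = binary n \<Longrightarrow> m = n" by metis
qed

lemma set_binary: "set (binary n) \<subseteq> {Zero, One}"
proof (induction n rule: binary.induct)
  case (1 n)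
  then show ?case by (subst binary.simps) (auto simp: digit_def)
qed

lemma inj_encode:
  assumes "inj num"
  shows "inj (encode num)"
proof -
  define ok where "ok = (\<lambda>xs. xs = [] \<or> hd xs \<notin> {Zero, One})"
  have ok_enc: "ok (encode num A @ xs)" for A :: "'a fm" and xs
    by (cases A) (auto simp: ok_def)
  have tw: "takeWhile (\<lambda>c. c \<in> {Zero, One}) (binary n @ xs) = binary n" if "ok xs" for n xs
    using that set_binary[of n] by (cases xs) (auto simp: ok_def takeWhile_append)
  have "A = B \<and> xs = ys"
    if "encode num A @ xs = encode num B @ ys" "ok xs" "ok ys" for A B :: "'a fm" and xs ys
    using that
  proof (induction A arbitrary: B xs ys)
    case Bot
    then show ?case by (cases B) auto
  next
    case (Var v)
    then obtain u where B: "B = Var u" and eq: "binary (num v) @ xs = binary (num u) @ ys"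
      by (cases B) auto
    have "binary (num v) = binary (num u)"
      using tw[OF Var.prems(2)] tw[OF Var.prems(3)] eq by metis
    then show ?case
      using B eq inj_binary injD[OF assms] by auto
  next
    case (Neg A)
    from Neg.prems(1) obtain B' where B: "B = \<^bold>\<not> B'" and eq: "encode num A @ xs = encode num B' @ ys"
      by (cases B) simp_all
    have "A = B' \<and> xs = ys"
      by (rule Neg.IH[OF eq Neg.prems(2,3)])
    with B show ?case by blast
  next
    case (Conj A1 A2)
    from Conj.prems(1) obtain B1 B2 where B: "B = B1 \<^bold>\<and> B2"
      and eq: "encode num A1 @ encode num A2 @ xs = encode num B1 @ encode num B2 @ ys"
      by (cases B) simp_all
    have 1: "A1 = B1 \<and> encode num A2 @ xs = encode num B2 @ ys"
      by (rule Conj.IH(1)[OF eq ok_enc ok_enc])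
    have "A2 = B2 \<and> xs = ys"
      by (rule Conj.IH(2)[OF conjunct2[OF 1] Conj.prems(2,3)])
    with 1 B show ?case by blast
  next
    case (Cond A1 A2)
    from Cond.prems(1) obtain B1 B2 where B: "B = B1 \<^bold>\<Rightarrow> B2"
      and eq: "encode num A1 @ encode num A2 @ xs = encode num B1 @ encode num B2 @ ys"
      by (cases B) simp_all
    have 1: "A1 = B1 \<and> encode num A2 @ xs = encode num B2 @ ys"
      by (rule Cond.IH(1)[OF eq ok_enc ok_enc])
    have "A2 = B2 \<and> xs = ys"
      by (rule Cond.IH(2)[OF conjunct2[OF 1] Cond.prems(2,3)])
    with 1 B show ?case by blast
  qed
  note * = this
  show ?thesis
  proof (rule injI)
    fix A B :: "'a fm"
    assume "encode num A = encode num B"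
    then show "A = B"
      using *[of A "[]" B "[]"] by (simp add: ok_def)
  qed
qed

end

theory Submission imports Defs begin

text \<open>Both logics are sound and complete for selection models in which every world selects at most one
  world for a given proposition. Adding one new world to the canonical model shows that a set of
  literals is satisfiable iff it extends to a valuation of all subformulas such that every false
  conditional with a false antecedent \<open>A\<close> has a successor valuation, which makes \<open>B\<close> true exactly if
  \<open>A' \<Rightarrow> B\<close> is true in the given one, for all \<open>A'\<close> provably equivalent to \<open>A\<close>; these successors are
  subject to the same condition for formulas of smaller size. So derivability is decided by a game of
  polynomial length, relative to the relation of provable equivalence between subformulas, which is
  the unique solution of an equation of the same kind and can therefore be guessed.

  For the complexity bound, words are read as numbers, and the procedure becomes an arithmetic
  predicate. The functions on numbers that are computable with polynomially many binary digits are
  closed under composition and under primitive recursion with bounded values, hence under bounded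
  quantifiers and under the evaluation of games by depth-first search. Primitive recursive expressions
  compile to counter programs, and these to Turing machines with one binary counter per tape.\<close>

section \<open>Propositional reasoning and maximal consistent sets\<close>

text \<open>The obstacle is that \<open>RCEA\<close> gives one successor to all provably equivalent
  antecedents. A successor valuation therefore answers for a whole class of antecedents, and
  membership in the class is again a question of derivability. A guessed relation avoids these
  nested calls. It can be checked because a game at level \<open>l\<close> compares only antecedents
  of size below \<open>l\<close>: the equation is stratified by size and fixes the relation level by
  level. Only false conditionals with false antecedents ask for a successor. If A is true at a
  world, \<open>MP\<close> and \<open>CEM\<close> make the world its own only successor, so A => B
  has the value of B there. If A is false and no conditional of its class is false, the empty
  selection makes all of them true. The closure under bounded recursion limits the number of digits
  and not the number of rounds. A loop may run exponentially often, so guesses become exhaustive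
  search by a deterministic program, and no argument about nondeterministic machines is
  required.\<close>

primrec atoms :: "'v fm \<Rightarrow> 'v fm set" where
  "atoms \<^bold>\<bottom> = {}"
| "atoms (Var p) = {Var p}"
| "atoms (\<^bold>\<not> A) = atoms A"
| "atoms (A \<^bold>\<and> B) = atoms A \<union> atoms B"
| "atoms (A \<^bold>\<Rightarrow> B) = {A \<^bold>\<Rightarrow> B}"

primrec skeleton_of :: "('v fm \<Rightarrow> nat) \<Rightarrow> 'v fm \<Rightarrow> pfm" where
  "skeleton_of g \<^bold>\<bottom> = PBot"
| "skeleton_of g (Var p) = PVar (g (Var p))"
| "skeleton_of g (\<^bold>\<not> A) = PNeg (skeleton_of g A)"
| "skeleton_of g (A \<^bold>\<and> B) = PConj (skeleton_of g A) (skeleton_of g B)"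
| "skeleton_of g (A \<^bold>\<Rightarrow> B) = PVar (g (A \<^bold>\<Rightarrow> B))"

primrec pval :: "('v fm \<Rightarrow> bool) \<Rightarrow> 'v fm \<Rightarrow> bool" where
  "pval h \<^bold>\<bottom> = False"
| "pval h (Var p) = h (Var p)"
| "pval h (\<^bold>\<not> A) = (\<not> pval h A)"
| "pval h (A \<^bold>\<and> B) = (pval h A \<and> pval h B)"
| "pval h (A \<^bold>\<Rightarrow> B) = h (A \<^bold>\<Rightarrow> B)"

text \<open>The axioms are instances of tautologies over letters indexed by \<open>nat\<close>. The
  finitely many atoms of \<open>A\<close>, conditionals among them, are numbered injectively by
  \<open>g\<close>; substituting back along the inverse of \<open>g\<close> recovers
  \<open>A\<close> from its skeleton.\<close>

lemma derivable_if_prop_valid: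
  assumes "\<And>h. pval h A"
  shows "R \<turnstile>\<^sub>H A"
proof -
  have "finite (atoms A)" by (induction A) auto
  then obtain g :: "'a fm \<Rightarrow> nat" where g: "inj_on g (atoms A)"
    using finite_imp_inj_to_nat_seg[of "atoms A"] by auto
  define \<sigma> where "\<sigma> = inv_into (atoms A) g"
  have "psubst \<sigma> (skeleton_of g B) = B" if "atoms B \<subseteq> atoms A" for B
    using that g by (induction B) (auto simp: \<sigma>_def)
  then have 1: "psubst \<sigma> (skeleton_of g A) = A" by simp
  have 2: "peval \<nu> (skeleton_of g B) = pval (\<lambda>C. \<nu> (g C)) B" for \<nu> B
    by (induction B) auto
  have "tautology (skeleton_of g A)"
    unfolding tautology_def 2 using assms by blast
  then show ?thesis using derivable.taut[of "skeleton_of g A" R \<sigma>] 1 by simp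
qed

lemma derivable_prop1:
  assumes "R \<turnstile>\<^sub>H A" "\<And>h. pval h A \<Longrightarrow> pval h B"
  shows "R \<turnstile>\<^sub>H B"
proof -
  have "R \<turnstile>\<^sub>H A \<^bold>\<longrightarrow> B" by (rule derivable_if_prop_valid) (use assms(2) in auto)
  then show ?thesis using assms(1) derivable.mp by blast
qed

lemma derivable_prop2:
  assumes "R \<turnstile>\<^sub>H A" "R \<turnstile>\<^sub>H B" "\<And>h. pval h A \<Longrightarrow> pval h B \<Longrightarrow> pval h C"
  shows "R \<turnstile>\<^sub>H C"
proof -
  have "R \<turnstile>\<^sub>H B \<^bold>\<longrightarrow> C" by (rule derivable_prop1[OF assms(1)]) (use assms(3) in auto)
  then show ?thesis using assms(2) derivable.mp by blast
qed

text \<open>Nested implications treat the empty list of premises uniformly, which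
  \<open>impl_list\<close> does not.\<close>

definition imps :: "'v fm list \<Rightarrow> 'v fm \<Rightarrow> 'v fm" where
  "imps Bs A = foldr Impl Bs A"

lemma imps_val [simp]: "pval h (imps Bs A) \<longleftrightarrow> ((\<forall>B\<in>set Bs. pval h B) \<longrightarrow> pval h A)"
  by (induction Bs) (auto simp: imps_def)

lemma conj_list_val [simp]: "pval h (conj_list B Bs) \<longleftrightarrow> pval h B \<and> (\<forall>C\<in>set Bs. pval h C)"
  by (induction Bs arbitrary: B) auto

lemma impl_list_val [simp]:
  "pval h (impl_list Bs A) \<longleftrightarrow> ((\<forall>B\<in>set Bs. pval h B) \<longrightarrow> pval h A)"
  by (cases Bs) auto

lemma disj_of_single [simp]: "disj_of {#A#} D \<longleftrightarrow> D = A"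
  unfolding disj_of_def by (auto intro: exI[of _ "[A]"])

definition logic :: "bool \<Rightarrow> 'v rule set" where
  "logic idf = (if idf then CKIDMPCEM else CKMPCEM)"

lemma logic_eq: "logic idf = RCEA \<union> RCK \<union> MP \<union> CEM \<union> (if idf then ID else {})"
  by (auto simp: logic_def CKIDMPCEM_def CKMPCEM_def)

context
  fixes idf :: bool and R :: "'v rule set"
  assumes R: "R = logic idf"
begin

lemma derivable_RCEA: "R \<turnstile>\<^sub>H A \<^bold>\<longleftrightarrow> A' \<Longrightarrow> R \<turnstile>\<^sub>H (A \<^bold>\<Rightarrow> B) \<^bold>\<longleftrightarrow> (A' \<^bold>\<Rightarrow> B)"
  by (rule derivable.rule[of "[{# A \<^bold>\<longleftrightarrow> A' #}]" "{# (A \<^bold>\<Rightarrow> B) \<^bold>\<longleftrightarrow> (A' \<^bold>\<Rightarrow> B) #}"])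
    (auto simp: R logic_eq RCEA_def)

lemma derivable_RCK: 
  assumes "R \<turnstile>\<^sub>H imps Bs B" 
  shows "R \<turnstile>\<^sub>H imps (map (Cond A) Bs) (A \<^bold>\<Rightarrow> B)"
proof -
  have 1: "R \<turnstile>\<^sub>H impl_list Bs B" by (rule derivable_prop1[OF assms]) simp
  have "R \<turnstile>\<^sub>H impl_list (map (Cond A) Bs) (A \<^bold>\<Rightarrow> B)"
    by (rule derivable.rule[of "[{# impl_list Bs B #}]" "{# impl_list (map (Cond A) Bs) (A \<^bold>\<Rightarrow> B) #}"])
      (use 1 in \<open>auto simp: R logic_eq RCK_def\<close>)
  then show ?thesis by (rule derivable_prop1) simp
qed

lemma derivable_MP: "R \<turnstile>\<^sub>H (A \<^bold>\<Rightarrow> B) \<^bold>\<longrightarrow> (A \<^bold>\<longrightarrow> B)"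
  by (rule derivable.rule[of "[]" "{# (A \<^bold>\<Rightarrow> B) \<^bold>\<longrightarrow> (A \<^bold>\<longrightarrow> B) #}"]) (auto simp: R logic_eq MP_def)

lemma derivable_CEM: "R \<turnstile>\<^sub>H (A \<^bold>\<Rightarrow> B) \<^bold>\<or> (A \<^bold>\<Rightarrow> \<^bold>\<not> B)"
  by (rule derivable.rule[of "[]" "{# (A \<^bold>\<Rightarrow> B) \<^bold>\<or> (A \<^bold>\<Rightarrow> \<^bold>\<not> B) #}"]) (auto simp: R logic_eq CEM_def)

lemma derivable_ID: "idf \<Longrightarrow> R \<turnstile>\<^sub>H A \<^bold>\<Rightarrow> A"
  by (rule derivable.rule[of "[]" "{# A \<^bold>\<Rightarrow> A #}"]) (auto simp: R logic_eq ID_def)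

end

section \<open>Consistency and Lindenbaum's lemma\<close>

definition con :: "'v rule set \<Rightarrow> 'v fm set \<Rightarrow> bool" where
  "con R S \<longleftrightarrow> (\<forall>Bs. set Bs \<subseteq> S \<longrightarrow> \<not> R \<turnstile>\<^sub>H imps Bs \<^bold>\<bottom>)"

definition mcs :: "'v rule set \<Rightarrow> 'v fm set \<Rightarrow> bool" where
  "mcs R u \<longleftrightarrow> con R u \<and> (\<forall>A. A \<in> u \<or> \<^bold>\<not> A \<in> u)"

lemma not_conE:
  assumes "\<not> con R S"
  obtains Bs where "set Bs \<subseteq> S" "R \<turnstile>\<^sub>H imps Bs \<^bold>\<bottom>"
  using assms unfolding con_def not_all not_imp not_not by (elim exE conjE)

lemma con_insert:
  assumes "con R S"
  shows "con R (insert A S) \<or> con R (insert (\<^bold>\<not> A) S)"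
proof (rule ccontr)
  assume "\<not> ?thesis"
  then have nA: "\<not> con R (insert A S)" and nB: "\<not> con R (insert (\<^bold>\<not> A) S)" by auto
  obtain Bs where B: "set Bs \<subseteq> insert A S" "R \<turnstile>\<^sub>H imps Bs \<^bold>\<bottom>" by (rule not_conE[OF nA])
  obtain Cs where C: "set Cs \<subseteq> insert (\<^bold>\<not> A) S" "R \<turnstile>\<^sub>H imps Cs \<^bold>\<bottom>" by (rule not_conE[OF nB])
  let ?D = "removeAll A Bs @ removeAll (\<^bold>\<not> A) Cs"
  have "R \<turnstile>\<^sub>H imps ?D \<^bold>\<bottom>"
  proof (rule derivable_prop2[OF B(2) C(2)])
    fix h assume "pval h (imps Bs \<^bold>\<bottom>)" "pval h (imps Cs \<^bold>\<bottom>)"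
    then obtain D E where "D \<in> set Bs" "\<not> pval h D" "E \<in> set Cs" "\<not> pval h E" by auto
    \<comment> \<open>If both false members were the removed formulas, \<open>h\<close> would
      falsify \<open>A\<close> as well as its negation; so at least one of them survives in
      \<open>?D\<close>.\<close>
    moreover from this have "D \<in> set ?D \<or> E \<in> set ?D" by (cases "D = A \<and> E = \<^bold>\<not> A") auto
    ultimately show "pval h (imps ?D \<^bold>\<bottom>)" unfolding imps_val by blast
  qed
  moreover have "set ?D \<subseteq> S" using B(1) C(1) by auto
  ultimately show False using assms unfolding con_def by blast
qed

lemma lindenbaum:
  assumes "con R S"
  obtains u where "S \<subseteq> u" "mcs R u"
proof -
  let ?A = "{S'. S \<subseteq> S' \<and> con R S'}"
  have "\<Union>C \<in> ?A" if C: "C \<noteq> {}" "subset.chain ?A C" for C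
  proof -
    have "con R (\<Union>C)"
      unfolding con_def
    proof (intro allI impI)
      fix Bs assume "set Bs \<subseteq> \<Union>C"
      \<comment> \<open>Consistency is finitary: the finitely many premises already lie in one
        member of the chain.\<close>
      then obtain X where "X \<in> C" "set Bs \<subseteq> X"
        using finite_subset_Union_chain[of "set Bs" C ?A] C by auto
      then show "\<not> R \<turnstile>\<^sub>H imps Bs \<^bold>\<bottom>"
        using C(2) by (auto simp: subset.chain_def con_def)
    qed
    moreover have "S \<subseteq> \<Union>C" using C unfolding subset.chain_def by blast
    ultimately show ?thesis by blast
  qed
  note chain = this
  have "?A \<noteq> {}" using assms by blast
  from subset_Zorn_nonempty[OF this chain] obtain u where u: "u \<in> ?A" and mx: "\<And>X. X \<in> ?A \<Longrightarrow> u \<subseteq> X \<Longrightarrow> X = u"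
    by (metis (no_types, lifting))
  have "A \<in> u \<or> \<^bold>\<not> A \<in> u" for A
  proof -
    have "con R (insert A u) \<or> con R (insert (\<^bold>\<not> A) u)" using con_insert u by blast
    then have "insert A u = u \<or> insert (\<^bold>\<not> A) u = u"
      using mx[of "insert A u"] mx[of "insert (\<^bold>\<not> A) u"] u by auto
    then show ?thesis by auto
  qed
  then have "mcs R u" using u by (simp add: mcs_def)
  then show thesis using u by (intro that) auto
qed

lemma mcs_closed:
  assumes "mcs R u" "set Bs \<subseteq> u" "R \<turnstile>\<^sub>H imps Bs A"
  shows "A \<in> u"
proof (rule ccontr)
  assume "A \<notin> u"
  then have "set (\<^bold>\<not> A # Bs) \<subseteq> u" using assms(1,2) by (auto simp: mcs_def)
  moreover have "R \<turnstile>\<^sub>H imps (\<^bold>\<not> A # Bs) \<^bold>\<bottom>"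
    by (rule derivable_prop1[OF assms(3)]) auto
  ultimately show False using assms(1) by (auto simp: mcs_def con_def)
qed

lemma mcs_derivable: "mcs R u \<Longrightarrow> R \<turnstile>\<^sub>H A \<Longrightarrow> A \<in> u"
  using mcs_closed[of R u "[]" A] by (simp add: imps_def)

lemma mcs_Bot: "mcs R u \<Longrightarrow> \<^bold>\<bottom> \<notin> u"
proof
  assume "mcs R u" "\<^bold>\<bottom> \<in> u"
  moreover have "R \<turnstile>\<^sub>H imps [\<^bold>\<bottom>] \<^bold>\<bottom>" by (rule derivable_if_prop_valid) simp
  ultimately show False unfolding mcs_def con_def by (auto dest!: spec[of _ "[\<^bold>\<bottom>]"])
qed

lemma mcs_Neg:
  assumes "mcs R u"
  shows "\<^bold>\<not> A \<in> u \<longleftrightarrow> A \<notin> u"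
proof -
  have "R \<turnstile>\<^sub>H imps [A, \<^bold>\<not> A] \<^bold>\<bottom>" by (rule derivable_if_prop_valid) simp
  from mcs_closed[OF assms _ this] have "\<not> (A \<in> u \<and> \<^bold>\<not> A \<in> u)"
    using mcs_Bot[OF assms] by simp blast
  then show ?thesis using assms by (auto simp: mcs_def)
qed

lemma mcs_Conj:
  assumes "mcs R u"
  shows "A \<^bold>\<and> B \<in> u \<longleftrightarrow> A \<in> u \<and> B \<in> u"
proof -
  have "R \<turnstile>\<^sub>H imps [A, B] (A \<^bold>\<and> B)" "R \<turnstile>\<^sub>H imps [A \<^bold>\<and> B] A" "R \<turnstile>\<^sub>H imps [A \<^bold>\<and> B] B"
    by (rule derivable_if_prop_valid; simp)+
  from mcs_closed[OF assms _ this(1)] mcs_closed[OF assms _ this(2)] mcs_closed[OF assms _ this(3)]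
  show ?thesis by (metis empty_set empty_subsetI insert_subset list.simps(15))
qed

lemma not_derivable_mcs:
  assumes "\<not> R \<turnstile>\<^sub>H A"
  obtains u where "mcs R u" "A \<notin> u"
proof -
  have "con R {\<^bold>\<not> A}"
    unfolding con_def
  proof (intro allI impI notI)
    fix Bs assume B: "set Bs \<subseteq> {\<^bold>\<not> A}" "R \<turnstile>\<^sub>H imps Bs \<^bold>\<bottom>"
    have "R \<turnstile>\<^sub>H A" by (rule derivable_prop1[OF B(2)]) (use B(1) in auto)
    then show False using assms by blast
  qed
  then obtain u where "{\<^bold>\<not> A} \<subseteq> u" "mcs R u" by (rule lindenbaum)
  then show thesis using that mcs_Neg[of R u A] by auto
qed

section \<open>Selection models\<close>

primrec holds :: "('w \<Rightarrow> 'w set \<Rightarrow> 'w set) \<Rightarrow> ('w \<Rightarrow> 'v \<Rightarrow> bool) \<Rightarrow> 'v fm \<Rightarrow> 'w \<Rightarrow> bool" where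
  "holds f V \<^bold>\<bottom> w = False"
| "holds f V (Var p) w = V w p"
| "holds f V (\<^bold>\<not> A) w = (\<not> holds f V A w)"
| "holds f V (A \<^bold>\<and> B) w = (holds f V A w \<and> holds f V B w)"
| "holds f V (A \<^bold>\<Rightarrow> B) w = (\<forall>v \<in> f w {u. holds f V A u}. holds f V B v)"

text \<open>The three conjuncts are the frame conditions of \<open>MP\<close>, \<open>CEM\<close>
  and \<open>ID\<close>. \<open>RCEA\<close> holds because \<open>f\<close> receives the truth set
  of the antecedent, \<open>RCK\<close> because a conditional quantifies over all selected
  worlds.\<close>

definition selection :: "bool \<Rightarrow> ('w \<Rightarrow> 'w set \<Rightarrow> 'w set) \<Rightarrow> bool" where
  "selection idf f \<longleftrightarrow> (\<forall>w X. (w \<in> X \<longrightarrow> w \<in> f w X) \<and> (\<forall>a\<in>f w X. \<forall>b\<in>f w X. a = b) \<and>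
     (idf \<longrightarrow> f w X \<subseteq> X))"

lemma holds_pval: "pval (\<lambda>B. holds f V B w) A = holds f V A w"
  by (induction A) auto

lemma holds_sound:
  assumes f: "selection idf f" and "logic idf \<turnstile>\<^sub>H A"
  shows "holds f V A w"
  using assms(2)
proof (induction arbitrary: w)
  case (taut P \<sigma>)
  have "holds f V (psubst \<sigma> P) w = peval (\<lambda>n. holds f V (\<sigma> n) w) P" by (induction P) auto
  then show ?case using taut by (simp add: tautology_def)
next
  case (mp A B)
  then show ?case by auto
next
  case (rule \<Gamma>s \<Gamma> C)
  consider "(\<Gamma>s, \<Gamma>) \<in> RCEA" | "(\<Gamma>s, \<Gamma>) \<in> RCK" | "(\<Gamma>s, \<Gamma>) \<in> MP" | "(\<Gamma>s, \<Gamma>) \<in> CEM" | "idf" "(\<Gamma>s, \<Gamma>) \<in> ID"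
    using rule.hyps(1) by (auto simp: logic_eq split: if_splits)
  then show ?case
  proof cases
    case 1
    then obtain A A' B where G: "\<Gamma>s = [{# A \<^bold>\<longleftrightarrow> A' #}]" "\<Gamma> = {# (A \<^bold>\<Rightarrow> B) \<^bold>\<longleftrightarrow> (A' \<^bold>\<Rightarrow> B) #}"
      by (auto simp: RCEA_def)
    then have "\<forall>u. holds f V (A \<^bold>\<longleftrightarrow> A') u" using rule.IH by (simp del: holds.simps)
    then have "{u. holds f V A u} = {u. holds f V A' u}" by auto
    then show ?thesis using rule.hyps(2) G by auto
  next
    case 2
    then obtain A Bs B where G: "\<Gamma>s = [{# impl_list Bs B #}]"
      "\<Gamma> = {# impl_list (map (\<lambda>C. A \<^bold>\<Rightarrow> C) Bs) (A \<^bold>\<Rightarrow> B) #}"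
      by (auto simp: RCK_def)
    then have "\<forall>u. holds f V (impl_list Bs B) u" using rule.IH by (simp del: holds.simps)
    then have "(\<forall>D\<in>set Bs. holds f V D u) \<longrightarrow> holds f V B u" for u
      using impl_list_val[of "\<lambda>A. holds f V A u" Bs B] unfolding holds_pval by metis
    then have "holds f V (impl_list (map (\<lambda>C. A \<^bold>\<Rightarrow> C) Bs) (A \<^bold>\<Rightarrow> B)) w"
      using impl_list_val[of "\<lambda>A. holds f V A w" "map (\<lambda>C. A \<^bold>\<Rightarrow> C) Bs" "A \<^bold>\<Rightarrow> B"]
      unfolding holds_pval by auto
    then show ?thesis using rule.hyps(2) G by simp
  next
    case 3
    then obtain A B where C: "C = (A \<^bold>\<Rightarrow> B) \<^bold>\<longrightarrow> (A \<^bold>\<longrightarrow> B)" using rule.hyps(2) by (auto simp: MP_def)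
    have "w \<in> f w {u. holds f V A u}" if "holds f V A w"
      using f that by (simp add: selection_def)
    then show ?thesis unfolding C by auto
  next
    case 4
    then obtain A B where C: "C = (A \<^bold>\<Rightarrow> B) \<^bold>\<or> (A \<^bold>\<Rightarrow> \<^bold>\<not> B)" using rule.hyps(2) by (auto simp: CEM_def)
    have "\<forall>a\<in>f w {u. holds f V A u}. \<forall>b\<in>f w {u. holds f V A u}. a = b"
      using f by (simp add: selection_def)
    then show ?thesis unfolding C by (auto dest: bspec)
  next
    case 5
    then obtain A where "C = A \<^bold>\<Rightarrow> A" using rule.hyps(2) by (auto simp: ID_def)
    moreover have "f w {u. holds f V A u} \<subseteq> {u. holds f V A u}" using f 5(1) by (simp add: selection_def)
    ultimately show ?thesis by auto
  qed
qed

text \<open>By soundness the theory of any world of any selection model is maximal consistent. In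
  this way a world added to the canonical model is turned back into a maximal consistent
  set.\<close>

lemma theory_mcs:
  assumes "selection idf f"
  shows "mcs (logic idf) {A. holds f V A w}"
  unfolding mcs_def con_def
proof (intro conjI allI impI notI)
  fix Bs assume "set Bs \<subseteq> {A. holds f V A w}" "logic idf \<turnstile>\<^sub>H imps Bs \<^bold>\<bottom>"
  then show False
    using holds_sound[OF assms, of "imps Bs \<^bold>\<bottom>" V w] imps_val[of "\<lambda>A. holds f V A w" Bs "\<^bold>\<bottom>"]
    unfolding holds_pval by auto
qed auto


section \<open>The tableau game\<close>

text \<open>Indices stand for occurrences of subformulas, and \<open>same\<close> relates
  occurrences of one formula. The clause for \<open>condn\<close> is the local effect of
  \<open>MP\<close> and \<open>CEM\<close>: a world satisfying the antecedent selects exactly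
  itself.\<close>

definition coherent :: "(nat \<Rightarrow> bool) \<Rightarrow> (nat \<Rightarrow> nat \<Rightarrow> bool) \<Rightarrow> (nat \<Rightarrow> nat \<Rightarrow> nat \<Rightarrow> bool) \<Rightarrow>
    (nat \<Rightarrow> nat \<Rightarrow> nat \<Rightarrow> bool) \<Rightarrow> (nat \<Rightarrow> nat \<Rightarrow> bool) \<Rightarrow> (nat \<Rightarrow> bool) \<Rightarrow> bool" where
  "coherent botn negn conjn condn same V \<longleftrightarrow>
     (\<forall>i. botn i \<longrightarrow> \<not> V i) \<and> (\<forall>i j. negn i j \<longrightarrow> (V i \<longleftrightarrow> \<not> V j)) \<and>
     (\<forall>i j k. conjn i j k \<longrightarrow> (V i \<longleftrightarrow> V j \<and> V k)) \<and>
     (\<forall>i j k. condn i j k \<and> V j \<longrightarrow> (V i \<longleftrightarrow> V k)) \<and>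
     (\<forall>i j. same i j \<longrightarrow> (V i \<longleftrightarrow> V j))"

lemma coherentD:
  assumes "coherent botn negn conjn condn same V"
  shows "botn i \<Longrightarrow> \<not> V i" "negn i j \<Longrightarrow> V i \<longleftrightarrow> \<not> V j" "conjn i j k \<Longrightarrow> V i \<longleftrightarrow> V j \<and> V k"
    "condn i j k \<Longrightarrow> V j \<Longrightarrow> V i \<longleftrightarrow> V k" "same i j \<Longrightarrow> V i \<longleftrightarrow> V j"
  using assms unfolding coherent_def by simp_all

text \<open>\<open>E\<close> stands in for provable equivalence, so the game itself does not mention
  derivability. One answer \<open>V'\<close> has to respect all conditionals whose antecedent is
  \<open>E\<close>-related to \<open>j\<close>, true and false ones alike. Coherence is tested for
  the answers only; that of the initial \<open>V\<close> is required separately.\<close>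

primrec game :: "((nat \<Rightarrow> bool) \<Rightarrow> bool) \<Rightarrow> (nat \<Rightarrow> nat \<Rightarrow> nat \<Rightarrow> bool) \<Rightarrow> (nat \<Rightarrow> nat \<Rightarrow> bool) \<Rightarrow> bool \<Rightarrow>
    (nat \<Rightarrow> nat \<Rightarrow> bool) \<Rightarrow> nat \<Rightarrow> (nat \<Rightarrow> bool) \<Rightarrow> bool" where
  "game coh condn le idf E 0 V = True"
| "game coh condn le idf E (Suc l) V =
     (\<forall>i j k. condn i j k \<and> le (Suc l) i \<and> \<not> V i \<and> \<not> V j \<longrightarrow>
       (\<exists>V'. coh V' \<and> (\<forall>i' j' k'. condn i' j' k' \<and> le (Suc l) i' \<and> E j' j \<longrightarrow> (V' k' \<longleftrightarrow> V i')) \<and>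
         (idf \<longrightarrow> V' j) \<and> game coh condn le idf E l V'))"

text \<open>An interface between formulas and indices: an index carries at most one formula, while a
  formula may have many indices. It is later instantiated with positions in a word and arithmetic
  predicates on them.\<close>

locale skeleton =
  fixes idf :: bool and fsz :: "'v fm \<Rightarrow> nat" and nd :: "nat \<Rightarrow> 'v fm \<Rightarrow> bool"
    and botn negn conjn condn same and le :: "nat \<Rightarrow> nat \<Rightarrow> bool"
  assumes nd_unique: "nd i A \<Longrightarrow> nd i B \<Longrightarrow> A = B"
    and fsz_pos: "fsz A > 0"
    and fsz_less: "fsz A < fsz (\<^bold>\<not> A)" "fsz A < fsz (A \<^bold>\<and> B)" "fsz B < fsz (A \<^bold>\<and> B)"
      "fsz A < fsz (A \<^bold>\<Rightarrow> B)" "fsz B < fsz (A \<^bold>\<Rightarrow> B)"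
    and nd_le: "nd i A \<Longrightarrow> le l i \<longleftrightarrow> fsz A \<le> l"
    and botn: "botn i \<longleftrightarrow> nd i \<^bold>\<bottom>"
    and negnD: "negn i j \<Longrightarrow> \<exists>A. nd i (\<^bold>\<not> A) \<and> nd j A"
    and negnI: "nd i (\<^bold>\<not> A) \<Longrightarrow> \<exists>j. negn i j \<and> nd j A"
    and conjnD: "conjn i j k \<Longrightarrow> \<exists>A B. nd i (A \<^bold>\<and> B) \<and> nd j A \<and> nd k B"
    and conjnI: "nd i (A \<^bold>\<and> B) \<Longrightarrow> \<exists>j k. conjn i j k \<and> nd j A \<and> nd k B"
    and condnD: "condn i j k \<Longrightarrow> \<exists>A B. nd i (A \<^bold>\<Rightarrow> B) \<and> nd j A \<and> nd k B"
    and condnI: "nd i (A \<^bold>\<Rightarrow> B) \<Longrightarrow> \<exists>j k. condn i j k \<and> nd j A \<and> nd k B"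
    and same: "same i j \<longleftrightarrow> (\<exists>A. nd i A \<and> nd j A)"
begin

abbreviation R where "R \<equiv> logic idf"
abbreviation coh where "coh \<equiv> coherent botn negn conjn condn same"
abbreviation "win \<equiv> game coh condn le idf"

text \<open>The inequality is strict because a conditional of size at most \<open>l\<close> has an
  antecedent of size below \<open>l\<close>.\<close>

definition equiv_ok :: "nat \<Rightarrow> (nat \<Rightarrow> nat \<Rightarrow> bool) \<Rightarrow> bool" where
  "equiv_ok l E \<longleftrightarrow> (\<forall>i j A B. nd i A \<and> nd j B \<and> fsz A < l \<and> fsz B < l \<longrightarrow>
     (E i j \<longleftrightarrow> R \<turnstile>\<^sub>H A \<^bold>\<longleftrightarrow> B))"

lemma equiv_okD:
  "equiv_ok l E \<Longrightarrow> nd i A \<Longrightarrow> nd j B \<Longrightarrow> fsz A < l \<Longrightarrow> fsz B < l \<Longrightarrow> E i j \<longleftrightarrow> R \<turnstile>\<^sub>H A \<^bold>\<longleftrightarrow> B"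
  unfolding equiv_ok_def by simp

section \<open>The canonical model and its extension by one world\<close>

definition proof_set :: "'v fm \<Rightarrow> 'v fm set set" where
  "proof_set A = {u. mcs R u \<and> A \<in> u}"

lemma proof_set_eq_iff: "proof_set A = proof_set B \<longleftrightarrow> R \<turnstile>\<^sub>H A \<^bold>\<longleftrightarrow> B"
proof
  assume eq: "proof_set A = proof_set B"
  show "R \<turnstile>\<^sub>H A \<^bold>\<longleftrightarrow> B"
  proof (rule ccontr)
    assume "\<not> R \<turnstile>\<^sub>H A \<^bold>\<longleftrightarrow> B"
    then obtain u where "mcs R u" "(A \<^bold>\<longleftrightarrow> B) \<notin> u" by (rule not_derivable_mcs)
    then show False using eq by (auto simp: proof_set_def mcs_Conj mcs_Neg)
  qed
next
  assume "R \<turnstile>\<^sub>H A \<^bold>\<longleftrightarrow> B"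
  then have "(A \<^bold>\<longleftrightarrow> B) \<in> u" if "mcs R u" for u using mcs_derivable that by blast
  then show "proof_set A = proof_set B" by (auto simp: proof_set_def mcs_Conj mcs_Neg)
qed

lemma mcs_Cond_cong:
  assumes "mcs R u" "proof_set A = proof_set A'"
  shows "A \<^bold>\<Rightarrow> B \<in> u \<longleftrightarrow> A' \<^bold>\<Rightarrow> B \<in> u"
proof -
  have "R \<turnstile>\<^sub>H (A \<^bold>\<Rightarrow> B) \<^bold>\<longleftrightarrow> (A' \<^bold>\<Rightarrow> B)"
    using derivable_RCEA[OF refl] assms(2) proof_set_eq_iff by blast
  then have "((A \<^bold>\<Rightarrow> B) \<^bold>\<longleftrightarrow> (A' \<^bold>\<Rightarrow> B)) \<in> u" using mcs_derivable assms(1) by blast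
  then show ?thesis using assms(1) by (auto simp: mcs_Conj mcs_Neg)
qed

lemma mcs_Cond_Neg:
  assumes "mcs R u" "A \<^bold>\<Rightarrow> B \<notin> u"
  shows "A \<^bold>\<Rightarrow> \<^bold>\<not> B \<in> u"
  using mcs_derivable[OF assms(1) derivable_CEM[OF refl, of idf A B]] assms by (auto simp: mcs_Conj mcs_Neg)

text \<open>\<open>MP\<close> gives the step from the conditional to its consequent. Applied to the
  negated consequent and combined with \<open>CEM\<close>, it also gives the converse.\<close>

lemma mcs_Cond_same:
  assumes "mcs R u" "A \<in> u"
  shows "A \<^bold>\<Rightarrow> B \<in> u \<longleftrightarrow> B \<in> u"
proof -
  have "C \<in> u" if "A \<^bold>\<Rightarrow> C \<in> u" for C
    using mcs_derivable[OF assms(1) derivable_MP[OF refl, of idf A C]] assms that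
    by (simp add: mcs_Conj mcs_Neg)
  then show ?thesis using mcs_Cond_Neg[OF assms(1), of A B] mcs_Neg[OF assms(1)] by blast
qed

text \<open>If the consequents of \<open>A\<close> in \<open>u\<close> were inconsistent,
  \<open>RCK\<close> would put every conditional with antecedent \<open>A\<close> into
  \<open>u\<close>. By \<open>CEM\<close> they form a complete set, so the Lindenbaum extension adds
  nothing, and the second claim is an equivalence.\<close>

lemma mcs_Cond_witness:
  assumes u: "mcs R u" and nB: "A \<^bold>\<Rightarrow> B \<notin> u"
  obtains v where "mcs R v" "\<And>C. A \<^bold>\<Rightarrow> C \<in> u \<longleftrightarrow> C \<in> v" "idf \<Longrightarrow> A \<in> v"
proof -
  have "con R {C. A \<^bold>\<Rightarrow> C \<in> u}"
    unfolding con_def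
  proof (intro allI impI notI)
    fix Bs assume Bs: "set Bs \<subseteq> {C. A \<^bold>\<Rightarrow> C \<in> u}" "R \<turnstile>\<^sub>H imps Bs \<^bold>\<bottom>"
    have "R \<turnstile>\<^sub>H imps Bs B" by (rule derivable_prop1[OF Bs(2)]) auto
    from derivable_RCK[OF refl this]
    have "R \<turnstile>\<^sub>H imps (map (Cond A) Bs) (A \<^bold>\<Rightarrow> B)" .
    then have "A \<^bold>\<Rightarrow> B \<in> u" by (rule mcs_closed[OF u, rotated]) (use Bs(1) in auto)
    then show False using nB by blast
  qed
  then obtain v where v: "{C. A \<^bold>\<Rightarrow> C \<in> u} \<subseteq> v" "mcs R v" by (rule lindenbaum)
  have "A \<^bold>\<Rightarrow> C \<in> u \<longleftrightarrow> C \<in> v" for C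
    using v mcs_Cond_Neg[OF u, of A C] mcs_Neg[OF v(2)] by blast
  moreover have "A \<in> v" if idf
    using v(1) mcs_derivable[OF u derivable_ID[OF refl that]] that by auto
  ultimately show thesis using that v(2) by metis
qed

text \<open>Worlds are arbitrary sets of formulas, so a proposition \<open>Y\<close> is matched with
  a formula only on its maximal consistent members. The selected world is the set of consequents
  that \<open>w\<close> attaches to that formula; by \<open>RCEA\<close> the choice among formulas
  defining \<open>Y\<close> is immaterial.\<close>

definition canon :: "'v fm set \<Rightarrow> 'v fm set set \<Rightarrow> 'v fm set set" where
  "canon w Y = (if w \<in> Y then {w} else
     {v. mcs R v \<and> (\<exists>A. proof_set A = {u \<in> Y. mcs R u} \<and> (\<forall>B. A \<^bold>\<Rightarrow> B \<in> w \<longleftrightarrow> B \<in> v) \<and> (idf \<longrightarrow> A \<in> v))})"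

lemma canon_selection:
  assumes "mcs R w"
  shows "w \<in> Y \<Longrightarrow> w \<in> canon w Y" "a \<in> canon w Y \<Longrightarrow> b \<in> canon w Y \<Longrightarrow> a = b"
    "idf \<Longrightarrow> canon w Y \<subseteq> Y"
proof -
  show "w \<in> Y \<Longrightarrow> w \<in> canon w Y" by (simp add: canon_def)
  show "a = b" if ab: "a \<in> canon w Y" "b \<in> canon w Y"
  proof (cases "w \<in> Y")
    case False
    obtain A where A: "proof_set A = {u \<in> Y. mcs R u}" "\<And>B. A \<^bold>\<Rightarrow> B \<in> w \<longleftrightarrow> B \<in> a"
      using ab(1) False unfolding canon_def by auto
    obtain A' where A': "proof_set A' = {u \<in> Y. mcs R u}" "\<And>B. A' \<^bold>\<Rightarrow> B \<in> w \<longleftrightarrow> B \<in> b"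
      using ab(2) False unfolding canon_def by auto
    show ?thesis using mcs_Cond_cong[OF assms, of A A'] A A' by auto
  qed (use ab in \<open>auto simp: canon_def\<close>)
  show "canon w Y \<subseteq> Y" if idf
  proof
    fix x assume "x \<in> canon w Y"
    then have "w \<in> Y \<and> x = w \<or> (\<exists>A. mcs R x \<and> proof_set A = {u \<in> Y. mcs R u} \<and> A \<in> x)"
      using that unfolding canon_def by (auto split: if_splits)
    then show "x \<in> Y" unfolding proof_set_def by blast
  qed
qed

text \<open>The empty set is never maximal consistent; it serves as the additional world.\<close>

lemma not_mcs_empty: "\<not> mcs R {}"
  by (auto simp: mcs_def)

text \<open>\<open>h\<close> and \<open>p\<close> are the selection and the valuation at the new
  world. The assumptions are the three selection conditions at that world.\<close>

context
  fixes h :: "'v fm set set \<Rightarrow> 'v fm set set" and p :: "'v \<Rightarrow> bool"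
  assumes h: "{} \<in> X \<Longrightarrow> h X = {{}}" "a \<in> h X \<Longrightarrow> b \<in> h X \<Longrightarrow> a = b" "idf \<Longrightarrow> h X \<subseteq> X"
begin

text \<open>Sets that are neither empty nor maximal consistent are junk worlds;
  \<open>{w} \<inter> Y\<close> makes them satisfy the selection conditions.\<close>

definition sel where
  "sel w Y = (if w = {} then h Y else if mcs R w then canon w Y else {w} \<inter> Y)"

definition val where "val w q = (if w = {} then p q else Var q \<in> w)"

lemma sel_selection: "selection idf sel"
  unfolding selection_def sel_def
  using canon_selection h by (auto split: if_splits)

text \<open>From a maximal consistent set only maximal consistent sets are selected, and
  \<open>canon\<close> inspects a proposition only on such sets. Hence the new world cannot disturb
  truth at the old ones, whatever \<open>h\<close> and \<open>p\<close> are.\<close>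

lemma canonical_truth: "mcs R w \<Longrightarrow> holds sel val A w \<longleftrightarrow> A \<in> w"
proof (induction A arbitrary: w)
  case (Cond A B)
  let ?Y = "{u. holds sel val A u}"
  have Y: "proof_set A = {u \<in> ?Y. mcs R u}" using Cond.IH(1) by (auto simp: proof_set_def)
  have sel: "sel w ?Y = canon w ?Y" using Cond.prems not_mcs_empty by (auto simp: sel_def)
  show ?case
  proof (cases "A \<in> w")
    case True
    then have "sel w ?Y = {w}" using sel Cond by (simp add: canon_def)
    then show ?thesis using Cond mcs_Cond_same[OF Cond.prems True] by simp
  next
    case False
    then have c: "canon w ?Y = {v. mcs R v \<and> (\<exists>A'. proof_set A' = proof_set A \<and>
       (\<forall>B. A' \<^bold>\<Rightarrow> B \<in> w \<longleftrightarrow> B \<in> v) \<and> (idf \<longrightarrow> A' \<in> v))}"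
      using Cond Y by (auto simp: canon_def)
    show ?thesis
    proof
      assume L: "holds sel val (A \<^bold>\<Rightarrow> B) w"
      show "A \<^bold>\<Rightarrow> B \<in> w"
      proof (rule ccontr)
        assume nB: "A \<^bold>\<Rightarrow> B \<notin> w"
        obtain v where v: "mcs R v" "\<And>C. A \<^bold>\<Rightarrow> C \<in> w \<longleftrightarrow> C \<in> v" "idf \<Longrightarrow> A \<in> v"
          by (rule mcs_Cond_witness[OF Cond.prems nB]) blast
        then have "v \<in> canon w ?Y" unfolding c by auto
        then have "holds sel val B v" using L sel by simp
        then show False using Cond.IH(2)[OF v(1)] v(2) nB by simp
      qed
    next
      assume R: "A \<^bold>\<Rightarrow> B \<in> w"
      have "holds sel val B v" if v: "v \<in> canon w ?Y" for v
      proof -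
        obtain A' where A': "mcs R v" "proof_set A' = proof_set A" "\<And>B. A' \<^bold>\<Rightarrow> B \<in> w \<longleftrightarrow> B \<in> v"
          using v unfolding c mem_Collect_eq by blast
        then show ?thesis using Cond.IH(2) mcs_Cond_cong[OF Cond.prems A'(2)] R by auto
      qed
      then show "holds sel val (A \<^bold>\<Rightarrow> B) w" using sel by simp
    qed
  qed
qed (use not_mcs_empty in \<open>auto simp: val_def mcs_Bot mcs_Neg mcs_Conj\<close>)

end

text \<open>Consistency of the logic: selecting \<open>{w} \<inter> X\<close> gives a model.\<close>

lemma ex_mcs: "\<exists>u. mcs R u"
  using theory_mcs[of idf "\<lambda>w X. {w} \<inter> X"] by (force simp: selection_def)

section \<open>Winning valuations and maximal consistent sets\<close>

lemma condn_small:
  assumes "condn i j k" "le (Suc l) i"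
  shows "nd j A \<Longrightarrow> fsz A \<le> l" "nd k B \<Longrightarrow> fsz B \<le> l"
proof -
  obtain A' B' where AB: "nd i (A' \<^bold>\<Rightarrow> B')" "nd j A'" "nd k B'" using condnD[OF assms(1)] by blast
  have "fsz (A' \<^bold>\<Rightarrow> B') \<le> Suc l" using nd_le[OF AB(1)] assms(2) by blast
  then have "fsz A' \<le> l" "fsz B' \<le> l" using fsz_less(4)[of A' B'] fsz_less(5)[of B' A'] by linarith+
  then show "nd j A \<Longrightarrow> fsz A \<le> l" "nd k B \<Longrightarrow> fsz B \<le> l"
    using nd_unique AB(2,3) by metis+
qed

text \<open>The induction hypothesis turns the answers of the game into maximal consistent sets that
  agree with them up to size \<open>l\<close>. These become the successors of a new world of the
  extended canonical model, and the theory of that world is the required set.\<close>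

lemma win_realizable:
  assumes "coh V" "win E l V" "equiv_ok l E"
  shows "\<exists>u. mcs R u \<and> (\<forall>i A. nd i A \<and> fsz A \<le> l \<longrightarrow> (V i \<longleftrightarrow> A \<in> u))"
  using assms
proof (induction l arbitrary: V)
  case 0
  have "\<not> fsz A \<le> 0" for A :: "'v fm" using fsz_pos[of A] by linarith
  then show ?case using ex_mcs by blast
next
  case (Suc l)
  \<comment> \<open>The conditionals that demand a successor, as in the game.\<close>
  define bad where "bad = (\<lambda>i j k. condn i j k \<and> le (Suc l) i \<and> \<not> V i \<and> \<not> V j)"
  \<comment> \<open>\<open>u\<close> meets all demands of the whole \<open>E\<close>-class of the
    antecedent \<open>j\<close>.\<close>
  define good where "good = (\<lambda>j u. mcs R u \<and> (idf \<longrightarrow> (\<forall>A. nd j A \<longrightarrow> A \<in> u)) \<and>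
    (\<forall>i' j' k' B. condn i' j' k' \<and> le (Suc l) i' \<and> E j' j \<and> nd k' B \<longrightarrow> (B \<in> u \<longleftrightarrow> V i')))"
  have E': "equiv_ok l E" using Suc.prems(3) by (auto simp: equiv_ok_def)
  have ex_good: "\<exists>u. good j u" if bad: "bad i j k" for i j k
  proof -
    have "\<exists>V'. coh V' \<and> (\<forall>i' j' k'. condn i' j' k' \<and> le (Suc l) i' \<and> E j' j \<longrightarrow> (V' k' \<longleftrightarrow> V i')) \<and>
         (idf \<longrightarrow> V' j) \<and> win E l V'"
      using Suc.prems(2) bad unfolding bad_def game.simps by blast
    then obtain V' where V': "coh V'" "idf \<longrightarrow> V' j" "win E l V'"
      and k': "\<And>i' j' k'. condn i' j' k' \<Longrightarrow> le (Suc l) i' \<Longrightarrow> E j' j \<Longrightarrow> V' k' \<longleftrightarrow> V i'"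
      by blast
    obtain u where u: "mcs R u" "\<And>i A. nd i A \<Longrightarrow> fsz A \<le> l \<Longrightarrow> V' i \<longleftrightarrow> A \<in> u"
      using Suc.IH[OF V'(1,3) E'] by blast
    have "good j u"
      unfolding good_def
    proof (intro conjI allI impI)
      show "mcs R u" by (rule u)
    next
      fix A assume "idf" "nd j A"
      then have "fsz A \<le> l" using bad condn_small(1) unfolding bad_def by blast
      then show "A \<in> u" using u(2)[OF \<open>nd j A\<close>] V'(2) \<open>idf\<close> by blast
    next
      fix i' j' k' B assume a: "condn i' j' k' \<and> le (Suc l) i' \<and> E j' j \<and> nd k' B"
      then have "fsz B \<le> l" using condn_small(2) by blast
      then show "B \<in> u \<longleftrightarrow> V i'" using u(2)[of k' B] k'[of i' j' k'] a by blast
    qed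
    then show ?thesis ..
  qed
  \<comment> \<open>The proposition \<open>X\<close> coincides on the canonical model with the
    antecedent of some demanding conditional.\<close>
  define sc where "sc = (\<lambda>X t. case t of (i, j, k, A) \<Rightarrow> bad i j k \<and> nd j A \<and> proof_set A = {u \<in> X. mcs R u})"
  \<comment> \<open>Several demanding conditionals may define the same \<open>X\<close>. Choosing
    one of them first, and then one good world for it, keeps the selection at most a
    singleton.\<close>
  define h where "h = (\<lambda>X. if {} \<in> X then {{}} else
     if \<exists>t. sc X t then {SOME u. good (case SOME t. sc X t of (i, j, k, A) \<Rightarrow> j) u} else {})"
  define p where "p = (\<lambda>q. \<exists>i. nd i (Var q) \<and> V i)"
  have hE: "\<exists>i j k A u. bad i j k \<and> nd j A \<and> proof_set A = {u \<in> X. mcs R u} \<and> good j u \<and> h X = {u}"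
    if "\<exists>t. sc X t" "{} \<notin> X" for X
  proof -
    obtain i j k A where t: "(SOME t. sc X t) = (i, j, k, A)" by (metis surj_pair)
    then have "sc X (i, j, k, A)" using that(1) someI_ex[of "sc X"] by simp
    then have b: "bad i j k" "nd j A" "proof_set A = {u \<in> X. mcs R u}" by (auto simp: sc_def)
    have "h X = {SOME u. good j u}" using that t by (simp add: h_def)
    moreover have "good j (SOME u. good j u)" using someI_ex[OF ex_good[OF b(1)]] .
    ultimately show ?thesis using b by blast
  qed
  have h1: "h X = {{}}" if "{} \<in> X" for X using that by (simp add: h_def)
  have h2: "a = b" if "a \<in> h X" "b \<in> h X" for a b X using that by (simp add: h_def split: if_splits)
  have h3: "h X \<subseteq> X" if idf for X
  proof (cases "{} \<in> X \<or> \<not> (\<exists>t. sc X t)")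
    case True
    then show ?thesis by (auto simp: h_def)
  next
    case False
    then obtain i j k A u where t: "nd j A" "proof_set A = {u \<in> X. mcs R u}" "good j u" "h X = {u}"
      using hE[of X] by blast
    have "mcs R u" "A \<in> u" using t(1,3) that unfolding good_def by blast+
    then have "u \<in> proof_set A" unfolding proof_set_def by blast
    then show ?thesis unfolding t(2,4) by simp
  qed
  note hh = h1 h2 h3
  let ?sel = "sel h" and ?val = "val p"
  \<comment> \<open>The truth lemma at the new world, for indexed formulas up to the current
    size.\<close>
  have truth: "holds ?sel ?val A {} \<longleftrightarrow> V i" if "nd i A" "fsz A \<le> Suc l" for i A
    using that
  proof (induction A arbitrary: i)
    case Bot
    then show ?case using coherentD(1)[OF Suc.prems(1)] botn by simp
  next
    case (Var q)
    have "V j \<longleftrightarrow> V i" if "nd j (Var q)" for j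
    proof -
      have "same j i" using same that Var.prems(1) by metis
      then show ?thesis by (rule coherentD(5)[OF Suc.prems(1)])
    qed
    then have "p q \<longleftrightarrow> V i" using Var.prems(1) unfolding p_def by metis
    then show ?case by (simp add: val_def[OF hh])
  next
    case (Neg A)
    obtain j where j: "negn i j" "nd j A" using negnI[OF Neg.prems(1)] by blast
    have "holds ?sel ?val A {} \<longleftrightarrow> V j" using Neg.IH[OF j(2)] Neg.prems(2) fsz_less(1)[of A] by linarith
    moreover have "V i \<longleftrightarrow> \<not> V j" by (rule coherentD(2)[OF Suc.prems(1) j(1)])
    ultimately show ?case by simp
  next
    case (Conj A B)
    obtain j k where j: "conjn i j k" "nd j A" "nd k B" using conjnI[OF Conj.prems(1)] by blast
    have "holds ?sel ?val A {} \<longleftrightarrow> V j" using Conj.IH(1)[OF j(2)] Conj.prems(2) fsz_less(2)[of A B] by linarith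
    moreover have "holds ?sel ?val B {} \<longleftrightarrow> V k" using Conj.IH(2)[OF j(3)] Conj.prems(2) fsz_less(3)[of B A] by linarith
    moreover have "V i \<longleftrightarrow> V j \<and> V k" by (rule coherentD(3)[OF Suc.prems(1) j(1)])
    ultimately show ?case by simp
  next
    case (Cond A B)
    obtain j k where j: "condn i j k" "nd j A" "nd k B" using condnI[OF Cond.prems(1)] by blast
    have szA: "fsz A \<le> l" and szB: "fsz B \<le> l"
      using Cond.prems(2) fsz_less(4)[of A B] fsz_less(5)[of B A] by linarith+
    have A: "holds ?sel ?val A {} \<longleftrightarrow> V j" using Cond.IH(1)[OF j(2)] szA by linarith
    have B: "holds ?sel ?val B {} \<longleftrightarrow> V k" using Cond.IH(2)[OF j(3)] szB by linarith
    have le: "le (Suc l) i" using nd_le[OF Cond.prems(1)] Cond.prems(2) by blast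
    let ?Y = "{u. holds ?sel ?val A u}"
    have Y: "proof_set A = {u \<in> ?Y. mcs R u}"
      using canonical_truth[OF hh, where p = p] by (auto simp: proof_set_def)
    have s: "?sel {} ?Y = h ?Y" by (simp add: sel_def[OF hh])
    show ?case
    proof (cases "V j")
      case True
      then have "h ?Y = {{}}" using A by (simp add: h_def)
      moreover have "V i \<longleftrightarrow> V k" by (rule coherentD(4)[OF Suc.prems(1) j(1) True])
      ultimately show ?thesis using s B by simp
    next
      case False
      then have nY: "{} \<notin> ?Y" using A by simp
      show ?thesis
      proof (cases "\<exists>t. sc ?Y t")
        case ex: True
        from hE[OF ex nY] obtain i0 j0 k0 A0 u where t: "bad i0 j0 k0" "nd j0 A0"
          "proof_set A0 = {u \<in> ?Y. mcs R u}" "good j0 u" "h ?Y = {u}"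
          by (elim exE conjE) (rule that)
        \<comment> \<open>The chosen representative \<open>A0\<close> may differ from
          \<open>A\<close>, but both define the same proposition and so are provably equivalent.
          Both have size at most \<open>l\<close>, where \<open>E\<close> is correct, so the world
          that is good for \<open>j0\<close> also decides \<open>B\<close>.\<close>
        have "proof_set A = proof_set A0" unfolding t(3) by (rule Y)
        then have AA: "R \<turnstile>\<^sub>H A \<^bold>\<longleftrightarrow> A0" using proof_set_eq_iff by blast
        have "fsz A0 \<le> l" using condn_small(1) t(1,2) unfolding bad_def by blast
        then have "E j j0" using equiv_okD[OF Suc.prems(3) j(2) t(2)] szA AA by simp
        then have "B \<in> u \<longleftrightarrow> V i" using t(4) j le unfolding good_def by blast
        moreover have "holds ?sel ?val B u \<longleftrightarrow> B \<in> u"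
          by (rule canonical_truth[OF hh]) (use t(4) in \<open>auto simp: good_def\<close>)
        ultimately show ?thesis using s t(5) by simp
      next
        case nex: False
        \<comment> \<open>A false conditional would itself demand a successor for \<open>?Y\<close>.
          So it is true, in accordance with the empty selection.\<close>
        have "V i"
        proof (rule ccontr)
          assume "\<not> V i"
          then have "sc ?Y (i, j, k, A)" using j le False Y by (auto simp: sc_def bad_def)
          then show False using nex by blast
        qed
        then show ?thesis using s nex nY by (simp add: h_def)
      qed
    qed
  qed
  have "mcs R {A. holds ?sel ?val A {}}" by (rule theory_mcs[OF sel_selection[OF hh]])
  moreover have "\<forall>i A. nd i A \<and> fsz A \<le> Suc l \<longrightarrow> (V i \<longleftrightarrow> A \<in> {A. holds ?sel ?val A {}})"
    using truth by blast
  ultimately show ?case by blast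
qed

definition val_of :: "'v fm set \<Rightarrow> nat \<Rightarrow> bool" where
  "val_of u i \<longleftrightarrow> (\<exists>A. nd i A \<and> A \<in> u)"

lemma val_of_nd: "nd i A \<Longrightarrow> val_of u i \<longleftrightarrow> A \<in> u"
  using nd_unique by (auto simp: val_of_def)

lemma coh_val_of:
  assumes "mcs R u"
  shows "coh (val_of u)"
  unfolding coherent_def
proof (intro conjI allI impI)
  show "\<not> val_of u i" if "botn i" for i
    using that botn val_of_nd mcs_Bot[OF assms] by blast
  show "val_of u i \<longleftrightarrow> \<not> val_of u j" if ij: "negn i j" for i j
    using negnD[OF ij] val_of_nd mcs_Neg[OF assms] by metis
  show "val_of u i \<longleftrightarrow> val_of u j \<and> val_of u k" if ij: "conjn i j k" for i j k
    using conjnD[OF ij] val_of_nd mcs_Conj[OF assms] by metis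
  show "val_of u i \<longleftrightarrow> val_of u k" if ij: "condn i j k \<and> val_of u j" for i j k
    using condnD[of i j k] ij val_of_nd mcs_Cond_same[OF assms] by metis
  show "val_of u i \<longleftrightarrow> val_of u j" if ij: "same i j" for i j
    using same[of i j] ij val_of_nd by metis
qed

text \<open>The answer to a challenge is the valuation of the witness from
  \<open>mcs_Cond_witness\<close>. \<open>RCEA\<close> lets the same witness serve all equivalent
  antecedents.\<close>

lemma win_val_of:
  assumes "mcs R u" "equiv_ok l E"
  shows "win E l (val_of u)"
  using assms
proof (induction l arbitrary: u)
  case (Suc l)
  have "\<exists>V'. coh V' \<and> (\<forall>i' j' k'. condn i' j' k' \<and> le (Suc l) i' \<and> E j' j \<longrightarrow> (V' k' \<longleftrightarrow> val_of u i')) \<and>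
         (idf \<longrightarrow> V' j) \<and> win E l V'" if a: "condn i j k" "le (Suc l) i" "\<not> val_of u i" for i j k
  proof -
    obtain A B where AB: "nd i (A \<^bold>\<Rightarrow> B)" "nd j A" "nd k B" using condnD[OF a(1)] by blast
    then have nB: "A \<^bold>\<Rightarrow> B \<notin> u" using a(3) val_of_nd by blast
    obtain v where v: "mcs R v" "\<And>C. A \<^bold>\<Rightarrow> C \<in> u \<longleftrightarrow> C \<in> v" "idf \<Longrightarrow> A \<in> v"
      by (rule mcs_Cond_witness[OF Suc.prems(1) nB]) blast
    have szA: "fsz A \<le> l" using condn_small(1)[OF a(1,2) AB(2)] .
    have "val_of v k' \<longleftrightarrow> val_of u i'" if b: "condn i' j' k'" "le (Suc l) i'" "E j' j" for i' j' k'
    proof -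
      obtain A' B' where AB': "nd i' (A' \<^bold>\<Rightarrow> B')" "nd j' A'" "nd k' B'" using condnD[OF b(1)] by blast
      have "fsz A' \<le> l" using condn_small(1)[OF b(1,2) AB'(2)] .
      then have "R \<turnstile>\<^sub>H A' \<^bold>\<longleftrightarrow> A" using equiv_okD[OF Suc.prems(2) AB'(2) AB(2)] szA b(3) by simp
      then have "proof_set A' = proof_set A" using proof_set_eq_iff by blast
      then show ?thesis
        using mcs_Cond_cong[OF Suc.prems(1), of A' A B'] v(2) val_of_nd AB' by simp
    qed
    moreover have "win E l (val_of v)"
      by (rule Suc.IH[OF v(1)]) (use Suc.prems(2) in \<open>auto simp: equiv_ok_def\<close>)
    moreover have "idf \<longrightarrow> val_of v j" using v(3) val_of_nd[OF AB(2)] by simp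
    ultimately show ?thesis using coh_val_of[OF v(1)] by blast
  qed
  then show ?case by auto
qed simp

section \<open>Provable equivalence as the solution of an equation\<close>

definition equiv_spec :: "nat \<Rightarrow> (nat \<Rightarrow> nat \<Rightarrow> bool) \<Rightarrow> bool" where
  "equiv_spec n E \<longleftrightarrow> (\<forall>l\<le>n. \<forall>i j. le l i \<and> le l j \<and> same i i \<and> same j j \<longrightarrow>
     (E i j \<longleftrightarrow> \<not> (\<exists>V. coh V \<and> (V i \<longleftrightarrow> \<not> V j) \<and> win E l V)))"

text \<open>Formulas that are not provably equivalent are told apart by a maximal consistent set,
  and up to size \<open>l\<close> such sets and winning coherent valuations have the same
  restrictions.\<close>

lemma separation:
  assumes "equiv_ok l E" "nd i A" "nd j B" "fsz A \<le> l" "fsz B \<le> l"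
  shows "R \<turnstile>\<^sub>H A \<^bold>\<longleftrightarrow> B \<longleftrightarrow> \<not> (\<exists>V. coh V \<and> (V i \<longleftrightarrow> \<not> V j) \<and> win E l V)"
proof
  assume AB: "R \<turnstile>\<^sub>H A \<^bold>\<longleftrightarrow> B"
  show "\<not> (\<exists>V. coh V \<and> (V i \<longleftrightarrow> \<not> V j) \<and> win E l V)"
  proof clarify
    fix V assume V: "coh V" "win E l V" "V i \<longleftrightarrow> \<not> V j"
    obtain u where u: "mcs R u" "V i \<longleftrightarrow> A \<in> u" "V j \<longleftrightarrow> B \<in> u"
      using win_realizable[OF V(1,2) assms(1)] assms by blast
    moreover have "(A \<^bold>\<longleftrightarrow> B) \<in> u" using mcs_derivable[OF u(1) AB] .
    ultimately show False using V(3) by (auto simp: mcs_Conj mcs_Neg)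
  qed
next
  assume no: "\<not> (\<exists>V. coh V \<and> (V i \<longleftrightarrow> \<not> V j) \<and> win E l V)"
  show "R \<turnstile>\<^sub>H A \<^bold>\<longleftrightarrow> B"
  proof (rule ccontr)
    assume "\<not> R \<turnstile>\<^sub>H A \<^bold>\<longleftrightarrow> B"
    then obtain u where u: "mcs R u" "(A \<^bold>\<longleftrightarrow> B) \<notin> u" by (rule not_derivable_mcs)
    then have "A \<in> u \<longleftrightarrow> B \<notin> u" by (auto simp: mcs_Conj mcs_Neg)
    then have "val_of u i \<longleftrightarrow> \<not> val_of u j" using val_of_nd assms by simp
    then show False using no coh_val_of[OF u(1)] win_val_of[OF u(1) assms(1)] by blast
  qed
qed

text \<open>At level \<open>l\<close> the right-hand side of the equation consults \<open>E\<close>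
  only on sizes below \<open>l\<close>. If \<open>E\<close> is correct there, the equation makes it
  correct on sizes up to \<open>l\<close>.\<close>

lemma equiv_spec_unique:
  assumes "equiv_spec n E" "l \<le> Suc n"
  shows "equiv_ok l E"
  using assms(2)
proof (induction l)
  case (Suc l)
  then have IH: "equiv_ok l E" by simp
  show ?case
    unfolding equiv_ok_def
  proof (intro allI impI)
    fix i j A B assume a: "nd i A \<and> nd j B \<and> fsz A < Suc l \<and> fsz B < Suc l"
    then have "le l i" "le l j" "same i i" "same j j" using nd_le same by auto
    then have "E i j \<longleftrightarrow> \<not> (\<exists>V. coh V \<and> (V i \<longleftrightarrow> \<not> V j) \<and> win E l V)"
      using assms(1) Suc.prems unfolding equiv_spec_def by auto
    then show "E i j \<longleftrightarrow> R \<turnstile>\<^sub>H A \<^bold>\<longleftrightarrow> B" using separation[OF IH, of i A j B] a by auto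
  qed
qed (simp add: equiv_ok_def)

text \<open>A solution has to meet the equation at every level that covers both indices. Provable
  equivalence does, since \<open>separation\<close> works at any such level.\<close>

lemma equiv_spec_exists:
  assumes "\<And>i j A B. nd i A \<Longrightarrow> nd j B \<Longrightarrow> E i j \<longleftrightarrow> R \<turnstile>\<^sub>H A \<^bold>\<longleftrightarrow> B"
  shows "equiv_spec n E"
  unfolding equiv_spec_def
proof (intro allI impI)
  fix l i j assume "le l i \<and> le l j \<and> same i i \<and> same j j"
  moreover from this obtain A B where "nd i A" "nd j B" using same by blast
  moreover have "equiv_ok l E" using assms by (simp add: equiv_ok_def)
  ultimately show "E i j \<longleftrightarrow> \<not> (\<exists>V. coh V \<and> (V i \<longleftrightarrow> \<not> V j) \<and> win E l V)"
    using separation[of l E i A j B] assms nd_le by simp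
qed

lemma derivable_iff_no_win:
  assumes "equiv_spec n E" "nd i A" "fsz A \<le> n"
  shows "R \<turnstile>\<^sub>H A \<longleftrightarrow> \<not> (\<exists>V. coh V \<and> \<not> V i \<and> win E n V)"
proof -
  have ok: "equiv_ok n E" using equiv_spec_unique[OF assms(1)] by simp
  show ?thesis
  proof
    assume d: "R \<turnstile>\<^sub>H A"
    show "\<not> (\<exists>V. coh V \<and> \<not> V i \<and> win E n V)"
    proof clarify
      fix V assume V: "coh V" "win E n V" "\<not> V i"
      obtain u where "mcs R u" "V i \<longleftrightarrow> A \<in> u" using win_realizable[OF V(1,2) ok] assms by blast
      then show False using V(3) mcs_derivable[OF _ d] by blast
    qed
  next
    assume no: "\<not> (\<exists>V. coh V \<and> \<not> V i \<and> win E n V)"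
    show "R \<turnstile>\<^sub>H A"
    proof (rule ccontr)
      assume "\<not> R \<turnstile>\<^sub>H A"
      then obtain u where u: "mcs R u" "A \<notin> u" by (rule not_derivable_mcs)
      then show False
        using no coh_val_of[OF u(1)] win_val_of[OF u(1) ok] val_of_nd[OF assms(2)] by blast
    qed
  qed
qed

end

section \<open>Primitive recursive expressions and counter programs\<close>

text \<open>Variables are de Bruijn indices. In \<open>ERec n i s\<close> the step \<open>s\<close>
  sees the accumulator as variable 0 and the round number as variable 1; \<open>ERen\<close>
  provides weakening.\<close>

datatype exp = EVar nat | EZero | ESuc exp | ELet exp exp | ERen "nat \<Rightarrow> nat" exp | ERec exp exp exp

type_synonym env = "nat \<Rightarrow> nat"

abbreviation push :: "nat \<Rightarrow> env \<Rightarrow> env" where "push a e \<equiv> case_nat a e"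

primrec eval :: "exp \<Rightarrow> env \<Rightarrow> nat" where
  "eval (EVar i) e = e i"
| "eval EZero e = 0"
| "eval (ESuc a) e = Suc (eval a e)"
| "eval (ELet a b) e = eval b (push (eval a e) e)"
| "eval (ERen f a) e = eval a (\<lambda>i. e (f i))"
| "eval (ERec n i s) e = rec_nat (eval i e) (\<lambda>k a. eval s (push a (push k e))) (eval n e)"

text \<open>All intermediate values are bounded and not only the result, because each of them
  occupies a register of the compiled program.\<close>

primrec vals_below :: "nat \<Rightarrow> exp \<Rightarrow> env \<Rightarrow> bool" where
  "vals_below B (EVar i) e \<longleftrightarrow> e i < B"
| "vals_below B EZero e \<longleftrightarrow> 0 < B"
| "vals_below B (ESuc a) e \<longleftrightarrow> vals_below B a e \<and> Suc (eval a e) < B"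
| "vals_below B (ELet a b) e \<longleftrightarrow> vals_below B a e \<and> vals_below B b (push (eval a e) e)"
| "vals_below B (ERen f a) e \<longleftrightarrow> vals_below B a (\<lambda>i. e (f i))"
| "vals_below B (ERec n i s) e \<longleftrightarrow> vals_below B n e \<and> vals_below B i e \<and>
     (\<forall>k < eval n e. vals_below B s
        (push (rec_nat (eval i e) (\<lambda>k a. eval s (push a (push k e))) k) (push k e)))"

lemma vals_below_eval: "vals_below B a e \<Longrightarrow> eval a e < B"
proof (induction a arbitrary: e)
  case (ERec n i s)
  then show ?case by (cases "eval n e") auto
qed auto

lemma vals_below_mono: "vals_below B a e \<Longrightarrow> B \<le> B' \<Longrightarrow> vals_below B' a e"
  by (induction a arbitrary: e) fastforce+

section \<open>Counter programs and their compilation from expressions\<close>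

datatype 'a com = Inc nat | Dec nat | Seq "'a com" "'a com" | While nat "'a com"
  | ReadLoop "'a \<Rightarrow> 'a com"

text \<open>A derivation certifies termination and, through the side condition of
  \<open>Inc\<close>, that no register is ever raised to \<open>B\<close> or beyond.\<close>

inductive exec :: "nat \<Rightarrow> 'a com \<Rightarrow> env \<times> 'a list \<Rightarrow> env \<times> 'a list \<Rightarrow> bool" for B where
  Inc: "Suc (s r) < B \<Longrightarrow> exec B (Inc r) (s, w) (s(r := Suc (s r)), w)"
| Dec: "0 < s r \<Longrightarrow> exec B (Dec r) (s, w) (s(r := s r - 1), w)"
| Seq: "exec B a c c' \<Longrightarrow> exec B b c' c'' \<Longrightarrow> exec B (Seq a b) c c''"
| WhileF: "s r = 0 \<Longrightarrow> exec B (While r a) (s, w) (s, w)"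
| WhileT: "0 < s r \<Longrightarrow> exec B a (s, w) c \<Longrightarrow> exec B (While r a) c c' \<Longrightarrow> exec B (While r a) (s, w) c'"
| ReadE: "exec B (ReadLoop g) (s, []) (s, [])"
| ReadC: "exec B (g l) (s, w) c \<Longrightarrow> exec B (ReadLoop g) c c' \<Longrightarrow> exec B (ReadLoop g) (s, l # w) c'"

lemma exec_eq: "exec B a c c' \<Longrightarrow> c' = c'' \<Longrightarrow> exec B a c c''"
  by simp

definition clear :: "nat \<Rightarrow> 'a com" where "clear r = While r (Dec r)"

definition move :: "nat \<Rightarrow> nat \<Rightarrow> 'a com" where "move a b = While a (Seq (Dec a) (Inc b))"

lemma exec_clear: "exec B (clear r) (s, w) (s(r := 0), w)"
proof (induction "s r" arbitrary: s)
  case 0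
  then show ?case unfolding clear_def by (intro exec_eq[OF exec.WhileF]) auto
next
  case (Suc n)
  have "exec B (clear r) (s(r := s r - 1), w) ((s(r := s r - 1))(r := 0), w)"
    by (rule Suc(1)) (use Suc(2) in simp)
  then have 1: "exec B (While r (Dec r)) (s(r := s r - 1), w) (s(r := 0), w)" by (simp add: clear_def)
  have 2: "0 < s r" using Suc(2) by simp
  show ?case unfolding clear_def by (rule exec.WhileT[OF 2 exec.Dec[of s r, OF 2] 1])
qed

lemma exec_move:
  assumes "a \<noteq> b" "s a + s b < B"
  shows "exec B (move a b) (s, w) (s(a := 0, b := s a + s b), w)"
  using assms(2)
proof (induction "s a" arbitrary: s)
  case 0
  then have "s(a := 0, b := s a + s b) = s" by auto
  then show ?case using 0 unfolding move_def by (intro exec_eq[OF exec.WhileF]) auto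
next
  case (Suc n)
  let ?s = "s(a := s a - 1, b := Suc (s b))"
  have "exec B (move a b) (?s, w) (?s(a := 0, b := ?s a + ?s b), w)"
    by (rule Suc(1)) (use Suc(2,3) assms(1) in auto)
  moreover have "?s(a := 0, b := ?s a + ?s b) = s(a := 0, b := s a + s b)"
    using Suc(2) assms(1) by (auto simp: fun_eq_iff)
  moreover have "exec B (Seq (Dec a) (Inc b)) (s, w) (?s, w)"
    by (intro exec.Seq[OF exec.Dec] exec_eq[OF exec.Inc]) (use Suc(2,3) assms(1) in auto)
  ultimately have 1: "exec B (While a (Seq (Dec a) (Inc b))) (?s, w) (s(a := 0, b := s a + s b), w)"
    and 2: "exec B (Seq (Dec a) (Inc b)) (s, w) (?s, w)" by (simp_all only: move_def)
  have 3: "0 < s a" using Suc(2) by simp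
  show ?case unfolding move_def by (rule exec.WhileT[OF 3 2 1])
qed

text \<open>Variables live in registers below \<open>L\<close>; registers from \<open>L\<close> on
  are scratch and initially zero. The result is left in \<open>L\<close> and all other registers are
  restored. Copying a variable destroys it, hence the second copy in \<open>Suc L\<close>, which is
  moved back. In a recursion \<open>L\<close> counts down, \<open>L + 1\<close> accumulates,
  \<open>L + 2\<close> counts up, and \<open>L + 3\<close> receives the result of the step.\<close>

primrec compile :: "exp \<Rightarrow> (nat \<Rightarrow> nat) \<Rightarrow> nat \<Rightarrow> 'a com" where
  "compile (EVar i) \<rho> L =
     Seq (While (\<rho> i) (Seq (Dec (\<rho> i)) (Seq (Inc L) (Inc (Suc L))))) (move (Suc L) (\<rho> i))"
| "compile EZero \<rho> L = clear L"
| "compile (ESuc a) \<rho> L = Seq (compile a \<rho> L) (Inc L)"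
| "compile (ELet a b) \<rho> L =
     Seq (compile a \<rho> L) (Seq (compile b (push L \<rho>) (Suc L)) (Seq (clear L) (move (Suc L) L)))"
| "compile (ERen f a) \<rho> L = compile a (\<lambda>i. \<rho> (f i)) L"
| "compile (ERec n i s) \<rho> L =
     Seq (compile n \<rho> L) (Seq (compile i \<rho> (L + 1)) (Seq
       (While L (Seq (compile s (push (L + 1) (push (L + 2) \<rho>)) (L + 3))
          (Seq (clear (L + 1)) (Seq (move (L + 3) (L + 1)) (Seq (Inc (L + 2)) (Dec L))))))
       (Seq (clear (L + 2)) (move (L + 1) L))))"

text \<open>The common initial value \<open>v\<close> of both targets makes the statement inductive;
  the compiled code uses it with \<open>v\<close> equal to 0.\<close>

lemma exec_copy:
  assumes "a < L" "s L = v" "s (Suc L) = v" "v + s a < B"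
  shows "exec B (While a (Seq (Dec a) (Seq (Inc L) (Inc (Suc L))))) (s, w)
     (s(a := 0, L := v + s a, Suc L := v + s a), w)"
  using assms(2-)
proof (induction "s a" arbitrary: s v)
  case 0
  then have "s(a := 0, L := v + s a, Suc L := v + s a) = s" by (auto simp: fun_eq_iff)
  then show ?case using 0 by (intro exec_eq[OF exec.WhileF]) auto
next
  case (Suc n)
  let ?s = "s(a := s a - 1, L := Suc v, Suc L := Suc v)"
  have "exec B (While a (Seq (Dec a) (Seq (Inc L) (Inc (Suc L))))) (?s, w)
     (?s(a := 0, L := Suc v + ?s a, Suc L := Suc v + ?s a), w)"
    by (rule Suc(1)) (use Suc(2-) assms(1) in auto)
  moreover have "?s(a := 0, L := Suc v + ?s a, Suc L := Suc v + ?s a) = s(a := 0, L := v + s a, Suc L := v + s a)"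
    using Suc(2) assms(1) by (auto simp: fun_eq_iff)
  moreover have "exec B (Seq (Dec a) (Seq (Inc L) (Inc (Suc L)))) (s, w) (?s, w)"
    by (intro exec.Seq[OF exec.Dec] exec.Seq[OF exec.Inc] exec_eq[OF exec.Inc])
      (use Suc(2-) assms(1) in auto)
  ultimately have 1: "exec B (While a (Seq (Dec a) (Seq (Inc L) (Inc (Suc L))))) (?s, w)
      (s(a := 0, L := v + s a, Suc L := v + s a), w)"
    and 2: "exec B (Seq (Dec a) (Seq (Inc L) (Inc (Suc L)))) (s, w) (?s, w)" by (simp_all only:)
  have 3: "0 < s a" using Suc(2) by simp
  show ?case by (rule exec.WhileT[OF 3 2 1])
qed

lemma compile_correct:
  assumes "\<And>r. r \<ge> L \<Longrightarrow> s r = 0" "\<And>i. \<rho> i < L" "vals_below B a (\<lambda>i. s (\<rho> i))"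
  shows "exec B (compile a \<rho> L) (s, w) (s(L := eval a (\<lambda>i. s (\<rho> i))), w)"
  using assms
proof (induction a arbitrary: s \<rho> L)
  case (EVar i)
  let ?a = "\<rho> i"
  let ?s = "s(?a := 0, L := 0 + s ?a, Suc L := 0 + s ?a)"
  have "exec B (move (Suc L) ?a) (?s, w) (?s(Suc L := 0, ?a := ?s (Suc L) + ?s ?a), w)"
    by (rule exec_move) (use EVar.prems(2)[of i] EVar.prems(3) in auto)
  moreover have "?s(Suc L := 0, ?a := ?s (Suc L) + ?s ?a) = s(L := s ?a)"
    using EVar.prems(2)[of i] EVar.prems(1) by (auto simp: fun_eq_iff)
  ultimately have 1: "exec B (move (Suc L) ?a) (?s, w) (s(L := s ?a), w)" by simp
  have "exec B (While ?a (Seq (Dec ?a) (Seq (Inc L) (Inc (Suc L))))) (s, w) (?s, w)"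
    by (rule exec_copy) (use EVar.prems in auto)
  from exec.Seq[OF this 1] show ?case unfolding compile.simps eval.simps .
next
  case EZero
  show ?case unfolding compile.simps eval.simps by (rule exec_clear)
next
  case (ESuc a)
  let ?v = "eval a (\<lambda>i. s (\<rho> i))"
  have 1: "exec B (compile a \<rho> L) (s, w) (s(L := ?v), w)"
    by (rule ESuc.IH) (use ESuc.prems in auto)
  have 2: "exec B (Inc L) (s(L := ?v), w) (s(L := Suc ?v), w)"
    by (rule exec_eq[OF exec.Inc]) (use ESuc.prems in auto)
  show ?case unfolding compile.simps eval.simps by (rule exec.Seq[OF 1 2])
next
  case (ELet a b)
  let ?v = "eval a (\<lambda>i. s (\<rho> i))"
  let ?s = "s(L := ?v)"
  have "(\<lambda>i. ?s (push L \<rho> i)) = push ?v (\<lambda>i. s (\<rho> i))"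
    using ELet.prems(2) by (auto simp: fun_eq_iff split: nat.split dest: less_imp_neq)
  note e = this
  let ?x = "eval b (push ?v (\<lambda>i. s (\<rho> i)))"
  have "exec B (compile b (push L \<rho>) (Suc L)) (?s, w) (?s(Suc L := eval b (\<lambda>i. ?s (push L \<rho> i))), w)"
  proof (rule ELet.IH(2))
    show "vals_below B b (\<lambda>i. ?s (push L \<rho> i))" unfolding e using ELet.prems(3) by simp
  qed (use ELet.prems in \<open>auto simp: less_SucI split: nat.split\<close>)
  then have 2: "exec B (compile b (push L \<rho>) (Suc L)) (?s, w) (?s(Suc L := ?x), w)" unfolding e .
  have 1: "exec B (compile a \<rho> L) (s, w) (?s, w)"
    by (rule ELet.IH(1)) (use ELet.prems in auto)
  have 3: "exec B (clear L) (?s(Suc L := ?x), w) (?s(Suc L := ?x, L := 0), w)" by (rule exec_clear)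
  have 4: "exec B (move (Suc L) L) (?s(Suc L := ?x, L := 0), w)
     (s(L := ?x), w)"
    by (rule exec_eq[OF exec_move]) (use ELet.prems vals_below_eval[of B b] in \<open>auto simp: fun_eq_iff\<close>)
  show ?case using exec.Seq[OF 1 exec.Seq[OF 2 exec.Seq[OF 3 4]]]
    unfolding compile.simps eval.simps .
next
  case (ERen f a)
  show ?case unfolding compile.simps eval.simps by (rule ERen.IH) (use ERen.prems in auto)
next
  case (ERec n i a)
  let ?e = "\<lambda>i. s (\<rho> i)"
  let ?n = "eval n ?e"
  define r where "r = rec_nat (eval i ?e) (\<lambda>k x. eval a (push x (push k ?e)))"
  have r0: "r 0 = eval i ?e" and rS: "\<And>k. r (Suc k) = eval a (push (r k) (push k ?e))"
    by (simp_all add: r_def)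
  have ba: "\<And>k. k < ?n \<Longrightarrow> vals_below B a (push (r k) (push k ?e))" and nB: "?n < B"
    and iB: "eval i ?e < B" using ERec.prems(3) vals_below_eval by (auto simp: r_def)
  have rB: "r k < B" if "k \<le> ?n" for k
  proof (cases k)
    case (Suc j)
    then show ?thesis using ba[of j] that vals_below_eval rS by auto
  qed (use iB r0 in simp)
  \<comment> \<open>The state after \<open>k\<close> rounds, which is the loop invariant.\<close>
  let ?st = "\<lambda>k. s(L := ?n - k, L + 1 := r k, L + 2 := k)"
  let ?body = "Seq (compile a (push (L + 1) (push (L + 2) \<rho>)) (L + 3))
          (Seq (clear (L + 1)) (Seq (move (L + 3) (L + 1)) (Seq (Inc (L + 2)) (Dec L))))"
  have body: "exec B ?body (?st k, w) (?st (Suc k), w)" if k: "k < ?n" for k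
  proof -
    have e: "(\<lambda>i. ?st k (push (L + 1) (push (L + 2) \<rho>) i)) = push (r k) (push k ?e)"
    proof
      fix j
      have "\<rho> j' \<noteq> L" "\<rho> j' \<noteq> L + 1" "\<rho> j' \<noteq> L + 2" for j' using ERec.prems(2)[of j'] by auto
      then show "?st k (push (L + 1) (push (L + 2) \<rho>) j) = push (r k) (push k ?e) j"
        by (auto split: nat.split)
    qed
    have "exec B (compile a (push (L + 1) (push (L + 2) \<rho>)) (L + 3)) (?st k, w)
       ((?st k)(L + 3 := eval a (\<lambda>i. ?st k (push (L + 1) (push (L + 2) \<rho>) i))), w)"
    proof (rule ERec.IH(3))
      show "vals_below B a (\<lambda>i. ?st k (push (L + 1) (push (L + 2) \<rho>) i))" unfolding e by (rule ba[OF k])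
      show "push (L + 1) (push (L + 2) \<rho>) j < L + 3" for j
      proof -
        have "\<rho> j' < L + 3" for j' using ERec.prems(2)[of j'] by simp
        then show ?thesis by (auto split: nat.split)
      qed
    qed (use ERec.prems(1) in auto)
    then have 1: "exec B (compile a (push (L + 1) (push (L + 2) \<rho>)) (L + 3)) (?st k, w)
       ((?st k)(L + 3 := r (Suc k)), w)" unfolding e rS .
    let ?s1 = "(?st k)(L + 3 := r (Suc k))"
    have 2: "exec B (clear (L + 1)) (?s1, w) (?s1(L + 1 := 0), w)" by (rule exec_clear)
    let ?s2 = "?s1(L + 1 := 0)"
    have 3: "exec B (move (L + 3) (L + 1)) (?s2, w) (?s2(L + 3 := 0, L + 1 := r (Suc k)), w)"
      by (rule exec_eq[OF exec_move]) (use rB[of "Suc k"] k in auto)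
    let ?s3 = "?s2(L + 3 := 0, L + 1 := r (Suc k))"
    have 4: "exec B (Inc (L + 2)) (?s3, w) (?s3(L + 2 := Suc k), w)"
      by (rule exec_eq[OF exec.Inc]) (use k nB in auto)
    let ?s4 = "?s3(L + 2 := Suc k)"
    have 5: "exec B (Dec L) (?s4, w) (?s4(L := ?n - k - 1), w)"
      by (rule exec_eq[OF exec.Dec]) (use k in auto)
    have 6: "?s4(L := ?n - k - 1) = ?st (Suc k)" using ERec.prems(1)[of "L + 3"] by (auto simp: fun_eq_iff)
    show ?thesis using exec.Seq[OF 1 exec.Seq[OF 2 exec.Seq[OF 3 exec.Seq[OF 4 5]]]] unfolding 6 .
  qed
  have loop: "exec B (While L ?body) (?st k, w) (?st ?n, w)" if "k \<le> ?n" for k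
    using that
  proof (induction "?n - k" arbitrary: k)
    case 0
    then have k: "k = ?n" by linarith
    have "(?st ?n) L = 0" by simp
    then show ?case unfolding k by (rule exec.WhileF)
  next
    case (Suc m)
    have k: "k < ?n" "m = ?n - Suc k" "Suc k \<le> ?n" using Suc(2) by linarith+
    have 1: "exec B (While L ?body) (?st (Suc k), w) (?st ?n, w)" by (rule Suc(1)[OF k(2,3)])
    have 2: "0 < (?st k) L" using k(1) by simp
    show ?case by (rule exec.WhileT[OF 2 body[OF k(1)] 1])
  qed
  have 1: "exec B (compile n \<rho> L) (s, w) (s(L := ?n), w)"
    by (rule ERec.IH(1)) (use ERec.prems in auto)
  have e: "(\<lambda>i. (s(L := ?n)) (\<rho> i)) = ?e" using ERec.prems(2) by (auto simp: fun_eq_iff dest: less_imp_neq)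
  have "exec B (compile i \<rho> (L + 1)) (s(L := ?n), w)
     ((s(L := ?n))(L + 1 := eval i (\<lambda>i. (s(L := ?n)) (\<rho> i))), w)"
  proof (rule ERec.IH(2))
    show "vals_below B i (\<lambda>i. (s(L := ?n)) (\<rho> i))" unfolding e using ERec.prems(3) by simp
  qed (use ERec.prems in \<open>auto simp: less_SucI\<close>)
  moreover have "(s(L := ?n))(L + 1 := eval i ?e) = ?st 0"
    using ERec.prems(1)[of "L + 2"] r0 by (auto simp: fun_eq_iff)
  ultimately have 2: "exec B (compile i \<rho> (L + 1)) (s(L := ?n), w) (?st 0, w)" unfolding e by simp
  have 3: "exec B (While L ?body) (?st 0, w) (?st ?n, w)" by (rule loop) simp
  have 4: "exec B (clear (L + 2)) (?st ?n, w) ((?st ?n)(L + 2 := 0), w)" by (rule exec_clear)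
  have 5: "exec B (move (L + 1) L) ((?st ?n)(L + 2 := 0), w) (s(L := r ?n), w)"
    by (rule exec_eq[OF exec_move]) (use ERec.prems(1) rB[of ?n] in \<open>auto simp: fun_eq_iff\<close>)
  show ?case using exec.Seq[OF 1 exec.Seq[OF 2 exec.Seq[OF 3 exec.Seq[OF 4 5]]]]
    unfolding compile.simps eval.simps r_def .
qed

section \<open>Turing machines for counter programs\<close>

text \<open>The head bound is checked in every configuration that is left, so
  \<open>reach_run\<close> has to ask for it separately in the last one.\<close>

inductive reach :: "'a tm \<Rightarrow> nat \<Rightarrow> 'a config \<Rightarrow> 'a config \<Rightarrow> bool" for M H where
  reach_here: "reach M H C C"
| reach_next: "(\<forall>(f, h) \<in> set (snd C). h < H) \<Longrightarrow> reach M H (step M C) C' \<Longrightarrow> reach M H C C'"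

lemma reach_trans: "reach M H C C' \<Longrightarrow> reach M H C' C'' \<Longrightarrow> reach M H C C''"
  by (induction rule: reach.induct) (auto intro: reach_next)

lemma reach_step: "(\<forall>(f, h) \<in> set (snd C). h < H) \<Longrightarrow> step M C = C' \<Longrightarrow> reach M H C C'"
  by (auto intro: reach.intros)

lemma reach_run:
  assumes "reach M H C C'" "fst C' = accept M \<or> fst C' = reject M" "\<forall>(f, h) \<in> set (snd C'). h < H"
  shows "(\<exists>t. fst ((step M ^^ t) C) = fst C') \<and> (\<forall>t. \<forall>(f, h) \<in> set (snd ((step M ^^ t) C)). h < H)"
  using assms
proof (induction rule: reach.induct)
  case (reach_here C)
  obtain q ts where C: "C = (q, ts)" by (cases C)
  have "(step M ^^ t) C = C" for t
  proof (induction t)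
    case (Suc t)
    then show ?case using reach_here(1) C by (simp add: funpow_swap1)
  qed simp
  then show ?case using reach_here by auto
next
  case (reach_next C C')
  then obtain t where t: "fst ((step M ^^ t) (step M C)) = fst C'"
    and sp: "\<And>t. \<forall>(f, h) \<in> set (snd ((step M ^^ t) (step M C))). h < H" by blast
  have "fst ((step M ^^ (Suc t)) C) = fst C'" using t by (simp add: funpow_swap1)
  moreover have "\<forall>(f, h) \<in> set (snd ((step M ^^ t) C)). h < H" for t
  proof (cases t)
    case 0
    then show ?thesis using reach_next(1) by simp
  next
    case (Suc t')
    then show ?thesis using sp[of t'] by (simp add: funpow_swap1)
  qed
  ultimately show ?case by blast
qed

text \<open>\<open>Init r\<close> writes the marker on the tape of register \<open>r\<close>,
  \<open>Go K\<close> works on the pending commands \<open>K\<close>, and \<open>Ret r K\<close>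
  rewinds the tape of register \<open>r\<close> before continuing with \<open>K\<close>.\<close>

datatype 'a st = Init nat | Go "'a com list" | Ret nat "'a com list" | Acc | Rej

text \<open>The lists of pending commands that can arise while \<open>c\<close> is executed in front
  of \<open>K\<close>. There are finitely many over a finite alphabet, so they can be stored in the
  finite control.\<close>

primrec conts :: "'a com \<Rightarrow> 'a com list \<Rightarrow> 'a com list set" where
  "conts (Inc r) K = {Inc r # K}"
| "conts (Dec r) K = {Dec r # K}"
| "conts (Seq a b) K = insert (Seq a b # K) (conts a (b # K) \<union> conts b K)"
| "conts (While r a) K = insert (While r a # K) (conts a (While r a # K))"
| "conts (ReadLoop g) K = insert (ReadLoop g # K) (\<Union>l. conts (g l) (ReadLoop g # K))"

fun next_conts :: "'a com list \<Rightarrow> 'a com list set" where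
  "next_conts [] = {}"
| "next_conts (Inc r # K) = {K}"
| "next_conts (Dec r # K) = {K}"
| "next_conts (Seq a b # K) = {a # b # K}"
| "next_conts (While r a # K) = {K, a # While r a # K}"
| "next_conts (ReadLoop g # K) = insert K (range (\<lambda>l. g l # ReadLoop g # K))"

lemma finite_conts: "finite (conts (c :: 'a::finite com) K)"
  by (induction c arbitrary: K) auto

lemma conts_start: "c # K \<in> conts c K"
  by (cases c) auto

lemma conts_closed: "K' \<in> conts c K \<Longrightarrow> next_conts K' \<subseteq> insert K (conts c K)"
proof (induction c arbitrary: K K')
  case (Seq a b)
  consider "K' = Seq a b # K" | "K' \<in> conts a (b # K)" | "K' \<in> conts b K" using Seq.prems by auto
  then show ?case
  proof cases
    case 2
    from Seq.IH(1)[OF this] show ?thesis using conts_start[of b K] by auto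
  next
    case 3
    from Seq.IH(2)[OF this] show ?thesis by auto
  qed (use conts_start[of a "b # K"] in simp)
next
  case (While r a)
  consider "K' = While r a # K" | "K' \<in> conts a (While r a # K)" using While.prems by auto
  then show ?case
  proof cases
    case 2
    from While.IH[OF this] show ?thesis by auto
  qed (use conts_start[of a "While r a # K"] in simp)
next
  case (ReadLoop g)
  show ?case
  proof (cases "K' = ReadLoop g # K")
    case True
    have "g l # ReadLoop g # K \<in> conts (g l) (ReadLoop g # K)" for l by (rule conts_start)
    then show ?thesis unfolding True by auto
  next
    case False
    then obtain l where l: "K' \<in> conts (g l) (ReadLoop g # K)" using ReadLoop.prems by auto
    then have "next_conts K' \<subseteq> insert (ReadLoop g # K) (conts (g l) (ReadLoop g # K))"
      using ReadLoop.IH by simp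
    then show ?thesis by auto
  qed
qed auto

primrec regs_less :: "nat \<Rightarrow> 'a com \<Rightarrow> bool" where
  "regs_less R (Inc r) \<longleftrightarrow> r < R"
| "regs_less R (Dec r) \<longleftrightarrow> r < R"
| "regs_less R (Seq a b) \<longleftrightarrow> regs_less R a \<and> regs_less R b"
| "regs_less R (While r a) \<longleftrightarrow> r < R \<and> regs_less R a"
| "regs_less R (ReadLoop g) \<longleftrightarrow> (\<forall>l. regs_less R (g l))"

lemma regs_less_mono: "regs_less R c \<Longrightarrow> R \<le> R' \<Longrightarrow> regs_less R' c"
  by (induction c) auto

lemma ex_regs_less: "\<exists>R. regs_less R (c :: 'a::finite com)"
proof (induction c)
  case (Seq a b)
  then obtain R R' where "regs_less R a" "regs_less R' b" by blast
  then show ?case by (intro exI[of _ "max R R'"]) (auto intro: regs_less_mono)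
next
  case (While r a)
  then obtain R where "regs_less R a" by blast
  then show ?case by (intro exI[of _ "max R (Suc r)"]) (auto intro: regs_less_mono)
next
  case (ReadLoop g)
  then have "\<forall>l. \<exists>R. regs_less R (g l)" by auto
  then obtain f where f: "\<And>l. regs_less (f l) (g l)" by metis
  have "regs_less (Max (range f)) (g l)" for l
    by (rule regs_less_mono[OF f]) (auto intro: Max_ge)
  then show ?case by auto
qed auto

lemma conts_regs_less:
  "K' \<in> conts c K \<Longrightarrow> regs_less R c \<Longrightarrow> (\<forall>a \<in> set K. regs_less R a) \<Longrightarrow> (\<forall>a \<in> set K'. regs_less R a)"
proof (induction c arbitrary: K K')
  case (Seq a b)
  show ?case
  proof (cases "K' = Seq a b # K")
    case False
    then have "K' \<in> conts a (b # K) \<or> K' \<in> conts b K" using Seq.prems(1) by simp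
    then show ?thesis using Seq.IH(1)[of K' "b # K"] Seq.IH(2)[of K' K] Seq.prems(2,3) by auto
  qed (use Seq.prems in auto)
next
  case (While r a)
  show ?case
  proof (cases "K' = While r a # K")
    case False
    then show ?thesis using While.IH[of K' "While r a # K"] While.prems by auto
  qed (use While.prems in auto)
next
  case (ReadLoop g)
  show ?case
  proof (cases "K' = ReadLoop g # K")
    case False
    then obtain l where l: "K' \<in> conts (g l) (ReadLoop g # K)" using ReadLoop.prems by auto
    show ?thesis by (rule ReadLoop.IH[OF _ l]) (use ReadLoop.prems in auto)
  qed (use ReadLoop.prems in auto)
qed auto

text \<open>A binary number, least significant digit first, is written to the right of the marker
  \<open>Work 2\<close> at position \<open>0\<close>.\<close>

definition tape_of :: "bool list \<Rightarrow> nat \<Rightarrow> 'a sym" where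
  "tape_of bs = case_nat (Work 2)
     (\<lambda>j. if j < length bs then (if bs ! j then Work 1 else Work 0) else Blank)"

fun bval :: "bool list \<Rightarrow> nat" where
  "bval [] = 0"
| "bval (b # bs) = (if b then 1 else 0) + 2 * bval bs"

fun binc :: "bool list \<Rightarrow> bool list" where
  "binc [] = [True]"
| "binc (False # bs) = True # bs"
| "binc (True # bs) = False # binc bs"

fun bdec :: "bool list \<Rightarrow> bool list" where
  "bdec [] = []"
| "bdec (True # bs) = False # bs"
| "bdec (False # bs) = True # bdec bs"

lemma bval_binc: "bval (binc bs) = Suc (bval bs)"
  by (induction bs rule: binc.induct) auto

lemma bval_bdec: "0 < bval bs \<Longrightarrow> bval (bdec bs) = bval bs - 1"
  by (induction bs rule: bdec.induct) auto

lemma length_bdec: "length (bdec bs) = length bs"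
  by (induction bs rule: bdec.induct) auto

lemma length_binc: "length (binc bs) = length bs \<or> length (binc bs) = Suc (length bs) \<and> Suc (bval bs) = 2 ^ length bs"
  by (induction bs rule: binc.induct) auto

text \<open>Leading zeros are permitted, so the value does not determine the length. But the length
  grows only when all digits are ones, and then the new value is 2 to the old length.\<close>

lemma length_binc_le:
  assumes "length bs \<le> N" "Suc (bval bs) < 2 ^ N"
  shows "length (binc bs) \<le> N"
proof (rule ccontr)
  assume "\<not> ?thesis"
  then have "length bs = N" "Suc (bval bs) = 2 ^ length bs" using length_binc[of bs] assms(1) by auto
  then show False using assms(2) by simp
qed

lemma tape_of_0 [simp]: "tape_of bs 0 = Work 2"
  by (simp add: tape_of_def)

lemma tape_of_Suc: "tape_of bs (Suc j) = (if j < length bs then (if bs ! j then Work 1 else Work 0) else Blank)"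
  by (simp add: tape_of_def)

lemma tape_of_mid [simp]:
  "tape_of (pre @ b # bs) (Suc (length pre)) = (if b then Work 1 else Work 0)"
  "tape_of pre (Suc (length pre)) = Blank"
  by (simp_all add: tape_of_Suc)

lemma tape_of_upd:
  "(tape_of (pre @ b # bs))(Suc (length pre) := (if b' then Work 1 else Work 0)) = tape_of (pre @ b' # bs)"
  "(tape_of pre)(Suc (length pre) := (if b' then Work 1 else Work 0)) = tape_of (pre @ [b'])"
  by (auto simp: fun_eq_iff tape_of_def nth_append nth_Cons split: nat.split)

lemma tape_of_upd' [simp]:
  "(tape_of (pre @ b # bs))(Suc (length pre) := Work (Suc 0)) = tape_of (pre @ True # bs)"
  "(tape_of (pre @ b # bs))(Suc (length pre) := Work 0) = tape_of (pre @ False # bs)"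
  "(tape_of pre)(Suc (length pre) := Work (Suc 0)) = tape_of (pre @ [True])"
  using tape_of_upd(1)[of pre b bs True] tape_of_upd(1)[of pre b bs False] tape_of_upd(2)[of pre True]
  by simp_all

lemma tape_of_not_mark: "0 < h \<Longrightarrow> tape_of bs h \<noteq> Work 2"
  by (cases h) (auto simp: tape_of_Suc)

section \<open>The machine of a counter program\<close>

locale counter_tm =
  fixes main :: "'a::finite com" and out R :: nat
  assumes regs: "regs_less R main" and out: "out < R"
begin

definition "CC = insert [] (conts main [])"

text \<open>In each state only one tape is read and changed: tape 0 carries the input, tape
  \<open>Suc r\<close> the register \<open>r\<close>.\<close>

primrec act :: "'a st \<Rightarrow> nat" where
  "act (Init r) = Suc r"
| "act (Go K) = (case K of [] \<Rightarrow> Suc out | c # _ \<Rightarrow>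
     (case c of Inc r \<Rightarrow> Suc r | Dec r \<Rightarrow> Suc r | While r _ \<Rightarrow> Suc r | _ \<Rightarrow> 0))"
| "act (Ret r K) = Suc r"
| "act Acc = 0"
| "act Rej = 0"

text \<open>\<open>Inc\<close> and \<open>Dec\<close> stay in their state while a carry or borrow
  travels to the right. A test for zero looks for a digit 1, and so does the final state
  \<open>Go []\<close> on the output register to choose between acceptance and rejection.\<close>

fun tr :: "'a st \<Rightarrow> 'a sym \<Rightarrow> 'a st \<times> 'a sym \<times> move" where
  "tr (Init r) s = (if Suc r < R then Init (Suc r) else Go [main], Work 2, Go_Right)"
| "tr (Go []) s = (if s = Work 0 then (Go [], s, Go_Right) else if s = Work 1 then (Acc, s, Stay) else (Rej, s, Stay))"
| "tr (Go (Inc r # K)) s = (if s = Work 1 then (Go (Inc r # K), Work 0, Go_Right) else (Ret r K, Work 1, Go_Left))"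
| "tr (Go (Dec r # K)) s = (if s = Work 1 then (Ret r K, Work 0, Go_Left) else (Go (Dec r # K), Work 1, Go_Right))"
| "tr (Go (Seq a b # K)) s = (Go (a # b # K), s, Stay)"
| "tr (Go (While r a # K)) s = (if s = Work 0 then (Go (While r a # K), s, Go_Right)
     else if s = Work 1 then (Ret r (a # While r a # K), s, Go_Left) else (Ret r K, s, Go_Left))"
| "tr (Go (ReadLoop g # K)) s = (case s of Inp l \<Rightarrow> (Go (g l # ReadLoop g # K), s, Go_Right) | _ \<Rightarrow> (Go K, s, Stay))"
| "tr (Ret r K) s = (if s = Work 2 then (Go K, s, Go_Right) else (Ret r K, s, Go_Left))"
| "tr Acc s = (Acc, s, Stay)"
| "tr Rej s = (Rej, s, Stay)"

definition "QQ = Init ` {..<R} \<union> Go ` CC \<union> (\<lambda>(r, K). Ret r K) ` ({..<R} \<times> CC) \<union> {Acc, Rej}"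

definition "enc = to_nat_on QQ"

definition "syms = {Blank, Work 0, Work 1, Work 2} \<union> range Inp"

definition machine :: "'a tm" where
  "machine = \<lparr>ntapes = Suc R, states = enc ` QQ, symbols = syms,
     start = enc (Init 0), accept = enc Acc, reject = enc Rej,
     delta = (\<lambda>n ss. let q = from_nat_into QQ n in
       case tr q (ss ! act q) of (q', s', m) \<Rightarrow>
         (enc q', (map (\<lambda>x. (x, Stay)) ss)[act q := (s', m)]))\<rparr>"

lemma finite_CC: "finite CC" by (simp add: CC_def finite_conts)

lemma countable_QQ: "countable QQ" and finite_QQ: "finite QQ"
proof -
  show "finite QQ" using finite_CC by (auto simp: QQ_def)
  then show "countable QQ" by (rule countable_finite)
qed

lemma enc_inj: "q \<in> QQ \<Longrightarrow> q' \<in> QQ \<Longrightarrow> enc q = enc q' \<longleftrightarrow> q = q'"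
  unfolding enc_def using countable_QQ by simp

lemma dec_enc [simp]: "q \<in> QQ \<Longrightarrow> from_nat_into QQ (enc q) = q"
  unfolding enc_def using countable_QQ by simp

lemma AR_QQ [simp]: "Acc \<in> QQ" "Rej \<in> QQ" by (auto simp: QQ_def)

lemma CC_closed: "K \<in> CC \<Longrightarrow> next_conts K \<subseteq> CC"
  unfolding CC_def using conts_closed[of K main "[]"] by auto

lemma CC_next: "K \<in> CC \<Longrightarrow> K' \<in> next_conts K \<Longrightarrow> K' \<in> CC"
  using CC_closed by blast

lemma CC_regs: "c # K \<in> CC \<Longrightarrow> regs_less R c"
  unfolding CC_def using conts_regs_less[of "c # K" main "[]" R] regs by auto

lemma QQ_intros [simp]:
  "Init r \<in> QQ \<longleftrightarrow> r < R" "Go K \<in> QQ \<longleftrightarrow> K \<in> CC" "Ret r K \<in> QQ \<longleftrightarrow> r < R \<and> K \<in> CC"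
  by (auto simp: QQ_def)

lemma main_CC: "[main] \<in> CC" "[] \<in> CC"
  by (auto simp: CC_def conts_start)

lemma act_less: "q \<in> QQ \<Longrightarrow> act q < Suc R"
proof (cases q)
  case (Go K)
  assume "q \<in> QQ"
  then have "K \<in> CC" using Go by simp
  then show ?thesis using Go out CC_regs by (cases K) (force split: com.split)+
qed (auto simp: out)

lemma tr_closed:
  assumes "q \<in> QQ" "s \<in> syms"
  shows "fst (tr q s) \<in> QQ" "fst (snd (tr q s)) \<in> syms"
proof -
  show "fst (tr q s) \<in> QQ" using assms(1)
  proof (cases q)
    case (Go K)
    then have K: "K \<in> CC" using assms(1) by simp
    show ?thesis
    proof (cases K)
      case (Cons c K')
      then show ?thesis using Go K CC_next[OF K] CC_regs[of c K']
        by (cases c) (auto split: sym.split)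
    qed (use Go main_CC in auto)
  qed (auto simp: main_CC)
  have s: "Work 0 \<in> syms" "Work 1 \<in> syms" "Work 2 \<in> syms" by (auto simp: syms_def)
  show "fst (snd (tr q s)) \<in> syms" using assms(2) s
    by (cases "(q, s)" rule: tr.cases) (auto split: sym.split)
qed

lemma machine_simps [simp]:
  "ntapes machine = Suc R" "states machine = enc ` QQ" "symbols machine = syms"
  "start machine = enc (Init 0)" "accept machine = enc Acc" "reject machine = enc Rej"
  by (simp_all add: machine_def)

lemma wf_machine: "wf_tm machine"
  unfolding wf_tm_def
proof (intro conjI ballI allI impI)
  show "finite (symbols machine)" by (simp add: syms_def)
  show "Blank \<in> symbols machine" "range Inp \<subseteq> symbols machine" by (auto simp: syms_def)
  have "0 < R" using out by simp
  then show "start machine \<in> states machine" by simp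
  show "accept machine \<noteq> reject machine" by (simp add: enc_inj)
next
  fix n ss assume "n \<in> states machine" and ss: "length ss = ntapes machine \<and> set ss \<subseteq> symbols machine"
  then obtain q where q: "q \<in> QQ" "n = enc q" by auto
  obtain q' s' m where t: "tr q (ss ! act q) = (q', s', m)" by (metis surj_pair)
  have "ss ! act q \<in> syms" using ss act_less[OF q(1)] by (auto simp: subset_iff)
  then have "q' \<in> QQ" "s' \<in> syms" using tr_closed[OF q(1)] t by (metis fst_conv snd_conv)+
  moreover have "fst ` set ((map (\<lambda>x. (x, Stay)) ss)[act q := (s', m)]) \<subseteq> insert s' (set ss)"
    using set_update_subset_insert[of "map (\<lambda>x. (x, Stay)) ss" "act q" "(s', m)"] by auto
  ultimately show "case delta machine n ss of (q', acts) \<Rightarrow> q' \<in> states machine \<and>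
      length acts = ntapes machine \<and> fst ` set acts \<subseteq> symbols machine"
    using ss q t by (auto simp: machine_def)
qed (auto simp: finite_QQ)

lemma map2_stay: "map2 act_tape (map (\<lambda>x. (x, Stay)) (map read_tape ts)) ts = ts"
  by (induction ts) auto

lemma step_machine:
  assumes "q \<in> QQ" "q \<noteq> Acc" "q \<noteq> Rej" "length ts = Suc R" "tr q (read_tape (ts ! act q)) = (q', s', m)"
  shows "step machine (enc q, ts) = (enc q', ts[act q := act_tape (s', m) (ts ! act q)])"
proof -
  have a: "act q < length ts" using act_less assms by simp
  have "map2 act_tape ((map (\<lambda>x. (x, Stay)) (map read_tape ts))[act q := (s', m)]) ts
      = (map2 act_tape (map (\<lambda>x. (x, Stay)) (map read_tape ts)) ts)[act q := act_tape (s', m) (ts ! act q)]"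
    by (rule nth_equalityI) (use a in \<open>auto simp: nth_list_update\<close>)
  then show ?thesis using assms a enc_inj
    unfolding map2_stay by (auto simp: machine_def Let_def)
qed

section \<open>Simulation of executions within bounded space\<close>

context
  fixes w0 :: "'a list" and N H :: nat
  assumes H: "length w0 < H" "Suc (Suc N) < H"
begin

abbreviation "go \<equiv> reach machine H"

definition "heads_ok ts \<longleftrightarrow> length ts = Suc R \<and> (\<forall>(f, h) \<in> set ts. h < H)"

lemma heads_ok_upd: "heads_ok ts \<Longrightarrow> h < H \<Longrightarrow> heads_ok (ts[i := (f, h)])"
  unfolding heads_ok_def using set_update_subset_insert[of ts i "(f, h)"] by auto

lemma go_step:
  assumes "q \<in> QQ" "q \<noteq> Acc" "q \<noteq> Rej" "heads_ok (ts[act q := (f, h)])"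
    "tr q (f h) = (q', s', m)"
  shows "go (enc q, ts[act q := (f, h)]) (enc q', ts[act q := (f(h := s'), move_head m h)])"
proof (rule reach_step)
  have l: "length ts = Suc R" using assms(4) by (simp add: heads_ok_def)
  then have a: "act q < length ts" using act_less[OF assms(1)] by simp
  show "step machine (enc q, ts[act q := (f, h)]) = (enc q', ts[act q := (f(h := s'), move_head m h)])"
    using step_machine[OF assms(1,2,3), of "ts[act q := (f, h)]"] assms(5) l a by simp
qed (use assms(4) in \<open>simp add: heads_ok_def\<close>)

lemma go_step':
  assumes "heads_ok (ts[i := (f, h)])" "q \<in> QQ" "q \<noteq> Acc" "q \<noteq> Rej" "act q = i"
    "tr q (f h) = (q', s', m)" "f(h := s') = f'" "move_head m h = h'"
  shows "go (enc q, ts[i := (f, h)]) (enc q', ts[i := (f', h')])"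
  using go_step[of q ts f h q' s' m] assms by simp

lemma go_Ret:
  assumes "r < R" "K \<in> CC" "heads_ok (ts[Suc r := (tape_of bs, h)])"
  shows "go (enc (Ret r K), ts[Suc r := (tape_of bs, h)]) (enc (Go K), ts[Suc r := (tape_of bs, 1)])"
  using assms(3)
proof (induction h)
  case 0
  then show ?case using go_step[of "Ret r K" ts "tape_of bs" 0] assms(1,2) by (simp add: fun_upd_idem)
next
  case (Suc h)
  have "Suc h < H" if "Suc r < length ts" using Suc.prems that unfolding heads_ok_def
    by (auto dest!: bspec[OF _ set_update_memI])
  then have "heads_ok (ts[Suc r := (tape_of bs, h)])"
    using Suc.prems heads_ok_upd[OF Suc.prems, of h "Suc r" "tape_of bs"] assms(1) by (auto simp: heads_ok_def)
  note IH = Suc.IH[OF this]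
  have "go (enc (Ret r K), ts[Suc r := (tape_of bs, Suc h)]) (enc (Ret r K), ts[Suc r := (tape_of bs, h)])"
    by (rule go_step'[OF Suc.prems, where s' = "tape_of bs (Suc h)" and m = Go_Left])
      (use assms(1,2) tape_of_not_mark[of "Suc h" bs] in \<open>auto simp: fun_upd_idem\<close>)
  then show ?case using IH reach_trans by blast
qed

text \<open>The digits in \<open>pre\<close> are those that the carry has already passed;
  generalising over them makes the induction on the remaining digits work.\<close>

lemma go_Inc_scan:
  assumes "Inc r # K \<in> CC" "heads_ok ts" "length pre + length bs \<le> N"
  shows "\<exists>h. h \<le> N \<and> go (enc (Go (Inc r # K)), ts[Suc r := (tape_of (pre @ bs), Suc (length pre))])
     (enc (Ret r K), ts[Suc r := (tape_of (pre @ binc bs), h)])"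
  using assms(3)
proof (induction bs arbitrary: pre rule: binc.induct)
  case 1
  have "heads_ok (ts[Suc r := (tape_of pre, Suc (length pre))])"
    by (rule heads_ok_upd) (use assms 1 H in auto)
  then show ?case
    using go_step[of "Go (Inc r # K)" ts "tape_of pre" "Suc (length pre)"] assms(1) 1 by (intro exI[of _ "length pre"]) auto
next
  case (2 bs)
  have "heads_ok (ts[Suc r := (tape_of (pre @ False # bs), Suc (length pre))])"
    by (rule heads_ok_upd) (use assms 2 H in auto)
  then show ?case
    using go_step[of "Go (Inc r # K)" ts "tape_of (pre @ False # bs)" "Suc (length pre)"] assms(1) 2 by (intro exI[of _ "length pre"]) auto
next
  case (3 bs)
  have "heads_ok (ts[Suc r := (tape_of (pre @ True # bs), Suc (length pre))])"
    by (rule heads_ok_upd) (use assms 3 H in auto)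
  then have 1: "go (enc (Go (Inc r # K)), ts[Suc r := (tape_of (pre @ True # bs), Suc (length pre))])
    (enc (Go (Inc r # K)), ts[Suc r := (tape_of ((pre @ [False]) @ bs), Suc (length (pre @ [False])))])"
    using go_step[of "Go (Inc r # K)" ts "tape_of (pre @ True # bs)" "Suc (length pre)"] assms(1) by auto
  show ?case using 3(1)[of "pre @ [False]"] 3(2) reach_trans[OF 1] by auto
qed

lemma go_Dec_scan:
  assumes "Dec r # K \<in> CC" "heads_ok ts" "length pre + length bs \<le> N" "0 < bval bs"
  shows "\<exists>h. h \<le> N \<and> go (enc (Go (Dec r # K)), ts[Suc r := (tape_of (pre @ bs), Suc (length pre))])
     (enc (Ret r K), ts[Suc r := (tape_of (pre @ bdec bs), h)])"
  using assms(3,4)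
proof (induction bs arbitrary: pre rule: bdec.induct)
  case (2 bs)
  have "heads_ok (ts[Suc r := (tape_of (pre @ True # bs), Suc (length pre))])"
    by (rule heads_ok_upd) (use assms 2 H in auto)
  then show ?case
    using go_step[of "Go (Dec r # K)" ts "tape_of (pre @ True # bs)" "Suc (length pre)"] assms(1) 2 by (intro exI[of _ "length pre"]) auto
next
  case (3 bs)
  have "heads_ok (ts[Suc r := (tape_of (pre @ False # bs), Suc (length pre))])"
    by (rule heads_ok_upd) (use assms 3 H in auto)
  then have 1: "go (enc (Go (Dec r # K)), ts[Suc r := (tape_of (pre @ False # bs), Suc (length pre))])
    (enc (Go (Dec r # K)), ts[Suc r := (tape_of ((pre @ [True]) @ bs), Suc (length (pre @ [True])))])"
    using go_step[of "Go (Dec r # K)" ts "tape_of (pre @ False # bs)" "Suc (length pre)"] assms(1) by auto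
  show ?case using 3(1)[of "pre @ [True]"] 3(2,3) reach_trans[OF 1] by auto
qed simp

lemma go_While_scan:
  assumes "While r a # K \<in> CC" "heads_ok ts" "length pre + length bs \<le> N"
  shows "\<exists>h. h \<le> N \<and> go (enc (Go (While r a # K)), ts[Suc r := (tape_of (pre @ bs), Suc (length pre))])
     (enc (Ret r (if bval bs = 0 then K else a # While r a # K)), ts[Suc r := (tape_of (pre @ bs), h)])"
  using assms(3)
proof (induction bs arbitrary: pre)
  case Nil
  have "heads_ok (ts[Suc r := (tape_of pre, Suc (length pre))])"
    by (rule heads_ok_upd) (use assms Nil H in auto)
  then show ?case
    using go_step[of "Go (While r a # K)" ts "tape_of pre" "Suc (length pre)"] assms(1) Nil
    by (intro exI[of _ "length pre"]) (auto simp: fun_upd_idem)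
next
  case (Cons b bs)
  have ok: "heads_ok (ts[Suc r := (tape_of (pre @ b # bs), Suc (length pre))])"
    by (rule heads_ok_upd) (use assms Cons H in auto)
  show ?case
  proof (cases b)
    case True
    then show ?thesis
      using go_step[of "Go (While r a # K)" ts "tape_of (pre @ b # bs)" "Suc (length pre)"] assms(1) Cons.prems ok
      by (intro exI[of _ "length pre"]) (auto simp: fun_upd_idem)
  next
    case False
    have 1: "go (enc (Go (While r a # K)), ts[Suc r := (tape_of (pre @ b # bs), Suc (length pre))])
      (enc (Go (While r a # K)), ts[Suc r := (tape_of ((pre @ [b]) @ bs), Suc (length (pre @ [b])))])"
      using go_step[of "Go (While r a # K)" ts "tape_of (pre @ b # bs)" "Suc (length pre)"] assms(1) ok False
      by (auto simp: fun_upd_idem)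
    show ?thesis using Cons.IH[of "pre @ [b]"] Cons.prems False reach_trans[OF 1] by auto
  qed
qed

lemma go_Halt_scan:
  assumes "heads_ok ts" "length pre + length bs \<le> N"
  shows "\<exists>h. h < H \<and> go (enc (Go []), ts[Suc out := (tape_of (pre @ bs), Suc (length pre))])
     (enc (if bval bs = 0 then Rej else Acc), ts[Suc out := (tape_of (pre @ bs), h)])"
  using assms(2)
proof (induction bs arbitrary: pre)
  case Nil
  have "heads_ok (ts[Suc out := (tape_of pre, Suc (length pre))])"
    by (rule heads_ok_upd) (use assms Nil H in auto)
  then show ?case
    using go_step[of "Go []" ts "tape_of pre" "Suc (length pre)"] main_CC Nil H
    by (intro exI[of _ "Suc (length pre)"]) (auto simp: fun_upd_idem)
next
  case (Cons b bs)
  have ok: "heads_ok (ts[Suc out := (tape_of (pre @ b # bs), Suc (length pre))])"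
    by (rule heads_ok_upd) (use assms Cons H in auto)
  show ?case
  proof (cases b)
    case True
    then show ?thesis
      using go_step[of "Go []" ts "tape_of (pre @ b # bs)" "Suc (length pre)"] main_CC Cons.prems ok H
      by (intro exI[of _ "Suc (length pre)"]) (auto simp: fun_upd_idem)
  next
    case False
    have 1: "go (enc (Go []), ts[Suc out := (tape_of (pre @ b # bs), Suc (length pre))])
      (enc (Go []), ts[Suc out := (tape_of ((pre @ [b]) @ bs), Suc (length (pre @ [b])))])"
      using go_step[of "Go []" ts "tape_of (pre @ b # bs)" "Suc (length pre)"] main_CC ok False
      by (auto simp: fun_upd_idem)
    show ?thesis using Cons.IH[of "pre @ [b]"] Cons.prems False reach_trans[OF 1] by auto
  qed
qed

definition "inp = (\<lambda>i. if i < length w0 then Inp (w0 ! i) else Blank)"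

text \<open>Between commands every register head rests on the lowest digit, at position 1, and the
  head of the input tape separates the letters read from those still to come.\<close>

definition "rep s w ts \<longleftrightarrow> length ts = Suc R \<and>
  (\<exists>p. p \<le> length w0 \<and> ts ! 0 = (inp, p) \<and> w = drop p w0) \<and>
  (\<forall>r<R. \<exists>bs. ts ! Suc r = (tape_of bs, 1) \<and> bval bs = s r \<and> length bs \<le> N)"

lemma rep_heads_ok:
  assumes "rep s w ts"
  shows "heads_ok ts"
  unfolding heads_ok_def
proof (intro conjI ballI)
  show "length ts = Suc R" using assms by (simp add: rep_def)
  fix x assume "x \<in> set ts"
  then obtain i where i: "i < Suc R" "x = ts ! i" using assms by (auto simp: in_set_conv_nth rep_def)
  show "case x of (f, h) \<Rightarrow> h < H"
  proof (cases i)
    case 0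
    then show ?thesis using assms i H by (auto simp: rep_def)
  next
    case (Suc r)
    then obtain bs where "ts ! i = (tape_of bs, 1)" using assms i unfolding rep_def by auto
    then show ?thesis using i H by simp
  qed
qed

lemma rep_upd:
  assumes "rep s w ts" "r < R" "bval bs = x" "length bs \<le> N"
  shows "rep (s(r := x)) w (ts[Suc r := (tape_of bs, 1)])"
  using assms unfolding rep_def by (auto simp: nth_list_update)

lemma rep_reg:
  assumes "rep s w ts" "r < R"
  obtains bs where "ts[Suc r := (tape_of ([] @ bs), Suc (length []))] = ts" "bval bs = s r" "length bs \<le> N"
proof -
  obtain bs where "ts ! Suc r = (tape_of bs, 1)" "bval bs = s r" "length bs \<le> N"
    using assms unfolding rep_def by blast
  moreover from this(1) have "ts[Suc r := (tape_of bs, 1)] = ts"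
    using list_update_id[of ts "Suc r"] by simp
  ultimately show thesis using that[of bs] by simp
qed

text \<open>The simulation holds for any pending \<open>K\<close>. That \<open>K\<close> is again in
  \<open>CC\<close> belongs to the conclusion because the command executed next needs it.\<close>

lemma go_exec:
  assumes "exec B c (s, w) (s', w')" "B \<le> 2 ^ N" "c # K \<in> CC" "rep s w ts"
  shows "K \<in> CC \<and> (\<exists>ts'. rep s' w' ts' \<and> go (enc (Go (c # K)), ts) (enc (Go K), ts'))"
  using assms
proof (induction c "(s, w)" "(s', w')" arbitrary: s w s' w' K ts rule: exec.induct)
  case (Inc s r w)
  have r: "r < R" using CC_regs[OF Inc.prems(2)] by simp
  have K: "K \<in> CC" using CC_next[OF Inc.prems(2)] by simp
  obtain bs where bs: "ts[Suc r := (tape_of ([] @ bs), Suc (length []))] = ts" "bval bs = s r" "length bs \<le> N"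
    using rep_reg[OF Inc.prems(3) r] .
  have ok: "heads_ok ts" using rep_heads_ok Inc.prems(3) .
  obtain h where h: "h \<le> N" "go (enc (Go (Inc r # K)), ts) (enc (Ret r K), ts[Suc r := (tape_of (binc bs), h)])"
    using go_Inc_scan[OF Inc.prems(2) ok, of "[]" bs] bs(1,3) by auto
  have "length (binc bs) \<le> N" by (rule length_binc_le) (use bs Inc in auto)
  then have "rep (s(r := Suc (s r))) w (ts[Suc r := (tape_of (binc bs), 1)])"
    using rep_upd[OF Inc.prems(3) r, of "binc bs"] bval_binc[of bs] bs(2) by simp
  moreover have "go (enc (Ret r K), ts[Suc r := (tape_of (binc bs), h)]) (enc (Go K), ts[Suc r := (tape_of (binc bs), 1)])"
    by (rule go_Ret[OF r K heads_ok_upd[OF ok]]) (use h H in auto)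
  ultimately show ?case using K h(2) reach_trans by blast
next
  case (Dec s r w)
  have r: "r < R" using CC_regs[OF Dec.prems(2)] by simp
  have K: "K \<in> CC" using CC_next[OF Dec.prems(2)] by simp
  obtain bs where bs: "ts[Suc r := (tape_of ([] @ bs), Suc (length []))] = ts" "bval bs = s r" "length bs \<le> N"
    using rep_reg[OF Dec.prems(3) r] .
  have ok: "heads_ok ts" using rep_heads_ok Dec.prems(3) .
  obtain h where h: "h \<le> N" "go (enc (Go (Dec r # K)), ts) (enc (Ret r K), ts[Suc r := (tape_of (bdec bs), h)])"
    using go_Dec_scan[OF Dec.prems(2) ok, of "[]" bs] bs Dec.hyps by auto
  have "rep (s(r := s r - 1)) w (ts[Suc r := (tape_of (bdec bs), 1)])"
    using rep_upd[OF Dec.prems(3) r, of "bdec bs"] bval_bdec[of bs] length_bdec[of bs] bs Dec.hyps by simp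
  moreover have "go (enc (Ret r K), ts[Suc r := (tape_of (bdec bs), h)]) (enc (Go K), ts[Suc r := (tape_of (bdec bs), 1)])"
    by (rule go_Ret[OF r K heads_ok_upd[OF ok]]) (use h H in auto)
  ultimately show ?case using K h(2) reach_trans by blast
next
  case (Seq a c' b)
  obtain s1 w1 where c': "c' = (s1, w1)" by (cases c')
  have ab: "a # b # K \<in> CC" using CC_next[OF Seq.prems(2)] by simp
  obtain ts1 where 1: "b # K \<in> CC" "rep s1 w1 ts1" "go (enc (Go (a # b # K)), ts) (enc (Go (b # K)), ts1)"
    using Seq.hyps(2)[OF c' Seq.prems(1) ab Seq.prems(3)] by blast
  obtain ts2 where 2: "K \<in> CC" "rep s' w' ts2" "go (enc (Go (b # K)), ts1) (enc (Go K), ts2)"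
    using Seq.hyps(4)[OF c' Seq.prems(1) 1(1,2)] by blast
  have ok: "heads_ok ts" using rep_heads_ok Seq.prems(3) .
  \<comment> \<open>\<open>go_step\<close> speaks of a tape list with one updated entry; here tape 0
    is updated with itself.\<close>
  have u: "ts[0 := (fst (ts ! 0), snd (ts ! 0))] = ts" using list_update_id[of ts 0] by simp
  have "go (enc (Go (Seq a b # K)), ts) (enc (Go (a # b # K)), ts)"
    using go_step[of "Go (Seq a b # K)" ts "fst (ts ! 0)" "snd (ts ! 0)"] Seq.prems(2) ok u by simp
  then show ?case using 1(3) 2 reach_trans by blast
next
  case (WhileF s r a w)
  have r: "r < R" using CC_regs[OF WhileF.prems(2)] by simp
  have K: "K \<in> CC" using CC_next[OF WhileF.prems(2)] by simp
  obtain bs where bs: "ts[Suc r := (tape_of ([] @ bs), Suc (length []))] = ts" "bval bs = s r" "length bs \<le> N"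
    using rep_reg[OF WhileF.prems(3) r] .
  have ok: "heads_ok ts" using rep_heads_ok WhileF.prems(3) .
  obtain h where h: "h \<le> N" "go (enc (Go (While r a # K)), ts) (enc (Ret r K), ts[Suc r := (tape_of bs, h)])"
    using go_While_scan[OF WhileF.prems(2) ok, of "[]" bs] bs WhileF.hyps by auto
  have "go (enc (Ret r K), ts[Suc r := (tape_of bs, h)]) (enc (Go K), ts[Suc r := (tape_of bs, 1)])"
    by (rule go_Ret[OF r K heads_ok_upd[OF ok]]) (use h H in auto)
  moreover have e: "ts[Suc r := (tape_of bs, 1)] = ts" using bs(1) by simp
  ultimately have "go (enc (Go (While r a # K)), ts) (enc (Go K), ts)"
    using h(2) reach_trans unfolding e by blast
  then show ?case using K WhileF.prems(3) by blast
next
  case (WhileT s r a w c)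
  obtain s1 w1 where c: "c = (s1, w1)" by (cases c)
  have r: "r < R" using CC_regs[OF WhileT.prems(2)] by simp
  have aK: "a # While r a # K \<in> CC" using CC_next[OF WhileT.prems(2)] by simp
  obtain bs where bs: "ts[Suc r := (tape_of ([] @ bs), Suc (length []))] = ts" "bval bs = s r" "length bs \<le> N"
    using rep_reg[OF WhileT.prems(3) r] .
  have ok: "heads_ok ts" using rep_heads_ok WhileT.prems(3) .
  obtain h where h: "h \<le> N" "go (enc (Go (While r a # K)), ts)
      (enc (Ret r (a # While r a # K)), ts[Suc r := (tape_of bs, h)])"
    using go_While_scan[OF WhileT.prems(2) ok, of "[]" bs] bs WhileT.hyps(1) by auto
  have "go (enc (Ret r (a # While r a # K)), ts[Suc r := (tape_of bs, h)])
      (enc (Go (a # While r a # K)), ts[Suc r := (tape_of bs, 1)])"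
    by (rule go_Ret[OF r aK heads_ok_upd[OF ok]]) (use h H in auto)
  moreover have e: "ts[Suc r := (tape_of bs, 1)] = ts" using bs(1) by simp
  ultimately have 0: "go (enc (Go (While r a # K)), ts) (enc (Go (a # While r a # K)), ts)"
    using h(2) reach_trans unfolding e by blast
  obtain ts1 where 1: "While r a # K \<in> CC" "rep s1 w1 ts1"
      "go (enc (Go (a # While r a # K)), ts) (enc (Go (While r a # K)), ts1)"
    using WhileT.hyps(3)[OF c WhileT.prems(1) aK WhileT.prems(3)] by blast
  obtain ts2 where 2: "K \<in> CC" "rep s' w' ts2" "go (enc (Go (While r a # K)), ts1) (enc (Go K), ts2)"
    using WhileT.hyps(5)[OF c WhileT.prems(1) 1(1,2)] by blast
  show ?case using 0 1(3) 2 reach_trans by blast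
next
  case (ReadE g s)
  have K: "K \<in> CC" using CC_next[OF ReadE.prems(2)] by simp
  have ok: "heads_ok ts" using rep_heads_ok ReadE.prems(3) .
  obtain p where p: "ts ! 0 = (inp, p)" "p \<ge> length w0" using ReadE.prems(3) unfolding rep_def by auto
  have u: "ts[0 := (inp, p)] = ts" using list_update_id[of ts 0] p by simp
  have "go (enc (Go (ReadLoop g # K)), ts) (enc (Go K), ts)"
    using go_step[of "Go (ReadLoop g # K)" ts inp p] ReadE.prems(2) ok u p by (simp add: inp_def fun_upd_idem)
  then show ?case using K ReadE.prems(3) by blast
next
  case (ReadC g l s w c)
  obtain s1 w1 where c: "c = (s1, w1)" by (cases c)
  have gK: "g l # ReadLoop g # K \<in> CC" using CC_next[OF ReadC.prems(2)] by simp
  have ok: "heads_ok ts" using rep_heads_ok ReadC.prems(3) .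
  obtain p where p: "ts ! 0 = (inp, p)" "p \<le> length w0" "l # w = drop p w0"
    using ReadC.prems(3) unfolding rep_def by auto
  then have p1: "p < length w0" "w0 ! p = l" "w = drop (Suc p) w0"
    by (metis drop_all leI list.distinct(1), metis nth_via_drop, metis drop_Suc drop_tl list.sel(3))
  then have inp: "inp p = Inp l" by (simp add: inp_def)
  have u: "ts[0 := (inp, p)] = ts" using list_update_id[of ts 0] p by simp
  have 0: "go (enc (Go (ReadLoop g # K)), ts) (enc (Go (g l # ReadLoop g # K)), ts[0 := (inp, Suc p)])"
    using go_step[of "Go (ReadLoop g # K)" ts inp p] ReadC.prems(2) ok u inp by (simp add: fun_upd_idem)
  have rep: "rep s w (ts[0 := (inp, Suc p)])"
    using ReadC.prems(3) p1 unfolding rep_def by (auto simp: nth_list_update)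
  obtain ts1 where 1: "ReadLoop g # K \<in> CC" "rep s1 w1 ts1"
      "go (enc (Go (g l # ReadLoop g # K)), ts[0 := (inp, Suc p)]) (enc (Go (ReadLoop g # K)), ts1)"
    using ReadC.hyps(2)[OF c ReadC.prems(1) gK rep] by blast
  obtain ts2 where 2: "K \<in> CC" "rep s' w' ts2" "go (enc (Go (ReadLoop g # K)), ts1) (enc (Go K), ts2)"
    using ReadC.hyps(4)[OF c ReadC.prems(1) 1(1,2)] by blast
  show ?case using 0 1(3) 2 reach_trans by blast
qed

lemma go_init:
  "\<exists>ts. rep (\<lambda>_. 0) w0 ts \<and> go (initial machine w0) (enc (Go [main]), ts)"
proof -
  \<comment> \<open>The tapes after the markers of the first \<open>k\<close> registers have been
    written.\<close>
  let ?T = "\<lambda>k. (inp, 0) # replicate k (tape_of [], 1) @ replicate (R - k) (\<lambda>_. Blank, 0)"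
  have ok: "heads_ok (?T k)" if "k \<le> R" for k
    using that H by (auto simp: heads_ok_def)
  have e: "(\<lambda>_. Blank)(0 := Work 2) = tape_of []"
    by (simp add: fun_eq_iff tape_of_def split: nat.split)
  have st: "go (enc (Init k), ?T k) (enc (if Suc k < R then Init (Suc k) else Go [main]), ?T (Suc k))" if "k < R" for k
  proof -
    define m where "m = R - Suc k"
    have m: "R - k = Suc m" "R - Suc k = m" using that by (simp_all add: m_def)
    have 1: "(?T k)[Suc k := ((\<lambda>_. Blank), 0)] = ?T k"
      unfolding m by (simp add: list_update_append)
    have 2: "(?T k)[Suc k := (tape_of [], 1)] = ?T (Suc k)"
      unfolding m by (simp add: list_update_append replicate_append_same replicate_app_Cons_same)
    have "go (enc (Init k), (?T k)[Suc k := ((\<lambda>_. Blank), 0)])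
        (enc (if Suc k < R then Init (Suc k) else Go [main]), (?T k)[Suc k := (tape_of [], 1)])"
    proof (rule go_step'[where m = Go_Right and s' = "Work 2"])
      show "heads_ok ((?T k)[Suc k := ((\<lambda>_. Blank), 0)])" unfolding 1 using ok[of k] that by simp
    qed (use that e in auto)
    then show ?thesis unfolding 1 2 .
  qed
  have "go (enc (Init 0), ?T 0) (enc (if k < R then Init k else Go [main]), ?T k)" if "k \<le> R" for k
    using that
  proof (induction k)
    case 0
    then show ?case using out by (simp add: reach_here)
  next
    case (Suc k)
    have k: "k < R" "k \<le> R" using Suc.prems by simp_all
    have "go (enc (Init 0), ?T 0) (enc (Init k), ?T k)" using Suc.IH[OF k(2)] k(1) by simp
    then show ?case using st[OF k(1)] reach_trans by blast
  qed
  from this[of R] have "go (enc (Init 0), ?T 0) (enc (Go [main]), ?T R)" by simp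
  moreover have "initial machine w0 = (enc (Init 0), ?T 0)"
    by (simp add: initial_def inp_def)
  moreover have "rep (\<lambda>_. 0) w0 (?T R)"
    unfolding rep_def by (auto intro!: exI[of _ 0] exI[of _ "[]"])
  ultimately show ?thesis by (intro exI[of _ "?T R"]) simp
qed

lemma machine_run:
  assumes "exec B main (\<lambda>_. 0, w0) (s', w')" "B \<le> 2 ^ N"
  shows "(\<exists>t. fst (run machine w0 t) = (if s' out = 0 then reject machine else accept machine))
     \<and> space_bounded machine w0 H"
proof -
  obtain ts where ts: "rep (\<lambda>_. 0) w0 ts" "go (initial machine w0) (enc (Go [main]), ts)" using go_init by blast
  obtain ts1 where ts1: "rep s' w' ts1" "go (enc (Go [main]), ts) (enc (Go []), ts1)"
    using go_exec[OF assms main_CC(1) ts(1)] by blast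
  obtain bs where bs: "ts1[Suc out := (tape_of ([] @ bs), Suc (length []))] = ts1" "bval bs = s' out" "length bs \<le> N"
    using rep_reg[OF ts1(1) out] .
  have ok: "heads_ok ts1" using rep_heads_ok ts1(1) .
  let ?q = "if s' out = 0 then Rej else Acc"
  obtain h where h: "h < H" "go (enc (Go []), ts1) (enc ?q, ts1[Suc out := (tape_of bs, h)])"
    using go_Halt_scan[OF ok, of "[]" bs] bs by auto
  have g: "go (initial machine w0) (enc ?q, ts1[Suc out := (tape_of bs, h)])"
    by (rule reach_trans[OF reach_trans[OF ts(2) ts1(2)] h(2)])
  have "heads_ok (ts1[Suc out := (tape_of bs, h)])" by (rule heads_ok_upd[OF ok h(1)])
  then have 1: "\<forall>(f, h) \<in> set (snd (enc ?q, ts1[Suc out := (tape_of bs, h)])). h < H"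
    unfolding heads_ok_def snd_conv by (rule conjunct2)
  have 2: "fst (enc ?q, ts1[Suc out := (tape_of bs, h)]) = accept machine
      \<or> fst (enc ?q, ts1[Suc out := (tape_of bs, h)]) = reject machine"
    by simp
  have 3: "fst (enc ?q, ts1[Suc out := (tape_of bs, h)]) = (if s' out = 0 then reject machine else accept machine)"
    by simp
  from reach_run[OF g 2 1] show ?thesis unfolding 3 run_def space_bounded_def .
qed

end

end

section \<open>Functions computable in polynomial space\<close>

text \<open>Arguments of the functions below are environments of natural numbers, and the size of an
  environment is a bound \<open>m\<close> on the number of binary digits of all its entries.\<close>

definition psp :: "(env \<Rightarrow> nat) \<Rightarrow> bool" where
  "psp f \<longleftrightarrow> (\<exists>a (q :: nat poly). \<forall>e. eval a e = f e \<and>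
     (\<forall>m. (\<forall>i. e i < 2 ^ m) \<longrightarrow> vals_below (2 ^ poly q m) a e))"

definition pspp :: "(env \<Rightarrow> bool) \<Rightarrow> bool" where
  "pspp P \<longleftrightarrow> psp (\<lambda>e. of_bool (P e))"

definition poly_bits :: "(env \<Rightarrow> nat) \<Rightarrow> bool" where
  "poly_bits f \<longleftrightarrow> (\<exists>q :: nat poly. \<forall>e m. (\<forall>i. e i < 2 ^ m) \<longrightarrow> f e < 2 ^ poly q m)"

text \<open>A bound on the value itself instead of its digits, as required of exponents and of the
  depth of games.\<close>

definition poly_small :: "(env \<Rightarrow> nat) \<Rightarrow> bool" where
  "poly_small f \<longleftrightarrow> (\<exists>q :: nat poly. \<forall>e m. (\<forall>i. e i < 2 ^ m) \<longrightarrow> f e \<le> poly q m)"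

section \<open>Composition and bounded recursion\<close>

lemma pspI:
  assumes "\<And>e. eval a e = f e"
    "\<And>e m. \<forall>i. e i < 2 ^ m \<Longrightarrow> vals_below (2 ^ poly (q :: nat poly) m) a e"
  shows "psp f"
  using assms unfolding psp_def by blast

lemma pspE:
  assumes "psp f"
  obtains a and q :: "nat poly" where "\<And>e. eval a e = f e"
    "\<And>e m. \<forall>i. e i < 2 ^ m \<Longrightarrow> vals_below (2 ^ poly q m) a e"
    "\<And>e m. \<forall>i. e i < 2 ^ m \<Longrightarrow> f e < 2 ^ poly q m"
proof -
  obtain a and q :: "nat poly" where 1: "\<forall>e. eval a e = f e \<and>
     (\<forall>m. (\<forall>i. e i < 2 ^ m) \<longrightarrow> vals_below (2 ^ poly q m) a e)"
    using assms unfolding psp_def by blast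
  show thesis by (rule that[of a q]) (use 1 vals_below_eval in \<open>metis+\<close>)
qed

lemma psp_poly_bits: "psp f \<Longrightarrow> poly_bits f"
  unfolding poly_bits_def by (elim pspE) blast

lemma psp_let:
  assumes "psp g" "psp (\<lambda>e. F (e 0) (\<lambda>i. e (Suc i)))"
  shows "psp (\<lambda>e. F (g e) e)"
proof -
  obtain a and p :: "nat poly" where a: "\<And>e. eval a e = g e"
    "\<And>e m. \<forall>i. e i < 2 ^ m \<Longrightarrow> vals_below (2 ^ poly p m) a e"
    "\<And>e m. \<forall>i. e i < 2 ^ m \<Longrightarrow> g e < 2 ^ poly p m" by (rule pspE[OF assms(1)]) (rule that)
  obtain b and q :: "nat poly" where b: "\<And>e. eval b e = F (e 0) (\<lambda>i. e (Suc i))"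
    "\<And>e m. \<forall>i. e i < 2 ^ m \<Longrightarrow> vals_below (2 ^ poly q m) b e"
    by (rule pspE[OF assms(2)]) (rule that)
  \<comment> \<open>The extended environment has entries of at most \<open>poly p m + m\<close>
    digits, which is the size at which \<open>b\<close> is evaluated.\<close>
  let ?p = "p + pcompose q (p + [:0, 1:])"
  show ?thesis
  proof (rule pspI[of "ELet a b" _ ?p])
    fix e :: env and m assume e: "\<forall>i. e i < 2 ^ m"
    have "push (g e) e i < 2 ^ (poly p m + m)" for i
    proof (cases i)
      case 0
      have "g e < 2 ^ poly p m" using a(3)[of e m, OF e] .
      also have "\<dots> \<le> 2 ^ (poly p m + m)" by simp
      finally show ?thesis using 0 by simp
    next
      case (Suc j)
      have "e j < 2 ^ m" using e by blast
      also have "\<dots> \<le> 2 ^ (poly p m + m)" by simp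
      finally show ?thesis using Suc by simp
    qed
    then have "vals_below (2 ^ poly q (poly p m + m)) b (push (g e) e)" by (intro b(2) allI)
    moreover have "vals_below (2 ^ poly p m) a e" by (rule a(2)[of e m, OF e])
    ultimately show "vals_below (2 ^ poly ?p m) (ELet a b) e"
      unfolding vals_below.simps a(1) by (auto elim!: vals_below_mono simp: poly_pcompose)
  qed (simp add: a b)
qed

lemma psp_ren: 
  assumes "psp f"
  shows "psp (\<lambda>e. f (\<lambda>i. e (r i)))"
proof -
  obtain a and p :: "nat poly" where a: "\<And>e. eval a e = f e"
    "\<And>e m. \<forall>i. e i < 2 ^ m \<Longrightarrow> vals_below (2 ^ poly p m) a e" by (rule pspE[OF assms]) (rule that)
  show ?thesis by (rule pspI[of "ERen r a" _ p]) (use a in auto)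
qed

lemma psp_var: "psp (\<lambda>e. e i)"
  by (rule pspI[of "EVar i" _ "[:0, 1:]"]) auto

lemma psp_Suc:
  assumes "psp f"
  shows "psp (\<lambda>e. Suc (f e))"
proof -
  obtain a and p :: "nat poly" where a: "\<And>e. eval a e = f e"
    "\<And>e m. \<forall>i. e i < 2 ^ m \<Longrightarrow> vals_below (2 ^ poly p m) a e"
    "\<And>e m. \<forall>i. e i < 2 ^ m \<Longrightarrow> f e < 2 ^ poly p m" by (rule pspE[OF assms]) (rule that)
  show ?thesis
  proof (rule pspI[of "ESuc a" _ "p + 1"])
    fix e :: env and m assume e: "\<forall>i. e i < 2 ^ m"
    have "Suc (f e) < 2 ^ (Suc (poly p m))" using a(3)[of e m, OF e] by simp
    moreover have "vals_below (2 ^ Suc (poly p m)) a e" by (rule vals_below_mono[OF a(2)[of e m, OF e]]) simp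
    ultimately show "vals_below (2 ^ poly (p + 1) m) (ESuc a) e" by (simp add: a)
  qed (simp add: a)
qed

lemma psp_const: "psp (\<lambda>e. c)"
proof (induction c)
  case 0
  show ?case by (rule pspI[of EZero _ 0]) auto
qed (rule psp_Suc)

text \<open>The number of rounds may be exponential, so even repeated doubling would leave
  polynomial space; the bound \<open>b\<close> on all intermediate accumulators prevents
  this.\<close>

lemma psp_rec:
  assumes "psp n" "psp i" "psp (\<lambda>e. s (e 1) (e 0) (\<lambda>j. e (Suc (Suc j))))" "poly_bits b"
    "\<And>e k. k \<le> n e \<Longrightarrow> rec_nat (i e) (\<lambda>k a. s k a e) k \<le> b e"
  shows "psp (\<lambda>e. rec_nat (i e) (\<lambda>k a. s k a e) (n e))"
proof -
  obtain n' and p1 :: "nat poly" where n: "\<And>e. eval n' e = n e"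
    "\<And>e m. \<forall>i. e i < 2 ^ m \<Longrightarrow> vals_below (2 ^ poly p1 m) n' e"
    "\<And>e m. \<forall>i. e i < 2 ^ m \<Longrightarrow> n e < 2 ^ poly p1 m" by (rule pspE[OF assms(1)]) (rule that)
  obtain i' and p2 :: "nat poly" where i: "\<And>e. eval i' e = i e"
    "\<And>e m. \<forall>i. e i < 2 ^ m \<Longrightarrow> vals_below (2 ^ poly p2 m) i' e"
    by (rule pspE[OF assms(2)]) (rule that)
  obtain s' and p3 :: "nat poly" where s: "\<And>e. eval s' e = s (e 1) (e 0) (\<lambda>j. e (Suc (Suc j)))"
    "\<And>e m. \<forall>i. e i < 2 ^ m \<Longrightarrow> vals_below (2 ^ poly p3 m) s' e"
    by (rule pspE[OF assms(3)]) (rule that)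
  obtain p4 :: "nat poly" where b: "\<And>e m. \<forall>i. e i < 2 ^ m \<Longrightarrow> b e < 2 ^ poly p4 m"
    using assms(4) unfolding poly_bits_def by blast
  \<comment> \<open>Digits of the environment of the step: round number, accumulator and the old
    entries.\<close>
  let ?h = "p1 + p4 + [:0, 1:]"
  let ?p = "p1 + p2 + pcompose p3 ?h"
  have ev: "eval s' (push a (push k e)) = s k a e" for a k e by (simp add: s)
  show ?thesis
  proof (rule pspI[of "ERec n' i' s'" _ ?p])
    show "eval (ERec n' i' s') e = rec_nat (i e) (\<lambda>k a. s k a e) (n e)" for e
      by (simp add: ev n i)
    fix e :: env and m assume e: "\<forall>i. e i < 2 ^ m"
    have "vals_below (2 ^ poly p3 (poly ?h m)) s' (push (rec_nat (i e) (\<lambda>k a. s k a e) k) (push k e))"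
      if k: "k < n e" for k
    proof (rule s(2), rule allI)
      fix j
      have le: "(2::nat) ^ poly p4 m \<le> 2 ^ poly ?h m" "(2::nat) ^ poly p1 m \<le> 2 ^ poly ?h m"
        "(2::nat) ^ m \<le> 2 ^ poly ?h m" by simp_all
      have "rec_nat (i e) (\<lambda>k a. s k a e) k < 2 ^ poly ?h m"
        using assms(5)[of k e] b[of e m, OF e] k le(1) by linarith
      moreover have "k < 2 ^ poly ?h m" using k n(3)[of e m, OF e] le(2) by linarith
      moreover have "e j' < 2 ^ poly ?h m" for j' using e le(3) less_le_trans by blast
      ultimately show "push (rec_nat (i e) (\<lambda>k a. s k a e) k) (push k e) j < 2 ^ poly ?h m"
        by (simp split: nat.split)
    qed
    then have "vals_below (2 ^ poly ?p m) s' (push (rec_nat (i e) (\<lambda>k a. s k a e) k) (push k e))"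
      if "k < n e" for k
      by (rule vals_below_mono[OF _ power_increasing]) (use that in \<open>simp_all add: poly_pcompose\<close>)
    moreover have "vals_below (2 ^ poly ?p m) n' e" by (rule vals_below_mono[OF n(2)[of e m, OF e]]) simp
    moreover have "vals_below (2 ^ poly ?p m) i' e" by (rule vals_below_mono[OF i(2)[of e m, OF e]]) simp
    ultimately show "vals_below (2 ^ poly ?p m) (ERec n' i' s') e"
      by (simp add: ev n i)
  qed
qed

section \<open>Growth conditions\<close>

lemma poly_bits_mono: "poly_bits g \<Longrightarrow> (\<And>e. f e \<le> g e) \<Longrightarrow> poly_bits f"
  unfolding poly_bits_def by (meson le_less_trans)

lemma poly_bits_plus:
  assumes "poly_bits f" "poly_bits g"
  shows "poly_bits (\<lambda>e. f e + g e)"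
proof -
  obtain p q :: "nat poly" where "\<And>e m. \<forall>i. e i < 2 ^ m \<Longrightarrow> f e < 2 ^ poly p m"
    "\<And>e m. \<forall>i. e i < 2 ^ m \<Longrightarrow> g e < 2 ^ poly q m"
    using assms unfolding poly_bits_def by blast
  note pq = this
  have "f e + g e < 2 ^ poly (p + q + 1) m" if e: "\<forall>i. e i < 2 ^ m" for e m
  proof -
    have "f e < 2 ^ poly p m" "g e < 2 ^ poly q m" using pq e by blast+
    moreover have "(2::nat) ^ poly p m \<le> 2 ^ poly (p + q) m" "(2::nat) ^ poly q m \<le> 2 ^ poly (p + q) m"
      by simp_all
    ultimately have "f e + g e < 2 * 2 ^ poly (p + q) m" by linarith
    then show ?thesis by simp
  qed
  then show ?thesis unfolding poly_bits_def by blast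
qed

lemma poly_bits_power:
  assumes "poly_bits f" "poly_small g"
  shows "poly_bits (\<lambda>e. f e ^ g e)"
proof -
  obtain p q :: "nat poly" where p: "\<And>e m. \<forall>i. e i < 2 ^ m \<Longrightarrow> f e < 2 ^ poly p m"
    and q: "\<And>e m. \<forall>i. e i < 2 ^ m \<Longrightarrow> g e \<le> poly q m"
    using assms unfolding poly_bits_def poly_small_def by blast
  have "f e ^ g e < 2 ^ poly (p * q + 1) m" if e: "\<forall>i. e i < 2 ^ m" for e m
  proof -
    have 1: "f e < 2 ^ poly p m" "g e \<le> poly q m" using p q e by blast+
    have "f e ^ g e \<le> (2 ^ poly p m) ^ g e" by (rule power_mono) (use 1 in auto)
    also have "\<dots> \<le> (2 ^ poly p m) ^ poly q m" by (rule power_increasing) (use 1 in auto)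
    also have "\<dots> = 2 ^ (poly p m * poly q m)" by (simp add: power_mult)
    also have "\<dots> < 2 ^ poly (p * q + 1) m" by simp
    finally show ?thesis .
  qed
  then show ?thesis unfolding poly_bits_def by blast
qed

lemma poly_bits_const: "poly_bits (\<lambda>e. c)"
  by (rule psp_poly_bits[OF psp_const])

lemma poly_bits_times:
  assumes "poly_bits f" "poly_bits g"
  shows "poly_bits (\<lambda>e. f e * g e)"
proof -
  have "poly_small (\<lambda>e. 2)" unfolding poly_small_def by (auto intro!: exI[of _ "[:2:]"])
  then have "poly_bits (\<lambda>e. (f e + g e) ^ 2)"
    by (intro poly_bits_power poly_bits_plus assms)
  then show ?thesis by (rule poly_bits_mono) (simp add: power2_eq_square algebra_simps)
qed

lemma poly_small_const: "poly_small (\<lambda>e. c)"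
  unfolding poly_small_def by (auto intro!: exI[of _ "[:c:]"])

lemma poly_small_plus:
  assumes "poly_small f" "poly_small g"
  shows "poly_small (\<lambda>e. f e + g e)"
proof -
  obtain p q :: "nat poly" where "\<And>e m. \<forall>i. e i < 2 ^ m \<Longrightarrow> f e \<le> poly p m"
    "\<And>e m. \<forall>i. e i < 2 ^ m \<Longrightarrow> g e \<le> poly q m"
    using assms unfolding poly_small_def by blast
  then have "f e + g e \<le> poly (p + q) m" if "\<forall>i. e i < 2 ^ m" for e m
    using that by (simp add: add_mono)
  then show ?thesis unfolding poly_small_def by blast
qed

section \<open>Arithmetic, Boolean connectives and bounded quantifiers\<close>

lemma psp_pred: assumes "psp f" shows "psp (\<lambda>e. f e - 1)"
proof -
  have 1: "rec_nat 0 (\<lambda>k a. k) n = n - 1" for n by (cases n) auto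
  have "psp (\<lambda>e. rec_nat 0 (\<lambda>k a. k) (f e))"
    by (rule psp_rec[where b = f]) (use assms 1 in \<open>auto intro: psp_const psp_var psp_poly_bits\<close>)
  then show ?thesis by (simp only: 1)
qed

lemma psp_minus: assumes "psp f" "psp g" shows "psp (\<lambda>e. f e - g e)"
proof -
  have 1: "rec_nat m (\<lambda>k a. a - 1) n = m - n" for m n :: nat by (induction n) auto
  have "psp (\<lambda>e. rec_nat (f e) (\<lambda>k a. a - 1) (g e))"
    by (rule psp_rec[where b = f], unfold 1)
      (use assms in \<open>auto intro: psp_pred[unfolded One_nat_def] psp_var psp_poly_bits\<close>)
  then show ?thesis by (simp only: 1)
qed

lemma psp_plus: assumes "psp f" "psp g" shows "psp (\<lambda>e. f e + g e)"
proof -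
  have 1: "rec_nat m (\<lambda>k a. Suc a) n = m + n" for m n :: nat by (induction n) auto
  have "psp (\<lambda>e. rec_nat (f e) (\<lambda>k a. Suc a) (g e))"
    by (rule psp_rec[where b = "\<lambda>e. f e + g e"], unfold 1)
      (use assms in \<open>auto intro: psp_Suc psp_var psp_poly_bits poly_bits_plus\<close>)
  then show ?thesis by (simp only: 1)
qed

lemma psp_times: assumes "psp f" "psp g" shows "psp (\<lambda>e. f e * g e)"
proof -
  have 1: "rec_nat 0 (\<lambda>k a. a + n) m = m * n" for m n :: nat by (induction m) auto
  have "psp (\<lambda>e. rec_nat 0 (\<lambda>k a. a + g e) (f e))"
    by (rule psp_rec[where b = "\<lambda>e. f e * g e"], unfold 1)
      (use assms in \<open>auto intro: psp_const psp_plus psp_var psp_ren psp_poly_bits poly_bits_times\<close>)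
  then show ?thesis by (simp only: 1)
qed

lemma psp_if: assumes "pspp P" "psp f" "psp g" shows "psp (\<lambda>e. if P e then f e else g e)"
proof -
  \<comment> \<open>A case distinction is a recursion with one round or none.\<close>
  have 1: "rec_nat m (\<lambda>k a. n) (of_bool B) = (if B then n else m)" for m n :: nat and B by auto
  have 2: "rec_nat m (\<lambda>k a. n) k \<le> n + m" for m n k :: nat by (cases k) auto
  have "psp (\<lambda>e. rec_nat (g e) (\<lambda>k a. f e) (of_bool (P e)))"
    by (rule psp_rec[where b = "\<lambda>e. f e + g e"])
      (use assms 2 in \<open>auto intro: psp_ren psp_poly_bits poly_bits_plus simp: pspp_def\<close>)
  then show ?thesis by (simp only: 1)
qed

lemma psp_of_bool: "pspp P \<Longrightarrow> psp (\<lambda>e. of_bool (P e))" by (simp add: pspp_def)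

lemma pspp_const: "pspp (\<lambda>e. b)" by (simp add: pspp_def psp_const)

lemma pspp_not: assumes "pspp P" shows "pspp (\<lambda>e. \<not> P e)"
proof -
  have "(\<lambda>e. of_bool (\<not> P e) :: nat) = (\<lambda>e. 1 - of_bool (P e))" by auto
  then show ?thesis unfolding pspp_def
    by (simp only:) (intro psp_minus psp_const psp_of_bool assms)
qed

lemma pspp_conj: assumes "pspp P" "pspp Q" shows "pspp (\<lambda>e. P e \<and> Q e)"
proof -
  have "(\<lambda>e. of_bool (P e \<and> Q e) :: nat) = (\<lambda>e. of_bool (P e) * of_bool (Q e))" by auto
  then show ?thesis unfolding pspp_def
    by (simp only:) (intro psp_times psp_of_bool assms)
qed

lemma pspp_disj: assumes "pspp P" "pspp Q" shows "pspp (\<lambda>e. P e \<or> Q e)"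
  using pspp_not[OF pspp_conj[OF assms[THEN pspp_not]]] by simp

lemma pspp_imp: assumes "pspp P" "pspp Q" shows "pspp (\<lambda>e. P e \<longrightarrow> Q e)"
  using pspp_disj[OF pspp_not[OF assms(1)] assms(2)] unfolding imp_conv_disj .

lemma pspp_iff: assumes "pspp P" "pspp Q" shows "pspp (\<lambda>e. P e \<longleftrightarrow> Q e)"
proof -
  have "(\<lambda>e. P e \<longleftrightarrow> Q e) = (\<lambda>e. (P e \<longrightarrow> Q e) \<and> (Q e \<longrightarrow> P e))" by auto
  moreover have "pspp (\<lambda>e. (P e \<longrightarrow> Q e) \<and> (Q e \<longrightarrow> P e))" by (rule pspp_conj[OF pspp_imp[OF assms] pspp_imp[OF assms(2,1)]])
  ultimately show ?thesis by (rule ssubst[where P = pspp])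
qed

lemma pspp_less: assumes "psp f" "psp g" shows "pspp (\<lambda>e. f e < g e)"
proof -
  have "(\<lambda>e. of_bool (f e < g e) :: nat) = (\<lambda>e. 1 - (1 - (g e - f e)))" by auto
  then show ?thesis unfolding pspp_def
    by (simp only:) (intro psp_minus psp_const assms)
qed

lemma pspp_le: assumes "psp f" "psp g" shows "pspp (\<lambda>e. f e \<le> g e)"
  using pspp_not[OF pspp_less[OF assms(2,1)]] unfolding not_less .

lemma pspp_eq: assumes "psp f" "psp g" shows "pspp (\<lambda>e. f e = g e)"
proof -
  have "(\<lambda>e. f e = g e) = (\<lambda>e. f e \<le> g e \<and> g e \<le> f e)" by auto
  moreover have "pspp (\<lambda>e. f e \<le> g e \<and> g e \<le> f e)" by (rule pspp_conj[OF pspp_le[OF assms] pspp_le[OF assms(2,1)]])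
  ultimately show ?thesis by (rule ssubst[where P = pspp])
qed

lemma pspp_ren: "pspp P \<Longrightarrow> pspp (\<lambda>e. P (\<lambda>i. e (r i)))"
  unfolding pspp_def by (rule psp_ren)

text \<open>Exhaustive search over possibly exponentially many candidates. Only one truth value is
  carried from round to round, so the accumulator is bounded by 1.\<close>

lemma pspp_ex:
  assumes "psp n" "pspp (\<lambda>e. P (e 0) (\<lambda>i. e (Suc i)))"
  shows "pspp (\<lambda>e. \<exists>x<n e. P x e)"
proof -
  let ?r = "\<lambda>e n. rec_nat 0 (\<lambda>k a. if P k e then 1 else a) n :: nat"
  have 1: "?r e k = of_bool (\<exists>x<k. P x e)" for e k
    by (induction k) (auto simp: less_Suc_eq)
  have "psp (\<lambda>e. ?r e (n e))"
  proof (rule psp_rec[where b = "\<lambda>e. 1"])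
    show "psp (\<lambda>e. if P (e 1) (\<lambda>j. e (Suc (Suc j))) then 1 else e 0)"
      using pspp_ren[OF assms(2), of Suc] by (intro psp_if psp_const psp_var) simp
  qed (use assms in \<open>auto simp: 1 intro: psp_const poly_bits_const\<close>)
  then show ?thesis unfolding pspp_def 1 .
qed

lemma pspp_all:
  assumes "psp n" "pspp (\<lambda>e. P (e 0) (\<lambda>i. e (Suc i)))"
  shows "pspp (\<lambda>e. \<forall>x<n e. P x e)"
proof -
  have "pspp (\<lambda>e. \<not> (\<exists>x<n e. \<not> P x e))" by (intro pspp_not pspp_ex assms)
  then show ?thesis by simp
qed

lemma pspp_ex_le:
  assumes "psp n" "pspp (\<lambda>e. P (e 0) (\<lambda>i. e (Suc i)))"
  shows "pspp (\<lambda>e. \<exists>x\<le>n e. P x e)"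
  using pspp_ex[OF psp_Suc[OF assms(1)] assms(2)] by (simp only: less_Suc_eq_le)

lemma pspp_all_le:
  assumes "psp n" "pspp (\<lambda>e. P (e 0) (\<lambda>i. e (Suc i)))"
  shows "pspp (\<lambda>e. \<forall>x\<le>n e. P x e)"
  using pspp_all[OF psp_Suc[OF assms(1)] assms(2)] by (simp only: less_Suc_eq_le)

lemmas psp_basic = psp_of_bool pspp_not pspp_conj pspp_disj pspp_imp pspp_iff pspp_less pspp_le pspp_eq
  pspp_ex pspp_all pspp_ex_le pspp_all_le psp_if psp_plus psp_times psp_minus psp_Suc psp_var psp_const pspp_const

text \<open>Simultaneous substitution for the first variables. It transfers a closure result stated
  for \<open>e 0\<close>, \<open>e 1\<close> and so on to arbitrary arguments.\<close>

lemma psp_subst: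
  assumes "psp f" "\<forall>g \<in> set gs. psp g"
  shows "psp (\<lambda>e. f (\<lambda>i. if i < length gs then (gs ! i) e else e (i - length gs)))"
  using assms
proof (induction gs arbitrary: f)
  case (Cons g gs)
  let ?f = "\<lambda>e'. f (push (g (\<lambda>i. e' (length gs + i))) e')"
  have f: "psp ?f"
  proof (rule psp_let[where F = "\<lambda>x e. f (push x e)"])
    have "push (e 0) (\<lambda>i. e (Suc i)) = e" for e :: env by (auto simp: fun_eq_iff split: nat.split)
    then show "psp (\<lambda>e. f (push (e 0) (\<lambda>i. e (Suc i))))" using Cons.prems(1) by (simp only:)
    show "psp (\<lambda>e. g (\<lambda>i. e (length gs + i)))" by (rule psp_ren) (use Cons.prems(2) in simp)
  qed
  have "psp (\<lambda>e. ?f (\<lambda>i. if i < length gs then (gs ! i) e else e (i - length gs)))"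
    by (rule Cons.IH[OF f]) (use Cons.prems in simp)
  moreover have "push (g e) (\<lambda>i. if i < length gs then (gs ! i) e else e (i - length gs)) =
    (\<lambda>i. if i < length (g # gs) then ((g # gs) ! i) e else e (i - length (g # gs)))" for e
    by (auto simp: fun_eq_iff split: nat.split)
  ultimately show ?case by simp
qed simp

lemma pspp_subst:
  assumes "pspp P" "\<forall>g \<in> set gs. psp g"
  shows "pspp (\<lambda>e. P (\<lambda>i. if i < length gs then (gs ! i) e else e (i - length gs)))"
  using psp_subst[OF _ assms(2)] assms(1) unfolding pspp_def by blast

lemma psp_let2:
  assumes "psp x" "psp y" "psp (\<lambda>e. F (e 0) (e 1) (\<lambda>i. e (Suc (Suc i))))"
  shows "psp (\<lambda>e. F (x e) (y e) e)"
  using psp_subst[OF assms(3), of "[x, y]"] assms(1,2) by simp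

lemma pspp_let2:
  assumes "psp x" "psp y" "pspp (\<lambda>e. P (e 0) (e 1) (\<lambda>i. e (Suc (Suc i))))"
  shows "pspp (\<lambda>e. P (x e) (y e) e)"
  using psp_let2[OF assms(1,2), of "\<lambda>x y e. of_bool (P x y e)"] assms(3) unfolding pspp_def .

lemma psp_div: assumes "psp f" "psp g" shows "psp (\<lambda>e. f e div g e)"
proof -
  \<comment> \<open>The quotient is counted upwards as long as its successor still fits; for a
    positive divisor, \<open>m\<close> rounds are enough to reach it.\<close>
  let ?r = "\<lambda>m n k. rec_nat 0 (\<lambda>k a. if Suc a * n \<le> m then Suc a else a) k :: nat"
  have 1: "?r m n k = min k (m div n)" if "0 < n" for m n k
  proof (induction k)
    case (Suc k)
    have "Suc a * n \<le> m \<longleftrightarrow> a < m div n" for a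
      using that by (metis Suc_le_eq less_eq_div_iff_mult_less_eq)
    then show ?case using Suc by auto
  qed simp
  have 2: "?r m n k \<le> k" for m n k by (induction k) auto
  have 3: "m div n = (if n = 0 then 0 else ?r m n m)" for m n
  proof (cases "n = 0")
    case False
    then show ?thesis unfolding 1[OF neq0_conv[THEN iffD1, OF False]] using div_le_dividend[of m n]
      by (simp add: min_absorb2)
  qed simp
  have "psp (\<lambda>e. ?r (f e) (g e) (f e))"
    by (rule psp_rec[where b = f], (intro psp_basic psp_ren[OF assms(1)] psp_ren[OF assms(2)] assms)+)
      (rule psp_poly_bits[OF assms(1)], rule order.trans[OF 2])
  then have "psp (\<lambda>e. if g e = 0 then 0 else ?r (f e) (g e) (f e))"
    by (intro psp_basic assms)
  then show ?thesis by (simp only: 3[symmetric])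
qed

lemma psp_mod: assumes "psp f" "psp g" shows "psp (\<lambda>e. f e mod g e)"
proof -
  have "psp (\<lambda>e. f e - f e div g e * g e)" by (intro psp_minus psp_times psp_div assms)
  then show ?thesis by (simp only: minus_div_mult_eq_mod)
qed

lemma psp_power:
  assumes "psp f" "psp g" "poly_small g"
  shows "psp (\<lambda>e. f e ^ g e)"
proof -
  have 1: "rec_nat 1 (\<lambda>k a. a * n) m = n ^ m" for m n :: nat by (induction m) auto
  \<comment> \<open>The base is raised by one because powers of 0 are not monotone in the
    exponent.\<close>
  have 2: "k \<le> m \<Longrightarrow> n ^ k \<le> Suc n ^ m" for k m n :: nat
    by (rule order.trans[OF power_mono[of n "Suc n"] power_increasing]) auto
  have "psp (\<lambda>e. rec_nat 1 (\<lambda>k a. a * f e) (g e))"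
    by (rule psp_rec[where b = "\<lambda>e. Suc (f e) ^ g e"], unfold 1,
        (intro psp_basic psp_ren[OF assms(1)] assms)+)
      (intro poly_bits_power psp_poly_bits psp_Suc assms, rule 2)
  then show ?thesis by (simp only: 1)
qed

text \<open>The divisor may have exponentially many digits. It is never formed: \<open>c\<close> is
  divided out once per round.\<close>

lemma psp_div_power:
  assumes "psp f" "psp g"
  shows "psp (\<lambda>e. f e div c ^ g e)"
proof -
  have 1: "rec_nat n (\<lambda>k a. a div c) m = n div c ^ m" for m n :: nat
    by (induction m) (simp_all add: power_Suc2 div_mult2_eq del: power_Suc)
  have "psp (\<lambda>e. rec_nat (f e) (\<lambda>k a. a div c) (g e))"
    by (rule psp_rec[where b = f], unfold 1, (intro psp_basic psp_div assms)+)
      (rule psp_poly_bits[OF assms(1)], rule div_le_dividend)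
  then show ?thesis by (simp only: 1)
qed

lemma pspp_bit:
  assumes "psp f" "psp g"
  shows "pspp (\<lambda>e. bit (f e) (g e))"
proof -
  have "pspp (\<lambda>e. f e div 2 ^ g e mod 2 = 1)" by (intro psp_basic psp_mod psp_div_power assms)
  then show ?thesis by (simp add: bit_iff_odd odd_iff_mod_2_eq_one)
qed

section \<open>Binary length\<close>

definition bitlen :: "nat \<Rightarrow> nat" where
  "bitlen x = card {k. 2 ^ k \<le> x}"

lemma bitlen_set: "{k. 2 ^ k \<le> x} \<subseteq> {..<x}" for x :: nat
  using less_le_trans[OF less_exp] by auto

lemma bitlen_le: "x < 2 ^ m \<Longrightarrow> bitlen x \<le> m"
proof -
  assume x: "x < 2 ^ m"
  have "{k. 2 ^ k \<le> x} \<subseteq> {..<m}"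
  proof
    fix k assume "k \<in> {k. 2 ^ k \<le> x}"
    then have "2 ^ k \<le> x" by simp
    then have "(2::nat) ^ k < 2 ^ m" using x by (rule le_less_trans)
    then have "k < m" by (rule power_less_imp_less_exp[rotated]) simp
    then show "k \<in> {..<m}" by simp
  qed
  from card_mono[OF _ this] show ?thesis unfolding bitlen_def by simp
qed

lemma bitlen_power: "bitlen (2 ^ n) = Suc n"
proof -
  have "{k. (2::nat) ^ k \<le> 2 ^ n} = {..n}" by auto
  then show ?thesis by (simp add: bitlen_def)
qed

lemma poly_small_bitlen: 
  assumes "psp f"
  shows "poly_small (\<lambda>e. bitlen (f e))"
proof -
  obtain p :: "nat poly" where "\<And>e m. \<forall>i. e i < 2 ^ m \<Longrightarrow> f e < 2 ^ poly p m"
    using psp_poly_bits[OF assms] unfolding poly_bits_def by blast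
  then show ?thesis unfolding poly_small_def using bitlen_le by blast
qed

lemma psp_bitlen:
  assumes "psp f"
  shows "psp (\<lambda>e. bitlen (f e))"
proof -
  \<comment> \<open>\<open>k\<close> runs up to \<open>x\<close>, so the power could be too long to
    write down; dividing \<open>x\<close> repeatedly avoids it.\<close>
  have 0: "2 ^ k \<le> x \<longleftrightarrow> x div 2 ^ k \<noteq> 0" for k x :: nat by (simp add: div_eq_0_iff not_less)
  let ?r = "\<lambda>x k. rec_nat 0 (\<lambda>k a. if x div 2 ^ k \<noteq> 0 then Suc a else a) k :: nat"
  have 1: "?r x n = card {k \<in> {..<n}. 2 ^ k \<le> x}" for x n :: nat
  proof (induction n)
    case (Suc n)
    have "{k \<in> {..<Suc n}. 2 ^ k \<le> x} = (if 2 ^ n \<le> x then insert n {k \<in> {..<n}. 2 ^ k \<le> x} else {k \<in> {..<n}. 2 ^ k \<le> x})"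
      by (auto simp: less_Suc_eq)
    then show ?case using Suc 0 by simp
  qed simp
  have 2: "?r x k \<le> k" for x k :: nat by (induction k) auto
  have 3: "bitlen x = ?r x x" for x
    unfolding 1 bitlen_def using bitlen_set[of x] by (auto intro: arg_cong[of _ _ card])
  have "psp (\<lambda>e. ?r (f e) (f e))"
    by (rule psp_rec[where b = f], (intro psp_basic psp_div_power psp_ren[OF assms] assms)+)
      (rule psp_poly_bits[OF assms], rule order.trans[OF 2])
  then show ?thesis by (simp only: 3)
qed

section \<open>Evaluation of games by depth-first search\<close>

text \<open>The player to move at \<open>x\<close> wins if some legal move leads to a position that
  is lost for the other player. With the budget \<open>k\<close> exhausted, the player to move
  loses.\<close>

primrec gwin :: "nat \<Rightarrow> (nat \<Rightarrow> nat \<Rightarrow> bool) \<Rightarrow> (nat \<Rightarrow> nat \<Rightarrow> nat) \<Rightarrow> nat \<Rightarrow> nat \<Rightarrow> bool" where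
  "gwin B ok nxt 0 x = False"
| "gwin B ok nxt (Suc k) x = (\<exists>y<B. ok x y \<and> \<not> gwin B ok nxt k (nxt x y))"

text \<open>A configuration \<open>(r, k, s)\<close> consists of a mode \<open>r\<close> (\<open>0\<close>: evaluate the frame on top of
  the stack; \<open>1\<close>, \<open>2\<close>: the frame just removed was lost, won), the level \<open>k\<close> of the frame on top,
  and a stack \<open>s\<close> of frames \<open>x * (B + 1) + y\<close>, written in base \<open>F\<close>, where \<open>y\<close> is the next move to
  be tried at \<open>x\<close>.\<close>

definition dfs_step :: "nat \<Rightarrow> nat \<Rightarrow> nat \<Rightarrow> (nat \<Rightarrow> nat \<Rightarrow> bool) \<Rightarrow> (nat \<Rightarrow> nat \<Rightarrow> nat) \<Rightarrow>
    nat \<times> nat \<times> nat \<Rightarrow> nat \<times> nat \<times> nat" where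
  "dfs_step B F D ok nxt = (\<lambda>(r, k, s).
     if k = Suc D then (r, k, s)
     else if r = 0 then
       (if k = 0 \<or> \<not> s mod F mod Suc B < B then (1, Suc k, s div F)
        else if ok (s mod F div Suc B) (s mod F mod Suc B)
          then (0, k - 1, s * F + nxt (s mod F div Suc B) (s mod F mod Suc B) * Suc B)
        else (0, k, Suc s))
     else if r = 1 then (2, Suc k, s div F)
     else (0, k, if s mod F mod Suc B < B then Suc s else s))"

text \<open>Each of the \<open>B\<close> moves costs the evaluation of a child and at most two
  further steps, to push its frame and to advance to the next move; one last step pops the
  frame.\<close>

fun dfs_cost :: "nat \<Rightarrow> nat \<Rightarrow> nat" where
  "dfs_cost B 0 = 1"
| "dfs_cost B (Suc k) = B * (dfs_cost B k + 2) + 1"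

lemma dfs_cost_le: "dfs_cost B k + 2 \<le> (B + 3) ^ Suc k"
proof (induction k)
  case (Suc k)
  have "dfs_cost B (Suc k) + 2 \<le> (B + 3) * (dfs_cost B k + 2)" by (simp add: algebra_simps)
  also have "\<dots> \<le> (B + 3) * (B + 3) ^ Suc k" by (rule mult_le_mono2[OF Suc])
  finally show ?case by simp
qed simp

text \<open>When the top frame has level \<open>k\<close>, the stack holds \<open>Suc D - k\<close>
  frames, each a digit in base \<open>F\<close>. This bounds the size of all configurations.\<close>

definition dfs_inv :: "nat \<Rightarrow> nat \<Rightarrow> nat \<times> nat \<times> nat \<Rightarrow> bool" where
  "dfs_inv F D = (\<lambda>(r, k, s). r < 3 \<and> k \<le> Suc D \<and> s < F ^ (Suc D - k))"

context
  fixes B X F D :: nat and ok :: "nat \<Rightarrow> nat \<Rightarrow> bool" and nxt :: "nat \<Rightarrow> nat \<Rightarrow> nat"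
  assumes F: "F = X * Suc B" and ok: "\<And>x y. ok x y \<Longrightarrow> nxt x y < X"
begin

abbreviation "G \<equiv> dfs_step B F D ok nxt"
abbreviation "win \<equiv> gwin B ok nxt"

lemma frame_less: "x < X \<Longrightarrow> y \<le> B \<Longrightarrow> x * Suc B + y < F"
proof -
  assume "x < X" "y \<le> B"
  then have "x * Suc B + y < Suc x * Suc B" by simp
  also have "\<dots> \<le> X * Suc B" using \<open>x < X\<close> by (intro mult_le_mono1) simp
  finally show ?thesis unfolding F .
qed

lemma frame_top:
  assumes "x < X" "y \<le> B"
  shows "(s * F + (x * Suc B + y)) mod F mod Suc B = y" "(s * F + (x * Suc B + y)) mod F div Suc B = x"
    "(s * F + (x * Suc B + y)) div F = s"
proof -
  have 1: "x * Suc B + y < F" by (rule frame_less[OF assms])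
  then have 2: "(s * F + (x * Suc B + y)) mod F = x * Suc B + y" by (simp del: mult_Suc_right)
  show "(s * F + (x * Suc B + y)) mod F mod Suc B = y"
    unfolding 2 using assms(2) by (simp only: mod_mult_self3) simp
  show "(s * F + (x * Suc B + y)) mod F div Suc B = x"
    unfolding 2 using assms(2) by (simp only: div_mult_self3) simp
  show "(s * F + (x * Suc B + y)) div F = s"
    using 1 by (simp only: div_mult_self3) simp
qed

text \<open>A frame is followed from move \<open>y\<close> on, by induction on the moves left. A
  child that is lost for the other player makes this frame won; one that is won only advances
  \<open>y\<close>. The induction over levels enters through \<open>IH\<close>.\<close>

lemma dfs_child:
  assumes IH: "\<And>x s. x < X \<Longrightarrow> \<exists>t\<le>dfs_cost B k. (G ^^ t) (0, k, s * F + x * Suc B) =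
      (if win k x then 2 else 1, Suc k, s)"
    and k: "k < D" and x: "x < X" and y: "y \<le> B"
  shows "\<exists>t\<le>(B - y) * (dfs_cost B k + 2) + 1. (G ^^ t) (0, Suc k, s * F + (x * Suc B + y)) =
      (if \<exists>y'<B. y \<le> y' \<and> ok x y' \<and> \<not> win k (nxt x y') then 2 else 1, Suc (Suc k), s)"
  using y
proof (induction "B - y" arbitrary: y)
  case 0
  then have yB: "y = B" by simp
  have "G (0, Suc k, s * F + (x * Suc B + B)) = (1, Suc (Suc k), s)"
    using k frame_top[OF x, of B s] by (simp add: dfs_step_def del: mult_Suc_right)
  then show ?case unfolding yB by (intro exI[of _ 1]) auto
next
  case (Suc d)
  let ?c = "dfs_cost B k"
  define f where "f = s * F + (x * Suc B + y)"
  have y: "y < B" using Suc(2) by simp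
  have sf: "Suc f = s * F + (x * Suc B + Suc y)" by (simp add: f_def)
  have "\<exists>t\<le>(B - Suc y) * (?c + 2) + 1. (G ^^ t) (0, Suc k, Suc f) =
      (if \<exists>y'<B. Suc y \<le> y' \<and> ok x y' \<and> \<not> win k (nxt x y') then 2 else 1, Suc (Suc k), s)"
    unfolding sf by (rule Suc(1)) (use Suc(2) y in simp_all)
  then obtain t where t: "t \<le> (B - Suc y) * (?c + 2) + 1" "(G ^^ t) (0, Suc k, Suc f) =
      (if \<exists>y'<B. Suc y \<le> y' \<and> ok x y' \<and> \<not> win k (nxt x y') then 2 else 1, Suc (Suc k), s)"
    by blast
  have b: "(B - y) * (?c + 2) = (?c + 2) + (B - Suc y) * (?c + 2)"
    using y by (metis Suc_diff_Suc mult_Suc)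
  have top: "f mod F mod Suc B = y" "f mod F div Suc B = x" "f div F = s"
    using frame_top[OF x, of y s] y unfolding f_def by simp_all
  have "\<exists>t\<le>(B - y) * (?c + 2) + 1. (G ^^ t) (0, Suc k, f) =
      (if \<exists>y'<B. y \<le> y' \<and> ok x y' \<and> \<not> win k (nxt x y') then 2 else 1, Suc (Suc k), s)"
  proof (cases "ok x y")
    case False
    have "G (0, Suc k, f) = (0, Suc k, Suc f)"
      using k y False unfolding dfs_step_def by (simp add: top del: mult_Suc_right)
    then have "(G ^^ Suc t) (0, Suc k, f) =
      (if \<exists>y'<B. Suc y \<le> y' \<and> ok x y' \<and> \<not> win k (nxt x y') then 2 else 1, Suc (Suc k), s)"
      using t(2) by (simp add: funpow_swap1)
    moreover have "(\<exists>y'<B. Suc y \<le> y' \<and> ok x y' \<and> \<not> win k (nxt x y')) \<longleftrightarrow>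
      (\<exists>y'<B. y \<le> y' \<and> ok x y' \<and> \<not> win k (nxt x y'))"
      using False by (metis Suc_leD Suc_leI le_neq_implies_less)
    moreover have "Suc t \<le> (B - y) * (?c + 2) + 1" using t(1) b by linarith
    ultimately show ?thesis by (intro exI[of _ "Suc t"]) simp
  next
    case True
    obtain t' where t': "t' \<le> ?c" "(G ^^ t') (0, k, f * F + nxt x y * Suc B) =
      (if win k (nxt x y) then 2 else 1, Suc k, f)"
      using IH[OF ok[OF True], of f] by blast
    have "G (0, Suc k, f) = (0, k, f * F + nxt x y * Suc B)"
      using k y True unfolding dfs_step_def by (simp add: top del: mult_Suc_right)
    then have 1: "(G ^^ Suc t') (0, Suc k, f) = (if win k (nxt x y) then 2 else 1, Suc k, f)"
      using t'(2) by (simp add: funpow_swap1)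
    show ?thesis
    proof (cases "win k (nxt x y)")
      case w: True
      have "G (2, Suc k, f) = (0, Suc k, Suc f)"
        using k y unfolding dfs_step_def by (simp add: top del: mult_Suc_right)
      then have "(G ^^ Suc (Suc t')) (0, Suc k, f) = (0, Suc k, Suc f)" using 1 w by simp
      then have "(G ^^ (t + Suc (Suc t'))) (0, Suc k, f) =
        (if \<exists>y'<B. Suc y \<le> y' \<and> ok x y' \<and> \<not> win k (nxt x y') then 2 else 1, Suc (Suc k), s)"
        using t(2) unfolding funpow_add comp_def by simp
      moreover have "(\<exists>y'<B. Suc y \<le> y' \<and> ok x y' \<and> \<not> win k (nxt x y')) \<longleftrightarrow>
        (\<exists>y'<B. y \<le> y' \<and> ok x y' \<and> \<not> win k (nxt x y'))"
        using w by (metis Suc_leD Suc_leI le_neq_implies_less)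
      moreover have "t + Suc (Suc t') \<le> (B - y) * (?c + 2) + 1" using t(1) t'(1) b by linarith
      ultimately show ?thesis by (intro exI[of _ "t + Suc (Suc t')"]) simp
    next
      case l: False
      have "G (1, Suc k, f) = (2, Suc (Suc k), s)"
        using k unfolding dfs_step_def by (simp add: top del: mult_Suc_right)
      then have "(G ^^ Suc (Suc t')) (0, Suc k, f) = (2, Suc (Suc k), s)" using 1 l by simp
      moreover have "\<exists>y'<B. y \<le> y' \<and> ok x y' \<and> \<not> win k (nxt x y')" using True l y by blast
      moreover have "Suc (Suc t') \<le> (B - y) * (?c + 2) + 1" using t'(1) b by linarith
      ultimately show ?thesis by (intro exI[of _ "Suc (Suc t')"]) simp
    qed
  qed
  then show ?case unfolding f_def .
qed

lemma dfs_correct: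
  assumes "k \<le> D" "x < X"
  shows "\<exists>t\<le>dfs_cost B k. (G ^^ t) (0, k, s * F + x * Suc B) = (if win k x then 2 else 1, Suc k, s)"
  using assms
proof (induction k arbitrary: x s)
  case 0
  have "G (0, 0, s * F + x * Suc B) = (1, 1, s)"
    using frame_top(3)[OF 0(2), of 0 s] unfolding dfs_step_def by (simp del: mult_Suc_right)
  then show ?case by (intro exI[of _ 1]) simp
next
  case (Suc k)
  then have k: "k < D" by simp
  show ?case using dfs_child[OF Suc.IH k Suc.prems(2), of 0 s] k by simp
qed

text \<open>Finished configurations are fixed points, so any number of iterations above the cost
  gives the same result.\<close>

lemma dfs_halt: "(G ^^ t) (r, Suc D, s) = (r, Suc D, s)"
  by (induction t) (simp_all add: dfs_step_def)

lemma dfs_final: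
  assumes "x < X" "dfs_cost B D \<le> T"
  shows "(G ^^ T) (0, D, x * Suc B) = (if win D x then 2 else 1, Suc D, 0)"
proof -
  obtain t where t: "t \<le> dfs_cost B D" "(G ^^ t) (0, D, x * Suc B) = (if win D x then 2 else 1, Suc D, 0)"
    using dfs_correct[OF order.refl assms(1), of 0] by auto
  obtain t' where "T = t' + t" using t(1) assms(2) by (metis le_iff_add add.commute order.trans)
  then show ?thesis using t(2) dfs_halt by (simp add: funpow_add)
qed

lemma dfs_inv_step:
  assumes "dfs_inv F D c"
  shows "dfs_inv F D (G c)"
proof -
  obtain r k s where c: "c = (r, k, s)" by (metis surj_pair)
  have inv: "r < 3" "k \<le> Suc D" "s < F ^ (Suc D - k)" using assms by (auto simp: dfs_inv_def c)
  show ?thesis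
  proof (cases "k = Suc D")
    case True
    then show ?thesis using inv by (simp add: dfs_step_def dfs_inv_def c)
  next
    case False
    then obtain j where j: "Suc D - k = Suc j" "Suc D - Suc k = j" "k \<le> D"
      using inv(2) by (metis Suc_diff_Suc diff_Suc_Suc le_SucE le_imp_less_Suc)
    have Fp: "0 < F" using inv(3) j(1) by (cases F) auto
    then have Xp: "0 < X" using F by (cases X) auto
    have pop: "s div F < F ^ (Suc D - Suc k)"
      using inv(3) unfolding j by (simp add: less_mult_imp_div_less mult.commute)
    \<comment> \<open>An overflow would make \<open>Suc s\<close> a multiple of \<open>F\<close> and
      hence of \<open>Suc B\<close>, so the next move stored in the top frame would already be
      \<open>B\<close>.\<close>
    have inc: "Suc s < F ^ (Suc D - k)" if "s mod F mod Suc B < B"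
    proof -
      have "F dvd F ^ (Suc D - k)" unfolding j by simp
      moreover have "\<not> F dvd Suc s"
      proof
        assume "F dvd Suc s"
        moreover have "Suc B dvd F" by (simp only: F dvd_triv_right)
        ultimately have "Suc s mod Suc B = 0" using dvd_trans dvd_imp_mod_0 by blast
        then have "s mod Suc B = B" unfolding mod_Suc by (simp split: if_splits)
        moreover have "s mod Suc B = s mod F mod Suc B" 
          by (rule mod_mod_cancel[symmetric]) (simp only: F dvd_triv_right)
        ultimately show False using that by linarith
      qed
      ultimately have "Suc s \<noteq> F ^ (Suc D - k)" by metis
      then show ?thesis by (rule Suc_lessI[OF inv(3)])
    qed
    have push: "s * F + nxt x y * Suc B < F ^ (Suc D - (k - 1))" if "ok x y" "k \<noteq> 0" for x y
    proof -
      have "nxt x y * Suc B + 0 < F" by (rule frame_less[OF ok[OF that(1)]]) simp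
      then have "s * F + nxt x y * Suc B < Suc s * F" by simp
      also have "\<dots> \<le> F ^ (Suc D - k) * F" by (rule mult_le_mono1) (use inv(3) in simp)
      also have "\<dots> = F ^ Suc (Suc D - k)" by simp
      also have "Suc (Suc D - k) = Suc D - (k - 1)" using that(2) j(3) by simp
      finally show ?thesis .
    qed
    have "dfs_inv F D (1, Suc k, s div F)" "dfs_inv F D (2, Suc k, s div F)" "dfs_inv F D (0, k, s)"
      using pop inv j(3) by (simp_all add: dfs_inv_def)
    moreover have "dfs_inv F D (0, k, Suc s)" if "s mod F mod Suc B < B"
      using inc[OF that] inv by (simp add: dfs_inv_def)
    moreover have "dfs_inv F D (0, k - 1, s * F + nxt x y * Suc B)" if "ok x y" "k \<noteq> 0" for x y
      using push[OF that] inv by (simp add: dfs_inv_def)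
    ultimately show ?thesis using False
      by (cases "k = 0") (simp_all add: dfs_step_def c del: mult_Suc_right)
  qed
qed

end

definition code3 :: "nat \<Rightarrow> nat \<times> nat \<times> nat \<Rightarrow> nat" where
  "code3 D = (\<lambda>(r, k, s). r + 3 * (k + (D + 2) * s))"

definition decode3 :: "nat \<Rightarrow> nat \<Rightarrow> nat \<times> nat \<times> nat" where
  "decode3 D c = (c mod 3, c div 3 mod (D + 2), c div 3 div (D + 2))"

lemma decode3_code3: "r < 3 \<Longrightarrow> k \<le> Suc D \<Longrightarrow> decode3 D (code3 D (r, k, s)) = (r, k, s)"
proof -
  have radix: "(r + c * a) mod c = r" "(r + c * a) div c = a" if "r < c" for r c a :: nat
    using that by simp_all
  assume "r < 3" "k \<le> Suc D"
  then show ?thesis unfolding decode3_def code3_def prod.case by (subst radix, simp, subst radix, simp)+ (simp only: radix)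
qed

text \<open>The search takes exponentially many rounds \<open>T\<close>, but its stack has at most
  \<open>Suc (d e)\<close> frames of polynomially many digits; this is where
  \<open>poly_small d\<close> matters. The test of \<open>x0\<close> against \<open>X\<close> is
  part of the predicate because larger positions do not fit into a frame.\<close>

lemma pspp_gwin:
  assumes "psp B" "psp X" "psp d" "poly_small d" "psp x0"
    "pspp (\<lambda>e. ok (e 0) (e 1) (\<lambda>i. e (Suc (Suc i))))"
    "psp (\<lambda>e. nxt (e 0) (e 1) (\<lambda>i. e (Suc (Suc i))))"
    and ok: "\<And>e x y. ok x y e \<Longrightarrow> nxt x y e < X e"
  shows "pspp (\<lambda>e. x0 e < X e \<and> gwin (B e) (\<lambda>x y. ok x y e) (\<lambda>x y. nxt x y e) (d e) (x0 e))"
proof -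
  define F where "F = (\<lambda>e. X e * Suc (B e))"
  define T where "T = (\<lambda>e. (B e + 3) ^ Suc (d e))"
  define g where "g = (\<lambda>c e. dfs_step (B e) (F e) (d e) (\<lambda>x y. ok x y e) (\<lambda>x y. nxt x y e) c)"
  \<comment> \<open>The invariant has to hold in every environment; a start position out of range is
    replaced by a finished configuration.\<close>
  define init :: "env \<Rightarrow> nat \<times> nat \<times> nat" where "init = (\<lambda>e. if x0 e < X e then (0, d e, x0 e * Suc (B e)) else (1, Suc (d e), 0))"
  define h where "h = (\<lambda>a e. code3 (d e) (g (decode3 (d e) a) e))"
  have F: "psp F" unfolding F_def by (intro psp_basic assms)
  have sd: "poly_small (\<lambda>e. Suc (d e))" using poly_small_plus[OF poly_small_const[of 1] assms(4)] by simp
  have T: "psp T" unfolding T_def by (intro psp_power psp_basic assms sd)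
  have inv: "dfs_inv (F e) (d e) ((g_e ^^ k) (init e))" if "g_e = (\<lambda>c. g c e)" for e k g_e
  proof (induction k)
    case 0
    have "x0 e * Suc (B e) + 0 < F e" if "x0 e < X e"
      by (rule frame_less[OF _ _ that]) (use F_def ok in auto)
    then show ?case by (auto simp: init_def dfs_inv_def)
  next
    case (Suc k)
    then show ?case unfolding that g_def by (auto intro!: dfs_inv_step[OF _ ok] simp: F_def)
  qed
  have rec: "rec_nat (code3 (d e) (init e)) (\<lambda>k a. h a e) k = code3 (d e) (((\<lambda>c. g c e) ^^ k) (init e))" for e k
  proof (induction k)
    case (Suc k)
    have "dfs_inv (F e) (d e) (((\<lambda>c. g c e) ^^ k) (init e))" by (rule inv) simp
    then have "decode3 (d e) (code3 (d e) (((\<lambda>c. g c e) ^^ k) (init e))) = ((\<lambda>c. g c e) ^^ k) (init e)"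
      by (cases "((\<lambda>c. g c e) ^^ k) (init e)") (auto simp: dfs_inv_def decode3_code3)
    then show ?case using Suc by (simp add: h_def)
  qed simp
  define b where "b = (\<lambda>e. 3 + 3 * (Suc (d e) + (d e + 2) * Suc (F e) ^ Suc (d e)))"
  have b: "poly_bits b" unfolding b_def
    by (intro poly_bits_plus poly_bits_times poly_bits_const poly_bits_power psp_poly_bits psp_basic assms F sd)
  have bound: "rec_nat (code3 (d e) (init e)) (\<lambda>k a. h a e) k \<le> b e" for e k
  proof -
    obtain r j s where c: "((\<lambda>c. g c e) ^^ k) (init e) = (r, j, s)" by (metis surj_pair)
    have "dfs_inv (F e) (d e) (r, j, s)" using inv[OF refl, of e k] c by simp
    then have i: "r \<le> 3" "j \<le> Suc (d e)" "s < F e ^ (Suc (d e) - j)" by (auto simp: dfs_inv_def)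
    have "F e ^ (Suc (d e) - j) \<le> Suc (F e) ^ (Suc (d e) - j)" by (rule power_mono) auto
    also have "\<dots> \<le> Suc (F e) ^ Suc (d e)" by (rule power_increasing) auto
    finally have s: "s \<le> Suc (F e) ^ Suc (d e)" using i(3) by linarith
    have "r + 3 * (j + (d e + 2) * s) \<le> b e" unfolding b_def
      by (intro add_mono mult_le_mono order.refl i(1,2) s)
    then show ?thesis unfolding rec c by (simp add: code3_def)
  qed
  have "psp (\<lambda>e. rec_nat (code3 (d e) (init e)) (\<lambda>k a. h a e) (T e))"
  proof (rule psp_rec[OF T _ _ b bound])
    have eq: "code3 (d e) (init e) = (if x0 e < X e then 0 + 3 * (d e + (d e + 2) * (x0 e * Suc (B e)))
        else 1 + 3 * (Suc (d e) + (d e + 2) * 0))" for e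
      by (simp add: init_def code3_def)
    show "psp (\<lambda>e. code3 (d e) (init e))" unfolding eq by (intro psp_basic assms)
  next
    let ?t = "\<lambda>e :: env. \<lambda>i. e (Suc (Suc i))"
    define r k s where "r = (\<lambda>e :: env. e 0 mod 3)" and "k = (\<lambda>e :: env. e 0 div 3 mod (d (?t e) + 2))"
      and "s = (\<lambda>e :: env. e 0 div 3 div (d (?t e) + 2))"
    have sh: "psp (\<lambda>e. d (?t e))" "psp (\<lambda>e. B (?t e))" "psp (\<lambda>e. F (?t e))"
      by (rule psp_ren[OF assms(3)] psp_ren[OF assms(1)] psp_ren[OF F])+
    have rks: "psp r" "psp k" "psp s" unfolding r_def k_def s_def
      by (intro psp_basic psp_div psp_mod sh)+
    define x y where "x = (\<lambda>e. s e mod F (?t e) div Suc (B (?t e)))" and "y = (\<lambda>e. s e mod F (?t e) mod Suc (B (?t e)))"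
    have xy: "psp x" "psp y" unfolding x_def y_def by (intro psp_basic psp_div psp_mod sh rks)+
    \<comment> \<open>The renaming skips the accumulator and the round number, which the recursion
      has put in front of the original variables.\<close>
    have okp: "pspp (\<lambda>e. ok (x e) (y e) (?t e))"
      using pspp_let2[OF xy, of "\<lambda>a b e. ok a b (?t e)"]
        pspp_ren[OF assms(6), of "\<lambda>i. if i < 2 then i else Suc (Suc i)"] by simp
    have nxtp: "psp (\<lambda>e. nxt (x e) (y e) (?t e))"
      using psp_let2[OF xy, of "\<lambda>a b e. nxt a b (?t e)"]
        psp_ren[OF assms(7), of "\<lambda>i. if i < 2 then i else Suc (Suc i)"] by simp
    let ?c = "\<lambda>e r k s. code3 (d (?t e)) (r, k, s)"
    have eq: "h (e 0) (?t e) = (if k e = Suc (d (?t e)) then ?c e (r e) (k e) (s e)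
     else if r e = 0 then
       (if k e = 0 \<or> \<not> y e < B (?t e) then ?c e 1 (Suc (k e)) (s e div F (?t e))
        else if ok (x e) (y e) (?t e)
          then ?c e 0 (k e - 1) (s e * F (?t e) + nxt (x e) (y e) (?t e) * Suc (B (?t e)))
        else ?c e 0 (k e) (Suc (s e)))
     else if r e = 1 then ?c e 2 (Suc (k e)) (s e div F (?t e))
     else ?c e 0 (k e) (if y e < B (?t e) then Suc (s e) else s e))" for e
      by (simp only: h_def g_def dfs_step_def decode3_def prod.case r_def k_def s_def x_def y_def
          if_distrib[of "code3 (d (?t e))"])
    show "psp (\<lambda>e. h (e 0) (?t e))" unfolding eq code3_def prod.case
      by (intro psp_basic psp_div sh rks xy okp nxtp)
  qed
  then have "pspp (\<lambda>e. x0 e < X e \<and> rec_nat (code3 (d e) (init e)) (\<lambda>k a. h a e) (T e) mod 3 = 2)"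
    by (intro psp_basic psp_mod assms)
  moreover have "rec_nat (code3 (d e) (init e)) (\<lambda>k a. h a e) (T e) mod 3 = 2 \<longleftrightarrow>
      gwin (B e) (\<lambda>x y. ok x y e) (\<lambda>x y. nxt x y e) (d e) (x0 e)" if "x0 e < X e" for e
  proof -
    have Fe: "F e = X e * Suc (B e)" by (simp add: F_def)
    have cost: "dfs_cost (B e) (d e) \<le> T e" using dfs_cost_le[of "B e" "d e"] unfolding T_def by linarith
    have ok': "\<And>x y. ok x y e \<Longrightarrow> nxt x y e < X e" using ok .
    have "((\<lambda>c. g c e) ^^ T e) (init e) =
      (if gwin (B e) (\<lambda>x y. ok x y e) (\<lambda>x y. nxt x y e) (d e) (x0 e) then 2 else 1, Suc (d e), 0)"
      using dfs_final[OF Fe ok' that cost] that unfolding g_def init_def by simp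
    then show ?thesis unfolding rec by (simp add: code3_def)
  qed
  ultimately show ?thesis by (simp cong: conj_cong)
qed

section \<open>The decision procedure as an arithmetic predicate\<close>

text \<open>A word of length \<open>n\<close> is represented by a number \<open>N\<close> whose octal digits, least significant
  first, are the codes of its letters, together with \<open>P = 2 ^ n\<close>. Subformulas are addressed by the
  positions at which they start; valuations of subformulas are numbers below \<open>P\<close>, binary relations
  between positions are numbers below \<open>P ^ Suc n\<close>.\<close>

definition len :: "nat \<Rightarrow> nat" where "len P = bitlen P - 1"

definition lt :: "nat \<Rightarrow> nat \<Rightarrow> nat" where "lt N i = N div 8 ^ i mod 8"

text \<open>A relation stored as a bit matrix, row by row. Rows have width
  \<open>Suc (len P)\<close> because a subformula may end at the end of the word. The span table
  \<open>T\<close> and the equivalence table \<open>E\<close> share this format.\<close>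

definition sp :: "nat \<Rightarrow> nat \<Rightarrow> nat \<Rightarrow> nat \<Rightarrow> bool" where
  "sp P T i j \<longleftrightarrow> i < len P \<and> j \<le> len P \<and> bit T (i * Suc (len P) + j)"

text \<open>A maximal block of digits (letter codes 6 and 7) from \<open>a\<close> to
  \<open>j\<close>, most significant first, hence the index \<open>j - 1 - t\<close>. The
  disjunction excludes leading zeros except for the numeral of 0.\<close>

definition bin_at :: "nat \<Rightarrow> nat \<Rightarrow> nat \<Rightarrow> nat \<Rightarrow> nat \<Rightarrow> bool" where
  "bin_at N P a j v \<longleftrightarrow> a < j \<and> (\<forall>t<j. a \<le> t \<longrightarrow> 6 \<le> lt N t) \<and> \<not> 6 \<le> lt N j \<and>
     (lt N a = 7 \<or> j = Suc a) \<and> (\<forall>t<len P. bit v t \<longleftrightarrow> a + t < j \<and> lt N (j - 1 - t) = 7)"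

text \<open>The grammar of Polish notation as a condition on a guessed table: a formula starts at
  \<open>i\<close> and ends just before \<open>j\<close>. \<open>K = 0\<close> encodes that every
  number names a variable; otherwise the variables are the numbers below \<open>K\<close>.\<close>

definition span_table :: "nat \<Rightarrow> nat \<Rightarrow> nat \<Rightarrow> nat \<Rightarrow> bool" where
  "span_table K N P T \<longleftrightarrow> (\<forall>i<len P. \<forall>j\<le>len P. sp P T i j \<longleftrightarrow>
     lt N i = 1 \<and> j = Suc i \<and> \<not> 6 \<le> lt N j \<or>
     lt N i = 2 \<and> (\<exists>v<P. (K = 0 \<or> v < K) \<and> bin_at N P (Suc i) j v) \<or>
     lt N i = 3 \<and> sp P T (Suc i) j \<or>
     (lt N i = 4 \<or> lt N i = 5) \<and> (\<exists>m\<le>len P. sp P T (Suc i) m \<and> sp P T m j))"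

definition is_node :: "nat \<Rightarrow> nat \<Rightarrow> nat \<Rightarrow> bool" where
  "is_node P T i \<longleftrightarrow> (\<exists>j\<le>len P. sp P T i j)"

definition bot_at :: "nat \<Rightarrow> nat \<Rightarrow> nat \<Rightarrow> nat \<Rightarrow> bool" where
  "bot_at N P T i \<longleftrightarrow> lt N i = 1 \<and> is_node P T i"

definition neg_at :: "nat \<Rightarrow> nat \<Rightarrow> nat \<Rightarrow> nat \<Rightarrow> nat \<Rightarrow> bool" where
  "neg_at N P T i j \<longleftrightarrow> i < len P \<and> lt N i = 3 \<and> j = Suc i \<and> is_node P T j"

definition conj_at :: "nat \<Rightarrow> nat \<Rightarrow> nat \<Rightarrow> nat \<Rightarrow> nat \<Rightarrow> nat \<Rightarrow> bool" where
  "conj_at N P T i j k \<longleftrightarrow> i < len P \<and> lt N i = 4 \<and> j = Suc i \<and> sp P T j k \<and> is_node P T k"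

definition cond_at :: "nat \<Rightarrow> nat \<Rightarrow> nat \<Rightarrow> nat \<Rightarrow> nat \<Rightarrow> nat \<Rightarrow> bool" where
  "cond_at N P T i j k \<longleftrightarrow> i < len P \<and> lt N i = 5 \<and> j = Suc i \<and> sp P T j k \<and> is_node P T k"

definition same_at :: "nat \<Rightarrow> nat \<Rightarrow> nat \<Rightarrow> nat \<Rightarrow> nat \<Rightarrow> bool" where
  "same_at N P T i j \<longleftrightarrow> (\<exists>l\<le>len P. sp P T i (i + l) \<and> sp P T j (j + l) \<and> (\<forall>t<l. lt N (i + t) = lt N (j + t)))"

definition size_le :: "nat \<Rightarrow> nat \<Rightarrow> nat \<Rightarrow> nat \<Rightarrow> bool" where
  "size_le P T l i \<longleftrightarrow> (\<exists>j\<le>len P. sp P T i j \<and> j \<le> i + l)"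

definition coh_num :: "nat \<Rightarrow> nat \<Rightarrow> nat \<Rightarrow> nat \<Rightarrow> bool" where
  "coh_num N P T V \<longleftrightarrow>
     (\<forall>i<len P. bot_at N P T i \<longrightarrow> \<not> bit V i) \<and>
     (\<forall>i<len P. \<forall>j<len P. neg_at N P T i j \<longrightarrow> (bit V i \<longleftrightarrow> \<not> bit V j)) \<and>
     (\<forall>i<len P. \<forall>j<len P. \<forall>k<len P. conj_at N P T i j k \<longrightarrow> (bit V i \<longleftrightarrow> bit V j \<and> bit V k)) \<and>
     (\<forall>i<len P. \<forall>j<len P. \<forall>k<len P. cond_at N P T i j k \<and> bit V j \<longrightarrow> (bit V i \<longleftrightarrow> bit V k)) \<and>
     (\<forall>i<len P. \<forall>j<len P. same_at N P T i j \<longrightarrow> (bit V i \<longleftrightarrow> bit V j))"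

text \<open>A position of the game is a triple \<open>(V, j, l)\<close>, coded as a number. If \<open>j = 0\<close>, the opponent of
  the coherent valuation \<open>V\<close> picks a conditional that needs a successor world; otherwise \<open>j\<close> is the
  antecedent of that conditional, and a valuation for the successor world has to be chosen.\<close>

definition pos :: "nat \<Rightarrow> nat \<Rightarrow> nat \<Rightarrow> nat \<Rightarrow> nat" where
  "pos P V j l = V + P * (j + Suc (len P) * l)"

definition pos_val where "pos_val P x = x mod P"
definition pos_ant where "pos_ant P x = x div P mod Suc (len P)"
definition pos_lev where "pos_lev P x = x div P div Suc (len P)"
definition pos_bound where "pos_bound P = P * (Suc (len P) * Suc (len P))"

text \<open>The opponent's move \<open>y\<close> is the position of a conditional, whose antecedent
  follows at \<open>Suc y\<close>; so 0 is never an antecedent and can mark the opponent's turn. In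
  answer, \<open>y\<close> is a valuation, and the level drops by one.\<close>

definition next_pos :: "nat \<Rightarrow> nat \<Rightarrow> nat \<Rightarrow> nat" where
  "next_pos P x y = (if pos_ant P x = 0 then pos P (pos_val P x) (Suc y) (pos_lev P x)
     else pos P y 0 (pos_lev P x - 1))"

text \<open>The first conjunct provides the bound on successor positions that
  \<open>pspp_gwin\<close> asks for; \<open>pos_less\<close> shows that the intended moves satisfy
  it.\<close>

definition move_ok :: "bool \<Rightarrow> nat \<Rightarrow> nat \<Rightarrow> nat \<Rightarrow> nat \<Rightarrow> nat \<Rightarrow> nat \<Rightarrow> bool" where
  "move_ok idf N P T E x y \<longleftrightarrow> next_pos P x y < pos_bound P \<and>
     (if pos_ant P x = 0 then
        0 < pos_lev P x \<and> (\<exists>k<len P. cond_at N P T y (Suc y) k) \<and> size_le P T (pos_lev P x) y \<and>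
        \<not> bit (pos_val P x) y \<and> \<not> bit (pos_val P x) (Suc y)
      else coh_num N P T y \<and> (idf \<longrightarrow> bit y (pos_ant P x)) \<and>
        (\<forall>i<len P. \<forall>j<len P. \<forall>k<len P. cond_at N P T i j k \<and> size_le P T (pos_lev P x) i \<and>
           sp P E j (pos_ant P x) \<longrightarrow> (bit y k \<longleftrightarrow> bit (pos_val P x) i)))"

text \<open>The opponent moves first, hence the negation. A level costs two moves, hence the budget
  \<open>len P + len P\<close>. Valuations and positions are both numbers below \<open>P\<close>, so
  \<open>P\<close> bounds the moves of either side.\<close>

definition win_num :: "bool \<Rightarrow> nat \<Rightarrow> nat \<Rightarrow> nat \<Rightarrow> nat \<Rightarrow> nat \<Rightarrow> nat \<Rightarrow> bool" where
  "win_num idf N P T E V l \<longleftrightarrow> \<not> (pos P V 0 l < pos_bound P \<and>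
     gwin P (\<lambda>x y. move_ok idf N P T E x y) (\<lambda>x y. next_pos P x y) (len P + len P) (pos P V 0 l))"

definition equiv_table :: "bool \<Rightarrow> nat \<Rightarrow> nat \<Rightarrow> nat \<Rightarrow> nat \<Rightarrow> bool" where
  "equiv_table idf N P T E \<longleftrightarrow> (\<forall>l\<le>len P. \<forall>i<len P. \<forall>j<len P. size_le P T l i \<and> size_le P T l j \<longrightarrow>
     (sp P E i j \<longleftrightarrow> \<not> (\<exists>V<P. coh_num N P T V \<and> (bit V i \<longleftrightarrow> \<not> bit V j) \<and> win_num idf N P T E V l)))"

text \<open>Both tables are searched for exhaustively among numbers of polynomially many digits.
  Their conditions determine them wherever they are consulted, so any tables found give the same
  answer.\<close>

definition decision :: "bool \<Rightarrow> nat \<Rightarrow> nat \<Rightarrow> nat \<Rightarrow> bool" where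
  "decision idf K N P \<longleftrightarrow> (\<exists>T<P ^ Suc (len P). span_table K N P T \<and> sp P T 0 (len P) \<and>
     (\<exists>E<P ^ Suc (len P). equiv_table idf N P T E \<and>
        \<not> (\<exists>V<P. coh_num N P T V \<and> \<not> bit V 0 \<and> win_num idf N P T E V (len P))))"

section \<open>The predicate is computable in polynomial space\<close>

lemma psp_len: "psp f \<Longrightarrow> psp (\<lambda>e. len (f e))"
  unfolding len_def by (intro psp_basic psp_bitlen)

lemma poly_small_len: "psp f \<Longrightarrow> poly_small (\<lambda>e. len (f e))"
proof -
  assume "psp f"
  then obtain q :: "nat poly" where "\<And>e m. \<forall>i. e i < 2 ^ m \<Longrightarrow> bitlen (f e) \<le> poly q m"
    using poly_small_bitlen unfolding poly_small_def by blast
  then show ?thesis unfolding poly_small_def len_def by (meson diff_le_self order.trans)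
qed

lemma psp_lt: "psp f \<Longrightarrow> psp g \<Longrightarrow> psp (\<lambda>e. lt (f e) (g e))"
  unfolding lt_def by (intro psp_mod psp_div_power psp_basic)

lemma pspp_sp: "psp a \<Longrightarrow> psp b \<Longrightarrow> psp c \<Longrightarrow> psp d \<Longrightarrow> pspp (\<lambda>e. sp (a e) (b e) (c e) (d e))"
  unfolding sp_def by (intro psp_basic psp_len pspp_bit)

lemmas psp_more = psp_basic psp_len psp_lt pspp_sp pspp_bit

text \<open>Bounded quantifiers shift the environment, and arguments would have to be shifted along.
  So the claim is proved for plain variables and transferred by \<open>pspp_subst\<close>, here and
  for the predicates below.\<close>

lemma pspp_bin_at:
  assumes "psp a" "psp b" "psp c" "psp d" "psp f"
  shows "pspp (\<lambda>e. bin_at (a e) (b e) (c e) (d e) (f e))"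
proof -
  have "pspp (\<lambda>e. bin_at (e 0) (e 1) (e 2) (e 3) (e 4))"
    unfolding bin_at_def by (intro psp_more)
  from pspp_subst[OF this, of "[a, b, c, d, f]"] show ?thesis using assms by simp
qed

lemma pspp_is_node:
  assumes "psp a" "psp b" "psp c"
  shows "pspp (\<lambda>e. is_node (a e) (b e) (c e))"
proof -
  have "pspp (\<lambda>e. is_node (e 0) (e 1) (e 2))"
    unfolding is_node_def by (intro psp_more)
  from pspp_subst[OF this, of "[a, b, c]"] show ?thesis using assms by simp
qed

lemma pspp_span_table:
  assumes "psp a" "psp b" "psp c"
  shows "pspp (\<lambda>e. span_table K (a e) (b e) (c e))"
proof -
  have "pspp (\<lambda>e. span_table K (e 0) (e 1) (e 2))"
    unfolding span_table_def by (intro psp_more pspp_bin_at)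
  from pspp_subst[OF this, of "[a, b, c]"] show ?thesis using assms by simp
qed

lemma pspp_bot_at: "psp a \<Longrightarrow> psp b \<Longrightarrow> psp c \<Longrightarrow> psp d \<Longrightarrow> pspp (\<lambda>e. bot_at (a e) (b e) (c e) (d e))"
  unfolding bot_at_def by (intro psp_more pspp_is_node)

lemma pspp_neg_at: "psp a \<Longrightarrow> psp b \<Longrightarrow> psp c \<Longrightarrow> psp d \<Longrightarrow> psp f \<Longrightarrow>
    pspp (\<lambda>e. neg_at (a e) (b e) (c e) (d e) (f e))"
  unfolding neg_at_def by (intro psp_more pspp_is_node)

lemma pspp_conj_at: "psp a \<Longrightarrow> psp b \<Longrightarrow> psp c \<Longrightarrow> psp d \<Longrightarrow> psp f \<Longrightarrow> psp g \<Longrightarrow>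
    pspp (\<lambda>e. conj_at (a e) (b e) (c e) (d e) (f e) (g e))"
  unfolding conj_at_def by (intro psp_more pspp_is_node)

lemma pspp_cond_at: "psp a \<Longrightarrow> psp b \<Longrightarrow> psp c \<Longrightarrow> psp d \<Longrightarrow> psp f \<Longrightarrow> psp g \<Longrightarrow>
    pspp (\<lambda>e. cond_at (a e) (b e) (c e) (d e) (f e) (g e))"
  unfolding cond_at_def by (intro psp_more pspp_is_node)

lemma pspp_same_at:
  assumes "psp a" "psp b" "psp c" "psp d" "psp f"
  shows "pspp (\<lambda>e. same_at (a e) (b e) (c e) (d e) (f e))"
proof -
  have "pspp (\<lambda>e. same_at (e 0) (e 1) (e 2) (e 3) (e 4))"
    unfolding same_at_def by (intro psp_more)
  from pspp_subst[OF this, of "[a, b, c, d, f]"] show ?thesis using assms by simp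
qed

lemma pspp_size_le:
  assumes "psp a" "psp b" "psp c" "psp d"
  shows "pspp (\<lambda>e. size_le (a e) (b e) (c e) (d e))"
proof -
  have "pspp (\<lambda>e. size_le (e 0) (e 1) (e 2) (e 3))"
    unfolding size_le_def by (intro psp_more)
  from pspp_subst[OF this, of "[a, b, c, d]"] show ?thesis using assms by simp
qed

lemmas psp_at = pspp_bot_at pspp_neg_at pspp_conj_at pspp_cond_at pspp_same_at pspp_size_le

lemma pspp_coh_num:
  assumes "psp a" "psp b" "psp c" "psp d"
  shows "pspp (\<lambda>e. coh_num (a e) (b e) (c e) (d e))"
proof -
  have "pspp (\<lambda>e. coh_num (e 0) (e 1) (e 2) (e 3))"
    unfolding coh_num_def by (intro psp_more psp_at)
  from pspp_subst[OF this, of "[a, b, c, d]"] show ?thesis using assms by simp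
qed

lemma psp_pos: "psp a \<Longrightarrow> psp b \<Longrightarrow> psp c \<Longrightarrow> psp d \<Longrightarrow> psp (\<lambda>e. pos (a e) (b e) (c e) (d e))"
  unfolding pos_def by (intro psp_more)

lemma psp_pos_proj:
  "psp a \<Longrightarrow> psp b \<Longrightarrow> psp (\<lambda>e. pos_val (a e) (b e))"
  "psp a \<Longrightarrow> psp b \<Longrightarrow> psp (\<lambda>e. pos_ant (a e) (b e))"
  "psp a \<Longrightarrow> psp b \<Longrightarrow> psp (\<lambda>e. pos_lev (a e) (b e))"
  "psp a \<Longrightarrow> psp (\<lambda>e. pos_bound (a e))"
  unfolding pos_val_def pos_ant_def pos_lev_def pos_bound_def by ((intro psp_more psp_mod psp_div | assumption)+)

lemma psp_next_pos: "psp a \<Longrightarrow> psp b \<Longrightarrow> psp c \<Longrightarrow> psp (\<lambda>e. next_pos (a e) (b e) (c e))"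
  unfolding next_pos_def by (intro psp_more psp_pos psp_pos_proj)

lemma pspp_if: 
  assumes "pspp P" "pspp Q" "pspp R"
  shows "pspp (\<lambda>e. if P e then Q e else R e)"
proof -
  have "pspp (\<lambda>e. (P e \<longrightarrow> Q e) \<and> (\<not> P e \<longrightarrow> R e))" by (intro psp_more assms)
  then show ?thesis by (simp only: if_bool_eq_conj)
qed

lemma pspp_move_ok:
  assumes "psp a" "psp b" "psp c" "psp d" "psp f" "psp g"
  shows "pspp (\<lambda>e. move_ok idf (a e) (b e) (c e) (d e) (f e) (g e))"
proof -
  have "pspp (\<lambda>e. move_ok idf (e 0) (e 1) (e 2) (e 3) (e 4) (e 5))"
    unfolding move_ok_def by (intro pspp_if psp_more psp_at psp_pos_proj psp_next_pos pspp_coh_num)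
  from pspp_subst[OF this, of "[a, b, c, d, f, g]"] show ?thesis using assms by simp
qed

lemma pspp_win_num:
  assumes "psp a" "psp b" "psp c" "psp d" "psp f" "psp g"
  shows "pspp (\<lambda>e. win_num idf (a e) (b e) (c e) (d e) (f e) (g e))"
proof -
  have "pspp (\<lambda>e. win_num idf (e 0) (e 1) (e 2) (e 3) (e 4) (e 5))"
    unfolding win_num_def
  proof (rule pspp_not, rule pspp_gwin)
    show "poly_small (\<lambda>e. len (e 1) + len (e 1))"
      by (intro poly_small_plus poly_small_len psp_var)
    show "\<And>e x y. move_ok idf (e 0) (e 1) (e 2) (e 3) x y \<Longrightarrow> next_pos (e 1) x y < pos_bound (e 1)"
      by (simp add: move_ok_def)
  qed (intro psp_more psp_pos psp_pos_proj psp_next_pos pspp_move_ok)+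
  from pspp_subst[OF this, of "[a, b, c, d, f, g]"] show ?thesis using assms by simp
qed

lemma pspp_equiv_table:
  assumes "psp a" "psp b" "psp c" "psp d"
  shows "pspp (\<lambda>e. equiv_table idf (a e) (b e) (c e) (d e))"
proof -
  have "pspp (\<lambda>e. equiv_table idf (e 0) (e 1) (e 2) (e 3))"
    unfolding equiv_table_def by (intro psp_more psp_at pspp_coh_num pspp_win_num)
  from pspp_subst[OF this, of "[a, b, c, d]"] show ?thesis using assms by simp
qed

lemma psp_table_bound: "psp f \<Longrightarrow> psp (\<lambda>e. f e ^ Suc (len (f e)))"
proof -
  assume f: "psp f"
  have "poly_small (\<lambda>e. Suc (len (f e)))"
    using poly_small_plus[OF poly_small_const[of 1] poly_small_len[OF f]] by simp
  then show ?thesis by (intro psp_power psp_more f)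
qed

lemma pspp_decision: "pspp (\<lambda>e. decision idf K (e 0) (e 1))"
  unfolding decision_def
  by (intro psp_table_bound psp_more pspp_span_table pspp_equiv_table pspp_coh_num pspp_win_num)

section \<open>Words as numbers\<close>

text \<open>Code 0 stays free and signals positions beyond the end of the word; the two digits come
  last, so a single comparison recognises them.\<close>

fun code :: "letter \<Rightarrow> nat" where
  "code TBot = 1" | "code TVar = 2" | "code TNeg = 3" | "code TConj = 4" | "code TCond = 5"
| "code Zero = 6" | "code One = 7"

fun wcode :: "letter list \<Rightarrow> nat" where
  "wcode [] = 0"
| "wcode (l # w) = code l + 8 * wcode w"

lemma code_less: "code l < 8" by (cases l) auto

lemma code_inj: "code l = code l' \<longleftrightarrow> l = l'" by (cases l; cases l') auto

lemma code_digit: "6 \<le> code l \<longleftrightarrow> l \<in> {Zero, One}" by (cases l) auto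

lemma lt_wcode: "lt (wcode w) i = (if i < length w then code (w ! i) else 0)"
proof (induction w arbitrary: i)
  case (Cons l w)
  have d: "(code l + 8 * wcode w) div 8 = wcode w" "(code l + 8 * wcode w) mod 8 = code l"
    using code_less[of l] by simp_all
  show ?case
  proof (cases i)
    case (Suc j)
    have "lt (wcode (l # w)) i = lt (wcode w) j"
      by (simp only: lt_def wcode.simps Suc power_Suc div_mult2_eq d)
    then show ?thesis using Cons Suc by simp
  qed (simp only: lt_def wcode.simps power_0 div_by_1 d, simp)
qed (simp add: lt_def)

lemma wcode_less: "wcode w < 8 ^ length w"
proof (induction w)
  case (Cons l w)
  then show ?case using code_less[of l] by simp
qed simp

text \<open>The machine reads the word from the left, so a new letter becomes the most significant
  octal digit. Its weight is the cube of the power of 2 that is maintained alongside.\<close>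

lemma wcode_snoc: "wcode (w @ [l]) = wcode w + code l * 8 ^ length w"
  by (induction w) auto

lemma ex_bits:
  fixes Q :: "nat \<Rightarrow> bool"
  shows "\<exists>v::nat. v < 2 ^ m \<and> (\<forall>i<m. bit v i \<longleftrightarrow> Q i)"
proof (induction m)
  case (Suc m)
  then obtain v :: nat where v: "v < 2 ^ m" "\<forall>i<m. bit v i \<longleftrightarrow> Q i" by blast
  let ?v = "v + of_bool (Q m) * 2 ^ m"
  have "bit ?v i \<longleftrightarrow> Q i" if "i < Suc m" for i
  proof (cases "i = m")
    case True
    have "?v div 2 ^ m = of_bool (Q m)" using v(1) by simp
    then show ?thesis unfolding True bit_iff_odd by simp
  next
    case False
    then have "i < m" using that by simp
    then obtain d where d: "m = i + Suc d" using less_iff_Suc_add by auto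
    have "?v = v + (of_bool (Q m) * 2 * 2 ^ d) * 2 ^ i"
      unfolding d by (simp add: power_add)
    then have "?v div 2 ^ i = of_bool (Q m) * 2 * 2 ^ d + v div 2 ^ i"
      by (simp only: div_mult_self1 power_not_zero zero_neq_numeral[symmetric] not_False_eq_True)
    then have "odd (?v div 2 ^ i) \<longleftrightarrow> odd (v div 2 ^ i)" by simp
    then show ?thesis using v(2) \<open>i < m\<close> unfolding bit_iff_odd by blast
  qed
  moreover have "?v < 2 ^ Suc m" using v(1) by simp
  ultimately show ?case by blast
qed simp

lemma bit_less: "v < 2 ^ m \<Longrightarrow> bit v t \<Longrightarrow> t < m" for v :: nat
proof (rule ccontr)
  assume v: "v < 2 ^ m" "bit v t" "\<not> t < m"
  then have "(2::nat) ^ m \<le> 2 ^ t" by simp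
  then have "v < 2 ^ t" using v(1) by linarith
  then have "v div 2 ^ t = 0" by simp
  then show False using v(2) by (simp add: bit_iff_odd)
qed

section \<open>Binary numerals and their bits\<close>

lemma binary_props:
  "binary v \<noteq> [] \<and> (hd (binary v) = One \<or> length (binary v) = 1) \<and> (0 < v \<longrightarrow> hd (binary v) = One) \<and>
   v < 2 ^ length (binary v) \<and>
   (\<forall>t. bit v t \<longleftrightarrow> t < length (binary v) \<and> binary v ! (length (binary v) - 1 - t) = One)"
proof (induction v rule: binary.induct)
  case (1 v)
  show ?case
  proof (cases "v < 2")
    case True
    then have b: "binary v = [digit v]" by (subst binary.simps) simp
    from True have "v = 0 \<or> v = 1" by auto
    then show ?thesis unfolding b by (auto simp: digit_def bit_1_iff bit_Suc_0_iff)
  next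
    case False
    then have b: "binary v = binary (v div 2) @ [digit (v mod 2)]" by (subst binary.simps) simp
    let ?b = "binary (v div 2)"
    have IH: "?b \<noteq> []" "hd ?b = One" "v div 2 < 2 ^ length ?b"
      "\<And>t. bit (v div 2) t \<longleftrightarrow> t < length ?b \<and> ?b ! (length ?b - 1 - t) = One"
      using 1[OF False] False by auto
    have "bit v t \<longleftrightarrow> t < length (binary v) \<and> binary v ! (length (binary v) - 1 - t) = One" for t
    proof (cases t)
      case 0
      then show ?thesis unfolding b by (auto simp: bit_0 digit_def nth_append odd_iff_mod_2_eq_one)
    next
      case (Suc t')
      have "bit v t \<longleftrightarrow> bit (v div 2) t'" unfolding Suc by (simp add: bit_Suc)
      then show ?thesis unfolding b IH(4) Suc by (auto simp: nth_append)
    qed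
    moreover have "v < 2 ^ length (binary v)" unfolding b using IH(3) by simp
    ultimately show ?thesis unfolding b using IH(1,2) by simp
  qed
qed

text \<open>Without leading zeros the digits are determined by the bits. The induction removes the
  last digit, as the recursion of \<open>binary\<close> does.\<close>

lemma binary_unique:
  assumes "ds \<noteq> []" "set ds \<subseteq> {Zero, One}" "hd ds = One \<or> length ds = 1"
    "\<And>t. bit v t \<longleftrightarrow> t < length ds \<and> ds ! (length ds - 1 - t) = One"
  shows "ds = binary v"
  using assms
proof (induction ds arbitrary: v rule: rev_induct)
  case (snoc d ds)
  have d: "d = digit (v mod 2)"
  proof -
    have "bit v 0 \<longleftrightarrow> d = One" using snoc.prems(4)[of 0] by simp
    then show ?thesis using snoc.prems(2) by (auto simp: digit_def bit_0 odd_iff_mod_2_eq_one)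
  qed
  show ?case
  proof (cases "ds = []")
    case True
    have "bit v t \<longleftrightarrow> bit (of_bool (d = One) :: nat) t" for t
      using snoc.prems(4)[of t] True by (auto simp: bit_simps)
    then have "v = of_bool (d = One)" by (rule bit_eqI)
    then have "v < 2" by simp
    then have "binary v = [digit v]" by (subst binary.simps) simp
    moreover have "v mod 2 = v" using \<open>v < 2\<close> by simp
    ultimately show ?thesis using True d by simp
  next
    case False
    have hd: "hd ds = One" using snoc.prems(3) False by auto
    have "ds = binary (v div 2)"
    proof (rule snoc.IH[OF False])
      fix t show "bit (v div 2) t \<longleftrightarrow> t < length ds \<and> ds ! (length ds - 1 - t) = One"
        using snoc.prems(4)[of "Suc t"] unfolding bit_Suc by (auto simp: nth_append)
    qed (use snoc.prems(2) hd in auto)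
    moreover have "\<not> v < 2"
    proof
      assume "v < 2"
      then have "v < 2 ^ 1" by simp
      moreover have "bit v (length ds)"
        using snoc.prems(4)[of "length ds"] False hd by (simp add: nth_append hd_conv_nth)
      ultimately have "length ds < 1" using bit_less by blast
      then show False using False by simp
    qed
    ultimately show ?thesis using d by (subst binary.simps) simp
  qed
qed simp

section \<open>Correctness of the decision procedure\<close>

text \<open>A numeral is delimited only by the next letter not being a digit. Encodings never start
  with a digit, so an occurrence followed by another formula is always delimited.\<close>

definition no_digit :: "letter list \<Rightarrow> bool" where
  "no_digit xs \<longleftrightarrow> xs = [] \<or> hd xs \<notin> {Zero, One}"

lemma no_digit_encode: "no_digit (encode num A @ xs)"
  by (cases A) (auto simp: no_digit_def)

lemma digits_unique:
  assumes "ds @ xs = es @ ys" "set ds \<subseteq> {Zero, One}" "set es \<subseteq> {Zero, One}" "no_digit xs" "no_digit ys"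
  shows "ds = es \<and> xs = ys"
proof -
  have "takeWhile (\<lambda>c. c \<in> {Zero, One}) (ds @ xs) = ds" if "set ds \<subseteq> {Zero, One}" "no_digit xs" for ds xs
    using that by (cases xs) (auto simp: no_digit_def takeWhile_append)
  then have "ds = es" using assms by metis
  then show ?thesis using assms(1) by simp
qed

lemma encode_prefix_unique:
  assumes "inj num"
  shows "encode num A @ xs = encode num B @ ys \<Longrightarrow> no_digit xs \<Longrightarrow> no_digit ys \<Longrightarrow> A = B \<and> xs = ys"
proof (induction A arbitrary: B xs ys)
  case Bot
  then show ?case by (cases B) auto
next
  case (Var p)
  then obtain q where B: "B = Var q" and eq: "binary (num p) @ xs = binary (num q) @ ys" by (cases B) auto
  have "binary (num p) = binary (num q) \<and> xs = ys"
    by (rule digits_unique[OF eq set_binary set_binary Var.prems(2,3)])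
  then show ?case using B inj_binary injD[OF assms] by auto
next
  case (Neg A)
  from Neg.prems(1) obtain B' where B: "B = \<^bold>\<not> B'" and eq: "encode num A @ xs = encode num B' @ ys"
    by (cases B) simp_all
  show ?case using Neg.IH[OF eq Neg.prems(2,3)] B by blast
next
  case (Conj A1 A2)
  from Conj.prems(1) obtain B1 B2 where B: "B = B1 \<^bold>\<and> B2"
    and eq: "encode num A1 @ encode num A2 @ xs = encode num B1 @ encode num B2 @ ys"
    by (cases B) simp_all
  have 1: "A1 = B1 \<and> encode num A2 @ xs = encode num B2 @ ys"
    by (rule Conj.IH(1)[OF eq no_digit_encode no_digit_encode])
  show ?case using Conj.IH(2)[OF conjunct2[OF 1] Conj.prems(2,3)] 1 B by blast
next
  case (Cond A1 A2)
  from Cond.prems(1) obtain B1 B2 where B: "B = B1 \<^bold>\<Rightarrow> B2"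
    and eq: "encode num A1 @ encode num A2 @ xs = encode num B1 @ encode num B2 @ ys"
    by (cases B) simp_all
  have 1: "A1 = B1 \<and> encode num A2 @ xs = encode num B2 @ ys"
    by (rule Cond.IH(1)[OF eq no_digit_encode no_digit_encode])
  show ?case using Cond.IH(2)[OF conjunct2[OF 1] Cond.prems(2,3)] 1 B by blast
qed

section \<open>Occurrences of subformulas and their tables\<close>

locale word_coding =
  fixes num :: "'v \<Rightarrow> nat" and K :: nat and w :: "letter list"
  assumes inj: "inj num" and range: "v \<in> range num \<longleftrightarrow> K = 0 \<or> v < K"
begin

abbreviation "n \<equiv> length w"
abbreviation "N \<equiv> wcode w"
abbreviation "P \<equiv> (2::nat) ^ length w"

lemma len_P [simp]: "len P = n" by (simp add: len_def bitlen_power)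

text \<open>Meaningful for every word, well-formed or not; \<open>w\<close> encodes \<open>A\<close>
  if \<open>A\<close> occurs at 0 and extends to the end.\<close>

definition nd :: "nat \<Rightarrow> 'v fm \<Rightarrow> bool" where
  "nd i A \<longleftrightarrow> i < n \<and> (\<exists>ys. drop i w = encode num A @ ys \<and> no_digit ys)"

definition fsz :: "'v fm \<Rightarrow> nat" where "fsz A = length (encode num A)"

definition span :: "nat \<Rightarrow> nat \<Rightarrow> bool" where
  "span i j \<longleftrightarrow> (\<exists>A. nd i A \<and> j = i + fsz A)"

lemma nd_less: "nd i A \<Longrightarrow> i < n" by (simp add: nd_def)

lemma nd_fsz: "nd i A \<Longrightarrow> i + fsz A \<le> n"
proof -
  assume A: "nd i A"
  then obtain ys where "drop i w = encode num A @ ys" by (auto simp: nd_def)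
  then have "length (drop i w) = fsz A + length ys" by (simp add: fsz_def)
  then show ?thesis using nd_less[OF A] by simp
qed

lemma nd_unique: "nd i A \<Longrightarrow> nd i B \<Longrightarrow> A = B"
  using encode_prefix_unique[OF inj] by (fastforce simp: nd_def)

lemma fsz_simps [simp]: "fsz \<^bold>\<bottom> = 1" "fsz (\<^bold>\<not> A) = Suc (fsz A)" "fsz (A \<^bold>\<and> B) = Suc (fsz A + fsz B)"
  "fsz (A \<^bold>\<Rightarrow> B) = Suc (fsz A + fsz B)"
  by (simp_all add: fsz_def)

lemma fsz_pos: "0 < fsz A" by (cases A) (auto simp: fsz_def)

lemma drop_word: "i < n \<Longrightarrow> drop i w = w ! i # drop (Suc i) w"
  by (simp add: Cons_nth_drop_Suc)

lemma nd_Bot: "nd i \<^bold>\<bottom> \<longleftrightarrow> i < n \<and> w ! i = TBot \<and> no_digit (drop (Suc i) w)"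
  unfolding nd_def using drop_word by auto

lemma nd_Var: "nd i (Var p) \<longleftrightarrow> i < n \<and> w ! i = TVar \<and> (\<exists>ys. drop (Suc i) w = binary (num p) @ ys \<and> no_digit ys)"
  unfolding nd_def using drop_word by auto

lemma nd_tail: "drop i w = encode num A @ ys \<Longrightarrow> i < n"
  using no_digit_encode by (cases A) (auto intro: ccontr)

lemma nd_Neg: "nd i (\<^bold>\<not> A) \<longleftrightarrow> i < n \<and> w ! i = TNeg \<and> nd (Suc i) A"
proof (cases "i < n")
  case True
  show ?thesis unfolding nd_def drop_word[OF True] using nd_tail[of "Suc i" A] True by auto
qed (simp add: nd_def)

lemma nd_binary:
  assumes "i < n"
  shows "(\<exists>ys. drop (Suc i) w = encode num A @ encode num B @ ys \<and> no_digit ys) \<longleftrightarrow>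
    nd (Suc i) A \<and> nd (Suc i + fsz A) B"
proof
  assume "\<exists>ys. drop (Suc i) w = encode num A @ encode num B @ ys \<and> no_digit ys"
  then obtain ys where ys: "drop (Suc i) w = encode num A @ encode num B @ ys" "no_digit ys" by blast
  then have "nd (Suc i) A" using nd_tail no_digit_encode unfolding nd_def by blast
  moreover have "drop (Suc i + fsz A) w = drop (fsz A) (drop (Suc i) w)" by (simp add: add.commute)
  then have d: "drop (Suc i + fsz A) w = encode num B @ ys" unfolding ys(1) by (simp add: fsz_def)
  then have "nd (Suc i + fsz A) B" using nd_tail[OF d] ys(2) unfolding nd_def by blast
  ultimately show "nd (Suc i) A \<and> nd (Suc i + fsz A) B" by blast
next
  assume a: "nd (Suc i) A \<and> nd (Suc i + fsz A) B"
  then obtain zs ys where zs: "drop (Suc i) w = encode num A @ zs"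
    and ys: "drop (Suc i + fsz A) w = encode num B @ ys" "no_digit ys" unfolding nd_def by blast
  have "drop (Suc i + fsz A) w = drop (fsz A) (drop (Suc i) w)" by (simp add: add.commute)
  then have "zs = encode num B @ ys" using ys(1) unfolding zs by (simp add: fsz_def)
  then show "\<exists>ys. drop (Suc i) w = encode num A @ encode num B @ ys \<and> no_digit ys" using zs ys(2) by blast
qed

lemma nd_Conj: "nd i (A \<^bold>\<and> B) \<longleftrightarrow> i < n \<and> w ! i = TConj \<and> nd (Suc i) A \<and> nd (Suc i + fsz A) B"
  unfolding nd_binary[symmetric] nd_def[of i] using drop_word nd_binary[of i A B] by auto

lemma nd_Cond: "nd i (A \<^bold>\<Rightarrow> B) \<longleftrightarrow> i < n \<and> w ! i = TCond \<and> nd (Suc i) A \<and> nd (Suc i + fsz A) B"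
  unfolding nd_def[of i] using drop_word nd_binary[of i A B] by auto

lemma lt_N: "lt N i = (if i < n then code (w ! i) else 0)" by (rule lt_wcode)

lemma lt_letter:
  "lt N i = Suc 0 \<longleftrightarrow> i < n \<and> w ! i = TBot" "lt N i = 2 \<longleftrightarrow> i < n \<and> w ! i = TVar"
  "lt N i = 3 \<longleftrightarrow> i < n \<and> w ! i = TNeg" "lt N i = 4 \<longleftrightarrow> i < n \<and> w ! i = TConj"
  "lt N i = 5 \<longleftrightarrow> i < n \<and> w ! i = TCond" "lt N i = 7 \<longleftrightarrow> i < n \<and> w ! i = One"
  "6 \<le> lt N i \<longleftrightarrow> i < n \<and> w ! i \<in> {Zero, One}"
  using code_digit by (cases "w ! i"; simp add: lt_N)+

lemma no_digit_drop: "no_digit (drop j w) \<longleftrightarrow> \<not> 6 \<le> lt N j"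
  unfolding lt_letter no_digit_def by (cases "j < n") (auto simp: hd_drop_conv_nth)

lemma bin_at_iff:
  assumes "j \<le> n" "v < P"
  shows "bin_at N P a j v \<longleftrightarrow> a \<le> j \<and> drop a w = binary v @ drop j w \<and> no_digit (drop j w)"
proof
  assume b: "bin_at N P a j v"
  then have aj: "a < j" and nd: "no_digit (drop j w)"
    and dg: "\<And>t. a \<le> t \<Longrightarrow> t < j \<Longrightarrow> w ! t \<in> {Zero, One}"
    and hd: "w ! a = One \<or> j = Suc a"
    and bits: "\<And>t. t < n \<Longrightarrow> bit v t \<longleftrightarrow> a + t < j \<and> w ! (j - 1 - t) = One"
    using assms unfolding bin_at_def no_digit_drop lt_letter by auto
  define ds where "ds = take (j - a) (drop a w)"
  have l: "length ds = j - a" unfolding ds_def using assms by simp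
  have nth: "ds ! t = w ! (a + t)" if "t < j - a" for t unfolding ds_def using that assms by simp
  have "ds = binary v"
  proof (rule binary_unique)
    show "ds \<noteq> []" using l aj by auto
    show "set ds \<subseteq> {Zero, One}"
    proof
      fix x assume "x \<in> set ds"
      then obtain t where "t < j - a" "x = ds ! t" using l by (auto simp: in_set_conv_nth)
      then show "x \<in> {Zero, One}" using nth dg[of "a + t"] by simp
    qed
    show "hd ds = One \<or> length ds = 1" using hd l aj nth[of 0] \<open>ds \<noteq> []\<close> by (auto simp: hd_conv_nth)
    show "bit v t \<longleftrightarrow> t < length ds \<and> ds ! (length ds - 1 - t) = One" for t
    proof (cases "t < j - a")
      case True
      have "ds ! (length ds - 1 - t) = w ! (j - 1 - t)" using nth[of "j - a - 1 - t"] True l by simp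
      then show ?thesis using bits[of t] True l assms(1) by auto
    next
      case False
      have "\<not> bit v t"
      proof
        assume "bit v t"
        then show False using bit_less[OF assms(2)] bits[of t] False by auto
      qed
      then show ?thesis using False l by simp
    qed
  qed
  moreover have "drop a w = ds @ drop j w"
    unfolding ds_def using aj append_take_drop_id[of "j - a" "drop a w"] by simp
  ultimately show "a \<le> j \<and> drop a w = binary v @ drop j w \<and> no_digit (drop j w)" using aj nd by simp
next
  assume a: "a \<le> j \<and> drop a w = binary v @ drop j w \<and> no_digit (drop j w)"
  let ?b = "binary v"
  have bne: "?b \<noteq> []" and bhd: "hd ?b = One \<or> length ?b = 1"
    and bbit: "\<And>t. bit v t \<longleftrightarrow> t < length ?b \<and> ?b ! (length ?b - 1 - t) = One"
    using binary_props[of v] by blast+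
  have "length (drop a w) = length ?b + length (drop j w)" using a by (metis length_append)
  then have "n - a = length ?b + (n - j)" by simp
  then have l: "length ?b = j - a" using assms(1) a by linarith
  then have aj: "a < j" using bne by (cases "a < j") auto
  have nth: "?b ! t = w ! (a + t)" if "t < j - a" for t
  proof -
    have "drop a w = ?b @ drop j w" using a by blast
    then have "drop a w ! t = (?b @ drop j w) ! t" by (rule arg_cong)
    then show ?thesis using that aj assms(1) l by (simp add: nth_append)
  qed
  have "w ! t \<in> {Zero, One}" if "a \<le> t" "t < j" for t
  proof -
    have "?b ! (t - a) \<in> set ?b" using that l by simp
    then have "?b ! (t - a) \<in> {Zero, One}" using set_binary by blast
    then show ?thesis using nth[of "t - a"] that by simp
  qed
  moreover have "w ! a = One \<or> j = Suc a" using bhd nth[of 0] aj l bne by (simp add: hd_conv_nth) linarith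
  moreover have "bit v t \<longleftrightarrow> a + t < j \<and> w ! (j - 1 - t) = One" for t
  proof (cases "t < j - a")
    case True
    have "?b ! (length ?b - 1 - t) = w ! (j - 1 - t)" using nth[of "j - a - 1 - t"] True l by simp
    then show ?thesis unfolding bbit l using True by auto
  next
    case False
    then show ?thesis unfolding bbit l by auto
  qed
  moreover have "\<not> 6 \<le> lt N j" using a no_digit_drop by blast
  ultimately show "bin_at N P a j v"
    using aj assms(1) unfolding bin_at_def lt_letter(6,7) by auto
qed

text \<open>The true spans satisfy the condition of \<open>span_table\<close>; this yields existence
  of a table, and uniqueness by comparison.\<close>

lemma span_rec:
  assumes "i < n" "j \<le> n"
  shows "span i j \<longleftrightarrow>
     lt N i = 1 \<and> j = Suc i \<and> \<not> 6 \<le> lt N j \<or>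
     lt N i = 2 \<and> (\<exists>v<P. (K = 0 \<or> v < K) \<and> bin_at N P (Suc i) j v) \<or>
     lt N i = 3 \<and> span (Suc i) j \<or>
     (lt N i = 4 \<or> lt N i = 5) \<and> (\<exists>m\<le>n. span (Suc i) m \<and> span m j)" (is "_ \<longleftrightarrow> ?R")
proof
  assume "span i j"
  then obtain A where A: "nd i A" "j = i + fsz A" by (auto simp: span_def)
  show ?R
  proof (cases A)
    case Bot
    then show ?thesis using A by (simp add: nd_Bot no_digit_drop lt_letter)
  next
    case (Var p)
    then obtain ys where ys: "w ! i = TVar" "drop (Suc i) w = binary (num p) @ ys" "no_digit ys"
      using A(1) by (auto simp: nd_Var)
    have j: "j = Suc i + length (binary (num p))" using A(2) Var by (simp add: fsz_def)
    have d: "drop j w = ys" using arg_cong[OF ys(2), of "drop (length (binary (num p)))"] j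
      by (simp add: add.commute)
    have "length (binary (num p)) \<le> n" using j assms(2) by simp
    then have "(2::nat) ^ length (binary (num p)) \<le> P" by simp
    then have vP: "num p < P" using binary_props[of "num p"] by (meson less_le_trans)
    have "bin_at N P (Suc i) j (num p)" unfolding bin_at_iff[OF assms(2) vP] using ys j d by simp
    moreover have "K = 0 \<or> num p < K" using range[of "num p"] by blast
    ultimately show ?thesis using vP ys(1) assms(1) by (auto simp: lt_letter)
  next
    case (Neg B)
    then show ?thesis using A by (auto simp: nd_Neg span_def lt_letter)
  next
    case (Conj B C)
    then have "span (Suc i) (Suc i + fsz B)" "span (Suc i + fsz B) j" "lt N i = 4" "Suc i + fsz B \<le> n"
      using A nd_fsz[of "Suc i" B] by (auto simp: nd_Conj span_def lt_letter)
    then show ?thesis by blast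
  next
    case (Cond B C)
    then have "span (Suc i) (Suc i + fsz B)" "span (Suc i + fsz B) j" "lt N i = 5" "Suc i + fsz B \<le> n"
      using A nd_fsz[of "Suc i" B] by (auto simp: nd_Cond span_def lt_letter)
    then show ?thesis by blast
  qed
next
  assume ?R
  then consider (1) "lt N i = 1" "j = Suc i" "\<not> 6 \<le> lt N j"
    | (2) v where "lt N i = 2" "v < P" "K = 0 \<or> v < K" "bin_at N P (Suc i) j v"
    | (3) "lt N i = 3" "span (Suc i) j"
    | (4) m where "lt N i = 4" "span (Suc i) m" "span m j"
    | (5) m where "lt N i = 5" "span (Suc i) m" "span m j" by blast
  then show "span i j"
  proof cases
    case 1
    then have "nd i \<^bold>\<bottom>" by (simp add: nd_Bot no_digit_drop lt_letter(1))
    then show ?thesis using 1 unfolding span_def by (intro exI[of _ "\<^bold>\<bottom>"]) simp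
  next
    case 2
    obtain p where p: "v = num p" using range[of v] 2(3) by blast
    have b: "Suc i \<le> j" "drop (Suc i) w = binary v @ drop j w" "no_digit (drop j w)"
      using 2(4) unfolding bin_at_iff[OF assms(2) 2(2)] by blast+
    have "nd i (Var p)" using b 2(1) p by (auto simp: nd_Var lt_letter)
    moreover have "length (drop (Suc i) w) = length (binary v) + length (drop j w)" using b(2) by (metis length_append)
    then have "j = i + fsz (Var p)" using b(1) p assms(2) by (simp add: fsz_def)
    ultimately show ?thesis unfolding span_def by blast
  next
    case 3
    then obtain B where B: "nd (Suc i) B" "j = Suc i + fsz B" by (auto simp: span_def)
    then have "nd i (\<^bold>\<not> B)" using 3(1) by (simp add: nd_Neg lt_letter)
    moreover have "j = i + fsz (\<^bold>\<not> B)" using B by simp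
    ultimately show ?thesis unfolding span_def by blast
  next
    case 4
    then obtain B C where B: "nd (Suc i) B" "m = Suc i + fsz B" "nd m C" "j = m + fsz C" by (auto simp: span_def)
    then have "nd i (B \<^bold>\<and> C)" using 4(1) by (simp add: nd_Conj lt_letter)
    moreover have "j = i + fsz (B \<^bold>\<and> C)" using B by simp
    ultimately show ?thesis unfolding span_def by blast
  next
    case 5
    then obtain B C where B: "nd (Suc i) B" "m = Suc i + fsz B" "nd m C" "j = m + fsz C" by (auto simp: span_def)
    then have "nd i (B \<^bold>\<Rightarrow> C)" using 5(1) by (simp add: nd_Cond lt_letter)
    moreover have "j = i + fsz (B \<^bold>\<Rightarrow> C)" using B by simp
    ultimately show ?thesis unfolding span_def by blast
  qed
qed

lemma span_bounds: "span i j \<Longrightarrow> i < j \<and> j \<le> n"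
  using nd_fsz fsz_pos by (auto simp: span_def)

text \<open>The condition at \<open>i\<close> refers only to spans that start further right, so the
  table is determined from the end of the word.\<close>

lemma span_table_unique:
  assumes "span_table K N P T"
  shows "sp P T i j \<longleftrightarrow> span i j"
proof (induction "n - i" arbitrary: i j rule: less_induct)
  case less
  show ?case
  proof (cases "i < n \<and> j \<le> n")
    case False
    then show ?thesis using span_bounds[of i j] by (auto simp: sp_def)
  next
    case True
    have IH: "sp P T i' j' \<longleftrightarrow> span i' j'" if "i < i'" for i' j'
      by (rule less) (use that True in linarith)
    have m: "(\<exists>m\<le>n. sp P T (Suc i) m \<and> sp P T m j) \<longleftrightarrow> (\<exists>m\<le>n. span (Suc i) m \<and> span m j)"
    proof -
      have "sp P T m j \<longleftrightarrow> span m j" if "span (Suc i) m" for m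
        \<comment> \<open>Subformulas are nonempty, so the second one starts beyond \<open>i\<close>
          as well.\<close>
        by (rule IH) (use span_bounds[OF that] in linarith)
      then show ?thesis using IH[of "Suc i"] by blast
    qed
    have "sp P T i j \<longleftrightarrow> (lt N i = 1 \<and> j = Suc i \<and> \<not> 6 \<le> lt N j \<or>
     lt N i = 2 \<and> (\<exists>v<P. (K = 0 \<or> v < K) \<and> bin_at N P (Suc i) j v) \<or>
     lt N i = 3 \<and> sp P T (Suc i) j \<or>
     (lt N i = 4 \<or> lt N i = 5) \<and> (\<exists>m\<le>n. sp P T (Suc i) m \<and> sp P T m j))"
      using assms True unfolding span_table_def len_P by blast
    then show ?thesis unfolding m IH[of "Suc i" j, OF lessI] span_rec[OF conjunct1[OF True] conjunct2[OF True]] .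
  qed
qed

text \<open>A matrix of \<open>n * Suc n\<close> bits is a number below 2 to that power, which is
  \<open>P ^ Suc n\<close>; hence the bound in \<open>decision\<close>.\<close>

lemma ex_table: "\<exists>T<P ^ Suc (len P). \<forall>i j. sp P T i j \<longleftrightarrow> i < n \<and> j \<le> n \<and> Q i j"
proof -
  obtain T :: nat where T: "T < 2 ^ (n * Suc n)"
    "\<forall>x<n * Suc n. bit T x \<longleftrightarrow> Q (x div Suc n) (x mod Suc n)"
    using ex_bits[of "n * Suc n" "\<lambda>x. Q (x div Suc n) (x mod Suc n)"] by blast
  have "bit T (i * Suc n + j) \<longleftrightarrow> Q i j" if "i < n" "j \<le> n" for i j
  proof -
    have "i * Suc n + j < Suc i * Suc n" using that by simp
    also have "\<dots> \<le> n * Suc n" by (rule mult_le_mono1) (use that in simp)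
    finally have "bit T (i * Suc n + j) \<longleftrightarrow> Q ((i * Suc n + j) div Suc n) ((i * Suc n + j) mod Suc n)"
      using T(2) by blast
    moreover have "(i * Suc n + j) div Suc n = i" "(i * Suc n + j) mod Suc n = j"
      using that by (simp_all only: div_mult_self3 mod_mult_self3) simp_all
    ultimately show ?thesis by simp
  qed
  moreover have "T < P ^ Suc (len P)" using T(1) by (simp add: power_mult[symmetric] power_add[symmetric])
  ultimately show ?thesis by (intro exI[of _ T]) (auto simp: sp_def)
qed

lemma ex_span_table: "\<exists>T<P ^ Suc (len P). span_table K N P T"
proof -
  obtain T where T: "T < P ^ Suc (len P)" "\<And>i j. sp P T i j \<longleftrightarrow> i < n \<and> j \<le> n \<and> span i j"
    using ex_table[of span] by blast
  then have "sp P T i j \<longleftrightarrow> span i j" for i j using span_bounds[of i j] by auto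
  then have "span_table K N P T" unfolding span_table_def len_P using span_rec by simp
  then show ?thesis using T(1) by blast
qed

end

section \<open>The arithmetic game and the abstract game\<close>

locale parsed_word = word_coding num K w for num :: "'v \<Rightarrow> nat" and K w +
  fixes T :: nat and idf :: bool
  assumes T: "span_table K N P T"
begin

lemma sp_iff: "sp P T i j \<longleftrightarrow> span i j"
  by (rule span_table_unique[OF T])

lemma is_node_iff: "is_node P T i \<longleftrightarrow> (\<exists>A. nd i A)"
  unfolding is_node_def sp_iff using nd_fsz by (auto simp: span_def)

lemma sp_nd: "nd i A \<Longrightarrow> sp P T i j \<longleftrightarrow> j = i + fsz A"
  unfolding sp_iff span_def using nd_unique by blast

abbreviation "bot' \<equiv> bot_at N P T"
abbreviation "neg' \<equiv> neg_at N P T"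
abbreviation "conj' \<equiv> conj_at N P T"
abbreviation "cond' \<equiv> cond_at N P T"
abbreviation "same' \<equiv> same_at N P T"
abbreviation "le' \<equiv> size_le P T"

lemma nd_letter: "nd i A \<Longrightarrow> lt N i = (case A of Bot \<Rightarrow> 1 | Var _ \<Rightarrow> 2 | Neg _ \<Rightarrow> 3 | Conj _ _ \<Rightarrow> 4 | Cond _ _ \<Rightarrow> 5)"
  by (cases A) (auto simp: nd_Bot nd_Var nd_Neg nd_Conj nd_Cond lt_letter)

lemma same_iff: "same' i j \<longleftrightarrow> (\<exists>A. nd i A \<and> nd j A)"
proof
  assume "same' i j"
  then obtain l where l: "span i (i + l)" "span j (j + l)" "\<And>t. t < l \<Longrightarrow> lt N (i + t) = lt N (j + t)"
    unfolding same_at_def sp_iff by blast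
  then obtain A B where AB: "nd i A" "l = fsz A" "nd j B" "l = fsz B" by (auto simp: span_def)
  obtain xs ys where xs: "drop i w = encode num A @ xs" "drop j w = encode num B @ ys"
    using AB unfolding nd_def by blast
  have "encode num A = encode num B"
  proof (rule nth_equalityI)
    show "length (encode num A) = length (encode num B)" using AB by (simp add: fsz_def)
    fix t assume "t < length (encode num A)"
    then have t: "t < l" using AB by (simp add: fsz_def)
    then have "i + t < n" "j + t < n" using nd_fsz[OF AB(1)] nd_fsz[OF AB(3)] AB by simp_all
    then have "w ! (i + t) = w ! (j + t)" using l(3)[OF t] by (simp add: lt_N code_inj)
    moreover have "w ! (i + t) = encode num A ! t" 
      using arg_cong[OF xs(1), of "\<lambda>x. x ! t"] t AB(2) \<open>i + t < n\<close> by (simp add: nth_append fsz_def)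
    moreover have "w ! (j + t) = encode num B ! t" 
      using arg_cong[OF xs(2), of "\<lambda>x. x ! t"] t AB(4) \<open>j + t < n\<close> by (simp add: nth_append fsz_def)
    ultimately show "encode num A ! t = encode num B ! t" by simp
  qed
  then have "A = B" using inj_encode[OF inj] injD by metis
  then show "\<exists>A. nd i A \<and> nd j A" using AB by blast
next
  assume "\<exists>A. nd i A \<and> nd j A"
  then obtain A where A: "nd i A" "nd j A" by blast
  obtain xs ys where xs: "drop i w = encode num A @ xs" "drop j w = encode num A @ ys"
    using A unfolding nd_def by blast
  have "lt N (i + t) = lt N (j + t)" if t: "t < fsz A" for t
  proof -
    have "i + t < n" "j + t < n" using nd_fsz[OF A(1)] nd_fsz[OF A(2)] t by simp_all
    moreover have "w ! (i + t) = encode num A ! t" 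
      using arg_cong[OF xs(1), of "\<lambda>x. x ! t"] t \<open>i + t < n\<close> by (simp add: nth_append fsz_def)
    moreover have "w ! (j + t) = encode num A ! t" 
      using arg_cong[OF xs(2), of "\<lambda>x. x ! t"] t \<open>j + t < n\<close> by (simp add: nth_append fsz_def)
    ultimately show ?thesis by (simp add: lt_N)
  qed
  moreover have "fsz A \<le> n" using nd_fsz[OF A(1)] by simp
  ultimately show "same' i j" unfolding same_at_def using sp_nd[OF A(1)] sp_nd[OF A(2)] by auto
qed

lemma lt_node:
  assumes "nd i A"
  shows "lt N i = 1 \<Longrightarrow> A = \<^bold>\<bottom>"
  using nd_letter[OF assms] by (cases A) auto

sublocale skeleton idf fsz nd bot' neg' conj' cond' same' le'
proof
  show "nd i A \<Longrightarrow> nd i B \<Longrightarrow> A = B" for i A B by (rule nd_unique)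
  show "0 < fsz A" for A by (rule fsz_pos)
  show "fsz A < fsz (\<^bold>\<not> A)" "fsz A < fsz (A \<^bold>\<and> B)" "fsz B < fsz (A \<^bold>\<and> B)"
      "fsz A < fsz (A \<^bold>\<Rightarrow> B)" "fsz B < fsz (A \<^bold>\<Rightarrow> B)" for A B by simp_all
  show "le' l i \<longleftrightarrow> fsz A \<le> l" if "nd i A" for l i A
    unfolding size_le_def using sp_nd[OF that] nd_fsz[OF that] by auto
  show "bot' i \<longleftrightarrow> nd i \<^bold>\<bottom>" for i
    unfolding bot_at_def is_node_iff using lt_node nd_letter[of i "\<^bold>\<bottom>"] by auto
  show "\<exists>A. nd i (\<^bold>\<not> A) \<and> nd j A" if "neg' i j" for i j
    using that unfolding neg_at_def is_node_iff len_P by (auto simp: nd_Neg lt_letter)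
  show "\<exists>j. neg' i j \<and> nd j A" if "nd i (\<^bold>\<not> A)" for i A
    using that unfolding neg_at_def is_node_iff len_P by (auto simp: nd_Neg lt_letter)
  show "\<exists>A B. nd i (A \<^bold>\<and> B) \<and> nd j A \<and> nd k B" if c: "conj' i j k" for i j k
  proof -
    obtain A B where AB: "i < n" "lt N i = 4" "j = Suc i" "nd j A" "k = j + fsz A" "nd k B"
      using c unfolding conj_at_def is_node_iff sp_iff len_P span_def by blast
    then have "nd i (A \<^bold>\<and> B)" by (simp add: nd_Conj lt_letter)
    then show ?thesis using AB by blast
  qed
  show "\<exists>j k. conj' i j k \<and> nd j A \<and> nd k B" if "nd i (A \<^bold>\<and> B)" for i A B
    using that unfolding conj_at_def is_node_iff sp_iff len_P by (auto simp: nd_Conj lt_letter span_def)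
  show "\<exists>A B. nd i (A \<^bold>\<Rightarrow> B) \<and> nd j A \<and> nd k B" if c: "cond' i j k" for i j k
  proof -
    obtain A B where AB: "i < n" "lt N i = 5" "j = Suc i" "nd j A" "k = j + fsz A" "nd k B"
      using c unfolding cond_at_def is_node_iff sp_iff len_P span_def by blast
    then have "nd i (A \<^bold>\<Rightarrow> B)" by (simp add: nd_Cond lt_letter)
    then show ?thesis using AB by blast
  qed
  show "\<exists>j k. cond' i j k \<and> nd j A \<and> nd k B" if "nd i (A \<^bold>\<Rightarrow> B)" for i A B
    using that unfolding cond_at_def is_node_iff sp_iff len_P by (auto simp: nd_Cond lt_letter span_def)
  show "same' i j \<longleftrightarrow> (\<exists>A. nd i A \<and> nd j A)" for i j by (rule same_iff)
qed

lemma at_less: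
  "bot' i \<Longrightarrow> i < n" "neg' i j \<Longrightarrow> i < n \<and> j < n" "conj' i j k \<Longrightarrow> i < n \<and> j < n \<and> k < n"
  "cond' i j k \<Longrightarrow> i < n \<and> j < n \<and> k < n" "same' i j \<Longrightarrow> i < n \<and> j < n"
  using nd_less unfolding bot_at_def neg_at_def conj_at_def cond_at_def same_iff is_node_iff sp_def len_P
  by blast+

lemma coh_num_iff: "coh_num N P T V \<longleftrightarrow> coh (bit V)"
  unfolding coh_num_def coherent_def len_P using at_less by meson

lemma coh_cong: "(\<And>i. i < n \<Longrightarrow> V i \<longleftrightarrow> V' i) \<Longrightarrow> coh V \<longleftrightarrow> coh V'"
  unfolding coherent_def using at_less by (smt (verit))

text \<open>Only positions in the word matter, so any valuation may be replaced by a number below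
  \<open>P\<close>.\<close>

lemma win_cong: "(\<And>i. i < n \<Longrightarrow> V i \<longleftrightarrow> V' i) \<Longrightarrow> win E l V \<longleftrightarrow> win E l V'"
proof (induction l)
  case (Suc l)
  have c: "cond' i j k \<Longrightarrow> V i = V' i \<and> V j = V' j" for i j k using Suc.prems at_less(4) by blast
  then have A: "(\<forall>i' j' k'. cond' i' j' k' \<and> le' (Suc l) i' \<and> E j' j \<longrightarrow> (W k' \<longleftrightarrow> V i')) \<longleftrightarrow>
    (\<forall>i' j' k'. cond' i' j' k' \<and> le' (Suc l) i' \<and> E j' j \<longrightarrow> (W k' \<longleftrightarrow> V' i'))" for W j
    by blast
  have B: "(\<forall>i j k. cond' i j k \<and> le' (Suc l) i \<and> \<not> V i \<and> \<not> V j \<longrightarrow> S j) \<longleftrightarrow>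
    (\<forall>i j k. cond' i j k \<and> le' (Suc l) i \<and> \<not> V' i \<and> \<not> V' j \<longrightarrow> S j)" for S
    using c by blast
  show ?case unfolding game.simps A by (rule B)
qed simp

lemma ex_valuation: "\<exists>v<P. \<forall>i<n. bit v i \<longleftrightarrow> V i"
  using ex_bits by blast

lemma pos_proj:
  assumes "V < P" "j \<le> n"
  shows "pos_val P (pos P V j l) = V" "pos_ant P (pos P V j l) = j" "pos_lev P (pos P V j l) = l"
  using assms by (simp_all add: pos_val_def pos_ant_def pos_lev_def pos_def del: mult_Suc)

lemma pos_less:
  assumes "V < P" "j \<le> n" "l \<le> n"
  shows "pos P V j l < pos_bound P"
proof -
  have "j + Suc n * l < Suc n * Suc l" using assms by simp
  also have "\<dots> \<le> Suc n * Suc n" by (rule mult_le_mono2) (use assms in simp)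
  finally have "Suc (j + Suc n * l) \<le> Suc n * Suc n" by simp
  then have "P * Suc (j + Suc n * l) \<le> P * (Suc n * Suc n)" by (rule mult_le_mono2)
  moreover have "V + P * (j + Suc n * l) < P * Suc (j + Suc n * l)" using assms(1) by (simp del: mult_Suc)
  ultimately show ?thesis unfolding pos_def pos_bound_def len_P by linarith
qed

abbreviation "mv E \<equiv> gwin P (\<lambda>x y. move_ok idf N P T E x y) (\<lambda>x y. next_pos P x y)"

text \<open>One level of \<open>game\<close> is a challenge followed by an answer, that is, two
  moves of \<open>gwin\<close>. At level 0 the opponent has no legal move and loses with any budget,
  so \<open>d\<close> may exceed \<open>l + l\<close>.\<close>

lemma gwin_iff_game:
  assumes "V < P" "l \<le> n" "l + l \<le> d"
  shows "\<not> mv E d (pos P V 0 l) \<longleftrightarrow> win (sp P E) l (bit V)"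
  using assms
proof (induction l arbitrary: V d)
  case 0
  then show ?case by (cases d) (auto simp: move_ok_def pos_proj)
next
  case (Suc l)
  then obtain d' where d: "d = Suc (Suc d')" "l + l \<le> d'" by (metis Suc_le_D add_Suc_right add_Suc Suc_le_mono)
  \<comment> \<open>Hence the moves below \<open>P\<close> include all positions of
    conditionals.\<close>
  have nP: "n < P" by (rule less_exp)
  have inner: "mv E (Suc d') (pos P V (Suc y) (Suc l)) \<longleftrightarrow>
     (\<exists>V'. coh V' \<and> (\<forall>i j k. cond' i j k \<and> le' (Suc l) i \<and> sp P E j (Suc y) \<longrightarrow> (V' k \<longleftrightarrow> bit V i)) \<and>
       (idf \<longrightarrow> V' (Suc y)) \<and> win (sp P E) l V')" (is "_ \<longleftrightarrow> ?R") if y: "Suc y < n" for y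
  proof -
    note pp = pos_proj[OF Suc.prems(1), of "Suc y" "Suc l"]
    have ok: "move_ok idf N P T E (pos P V (Suc y) (Suc l)) V' \<longleftrightarrow> coh (bit V') \<and> (idf \<longrightarrow> bit V' (Suc y)) \<and>
      (\<forall>i j k. cond' i j k \<and> le' (Suc l) i \<and> sp P E j (Suc y) \<longrightarrow> (bit V' k \<longleftrightarrow> bit V i))" if "V' < P" for V'
    proof -
      have "(\<forall>i<n. \<forall>j<n. \<forall>k<n. cond' i j k \<and> le' (Suc l) i \<and> sp P E j (Suc y) \<longrightarrow> (bit V' k \<longleftrightarrow> bit V i)) \<longleftrightarrow>
        (\<forall>i j k. cond' i j k \<and> le' (Suc l) i \<and> sp P E j (Suc y) \<longrightarrow> (bit V' k \<longleftrightarrow> bit V i))"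
        using at_less(4) by blast
      then show ?thesis
        using pos_less[OF that, of 0 l] Suc.prems(2) y unfolding move_ok_def next_pos_def len_P coh_num_iff
        by (simp add: pp)
    qed
    have nx: "next_pos P (pos P V (Suc y) (Suc l)) V' = pos P V' 0 l" for V'
      using y by (simp add: next_pos_def pp)
    have IH: "\<not> mv E d' (pos P V' 0 l) \<longleftrightarrow> win (sp P E) l (bit V')" if "V' < P" for V'
      by (rule Suc.IH) (use that Suc.prems(2) d(2) in auto)
    have "mv E (Suc d') (pos P V (Suc y) (Suc l)) \<longleftrightarrow> (\<exists>V'<P. coh (bit V') \<and> (idf \<longrightarrow> bit V' (Suc y)) \<and>
      (\<forall>i j k. cond' i j k \<and> le' (Suc l) i \<and> sp P E j (Suc y) \<longrightarrow> (bit V' k \<longleftrightarrow> bit V i)) \<and> win (sp P E) l (bit V'))"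
      unfolding gwin.simps nx using ok IH by blast
    also have "\<dots> \<longleftrightarrow> ?R"
    \<comment> \<open>An answer in \<open>game\<close> is any function on indices; it is truncated
      to a number that agrees with it on the word.\<close>
    proof
      assume ?R
      then obtain V' where V': "coh V'" "idf \<longrightarrow> V' (Suc y)" "win (sp P E) l V'"
        "\<forall>i j k. cond' i j k \<and> le' (Suc l) i \<and> sp P E j (Suc y) \<longrightarrow> (V' k \<longleftrightarrow> bit V i)" by blast
      obtain v where v: "v < P" "\<forall>i<n. bit v i \<longleftrightarrow> V' i" using ex_valuation by blast
      have "coh (bit v)" "win (sp P E) l (bit v)"
        using coh_cong[of "bit v" V'] win_cong[of "bit v" V'] v(2) V' by blast+
      moreover have "idf \<longrightarrow> bit v (Suc y)" using v(2) V'(2) y by blast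
      moreover have "\<forall>i j k. cond' i j k \<and> le' (Suc l) i \<and> sp P E j (Suc y) \<longrightarrow> (bit v k \<longleftrightarrow> bit V i)"
        using V'(4) v(2) at_less(4) by blast
      ultimately show "\<exists>V'<P. coh (bit V') \<and> (idf \<longrightarrow> bit V' (Suc y)) \<and>
        (\<forall>i j k. cond' i j k \<and> le' (Suc l) i \<and> sp P E j (Suc y) \<longrightarrow> (bit V' k \<longleftrightarrow> bit V i)) \<and> win (sp P E) l (bit V')"
        using v(1) by blast
    qed blast
    finally show ?thesis .
  qed
  note pp = pos_proj[OF Suc.prems(1), of 0 "Suc l", OF le0]
  have ok: "move_ok idf N P T E (pos P V 0 (Suc l)) y \<longleftrightarrow>
    (\<exists>k. cond' y (Suc y) k) \<and> le' (Suc l) y \<and> \<not> bit V y \<and> \<not> bit V (Suc y)" for y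
  proof -
    have k: "(\<exists>k<n. cond' y (Suc y) k) \<longleftrightarrow> (\<exists>k. cond' y (Suc y) k)" using at_less(4) by blast
    have "pos P V (Suc y) (Suc l) < pos_bound P" if "cond' y (Suc y) k" for k
      by (rule pos_less) (use at_less(4)[OF that] Suc.prems in auto)
    then show ?thesis unfolding move_ok_def next_pos_def len_P k pp by auto
  qed
  have nx: "next_pos P (pos P V 0 (Suc l)) y = pos P V (Suc y) (Suc l)" for y
    by (simp add: next_pos_def pp)
  have j: "j = Suc i \<and> i < P \<and> Suc i < n" if "cond' i j k" for i j k
  proof -
    have "j = Suc i" "i < n" "j < n" using at_less(4)[OF that] that unfolding cond_at_def by blast+
    then show ?thesis using less_trans[OF _ nP] by blast
  qed
  have "mv E d (pos P V 0 (Suc l)) \<longleftrightarrow>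
    (\<exists>y<P. ((\<exists>k. cond' y (Suc y) k) \<and> le' (Suc l) y \<and> \<not> bit V y \<and> \<not> bit V (Suc y)) \<and>
      \<not> mv E (Suc d') (pos P V (Suc y) (Suc l)))"
    unfolding d gwin.simps(2)[of _ _ _ "Suc d'"] ok nx ..
  also have "\<dots> \<longleftrightarrow> \<not> win (sp P E) (Suc l) (bit V)"
  proof -
    define S where "S = (\<lambda>j. \<exists>V'. coh V' \<and> (\<forall>i' j' k. cond' i' j' k \<and> le' (Suc l) i' \<and> sp P E j' j \<longrightarrow>
       (V' k \<longleftrightarrow> bit V i')) \<and> (idf \<longrightarrow> V' j) \<and> win (sp P E) l V')"
    have mv: "mv E (Suc d') (pos P V (Suc y) (Suc l)) \<longleftrightarrow> S (Suc y)" if "Suc y < n" for y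
      unfolding S_def by (rule inner[OF that])
    have win: "win (sp P E) (Suc l) (bit V) \<longleftrightarrow>
      (\<forall>i j k. cond' i j k \<and> le' (Suc l) i \<and> \<not> bit V i \<and> \<not> bit V j \<longrightarrow> S j)"
      unfolding game.simps S_def ..
    show ?thesis unfolding win
    proof
      assume "\<exists>y<P. ((\<exists>k. cond' y (Suc y) k) \<and> le' (Suc l) y \<and> \<not> bit V y \<and> \<not> bit V (Suc y)) \<and>
        \<not> mv E (Suc d') (pos P V (Suc y) (Suc l))"
      then obtain y k where y: "cond' y (Suc y) k" "le' (Suc l) y" "\<not> bit V y" "\<not> bit V (Suc y)"
        "\<not> mv E (Suc d') (pos P V (Suc y) (Suc l))" by blast
      have "\<not> S (Suc y)" using y(5) mv j[OF y(1)] by blast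
      then show "\<not> (\<forall>i j k. cond' i j k \<and> le' (Suc l) i \<and> \<not> bit V i \<and> \<not> bit V j \<longrightarrow> S j)"
        using y by blast
    next
      assume "\<not> (\<forall>i j k. cond' i j k \<and> le' (Suc l) i \<and> \<not> bit V i \<and> \<not> bit V j \<longrightarrow> S j)"
      then obtain i j' k where i: "cond' i j' k" "le' (Suc l) i" "\<not> bit V i" "\<not> bit V j'" "\<not> S j'" by blast
      note ji = j[OF i(1)]
      have "\<not> mv E (Suc d') (pos P V (Suc i) (Suc l))" using mv i(5) ji by blast
      then show "\<exists>y<P. ((\<exists>k. cond' y (Suc y) k) \<and> le' (Suc l) y \<and> \<not> bit V y \<and> \<not> bit V (Suc y)) \<and>
        \<not> mv E (Suc d') (pos P V (Suc y) (Suc l))" using i ji by blast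
    qed
  qed
  finally show ?case by blast
qed

lemma win_num_iff: "V < P \<Longrightarrow> l \<le> n \<Longrightarrow> win_num idf N P T E V l \<longleftrightarrow> win (sp P E) l (bit V)"
  unfolding win_num_def using gwin_iff_game[of V l "len P + len P" E] pos_less[of V 0 l] by simp

lemma ex_num_iff:
  assumes "l \<le> n" "\<And>V V'. (\<And>i. i < n \<Longrightarrow> V i \<longleftrightarrow> V' i) \<Longrightarrow> Q V \<longleftrightarrow> Q V'"
  shows "(\<exists>V<P. coh_num N P T V \<and> Q (bit V) \<and> win_num idf N P T E V l) \<longleftrightarrow>
    (\<exists>V. coh V \<and> Q V \<and> win (sp P E) l V)"
proof
  assume "\<exists>V. coh V \<and> Q V \<and> win (sp P E) l V"
  then obtain V where V: "coh V" "Q V" "win (sp P E) l V" by blast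
  obtain v where v: "v < P" "\<forall>i<n. bit v i \<longleftrightarrow> V i" using ex_valuation by blast
  have "coh (bit v)" "win (sp P E) l (bit v)" "Q (bit v)"
    using coh_cong[of "bit v" V] win_cong[of "bit v" V] assms(2)[of "bit v" V] v(2) V by blast+
  then show "\<exists>V<P. coh_num N P T V \<and> Q (bit V) \<and> win_num idf N P T E V l"
    using v(1) win_num_iff[OF v(1) assms(1)] coh_num_iff by blast
qed (use win_num_iff assms(1) coh_num_iff in blast)

lemma equiv_table_iff: "equiv_table idf N P T E \<longleftrightarrow> equiv_spec n (sp P E)"
proof -
  have le: "le' l i \<Longrightarrow> i < n \<and> same' i i" for l i
    unfolding size_le_def sp_iff same_iff span_def using nd_less by blast
  have ex: "(\<exists>V<P. coh_num N P T V \<and> (bit V i \<longleftrightarrow> \<not> bit V j) \<and> win_num idf N P T E V l) \<longleftrightarrow>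
    (\<exists>V. coh V \<and> (V i \<longleftrightarrow> \<not> V j) \<and> win (sp P E) l V)" if "l \<le> n" "i < n" "j < n" for l i j
    by (rule ex_num_iff[OF that(1), of "\<lambda>V. V i \<longleftrightarrow> \<not> V j"]) (use that in simp)
  show ?thesis unfolding equiv_table_def equiv_spec_def len_P
  proof (rule iffI, goal_cases)
    case H: 1
    show ?case
    proof (intro allI impI, goal_cases)
      case (1 l i j)
      then have ij: "i < n" "j < n" "size_le P T l i \<and> size_le P T l j" using le by blast+
      show ?case unfolding ex[OF 1(1) ij(1,2), symmetric] using H 1(1) ij by simp
    qed
  next
    case H: 2
    show ?case
    proof (intro allI impI, goal_cases)
      case (1 l i j)
      then have a: "le' l i \<and> le' l j \<and> same' i i \<and> same' j j" using le by blast
      show ?case unfolding ex[OF 1(1,2,3)] using H 1(1) a by simp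
    qed
  qed
qed

lemma derivable_iff_table:
  assumes "equiv_table idf N P T E" "nd 0 A"
  shows "R \<turnstile>\<^sub>H A \<longleftrightarrow> \<not> (\<exists>V<P. coh_num N P T V \<and> \<not> bit V 0 \<and> win_num idf N P T E V (len P))"
proof -
  have "(\<exists>V<P. coh_num N P T V \<and> \<not> bit V 0 \<and> win_num idf N P T E V n) \<longleftrightarrow>
    (\<exists>V. coh V \<and> \<not> V 0 \<and> win (sp P E) n V)"
    by (rule ex_num_iff[OF order.refl, of "\<lambda>V. \<not> V 0"]) (use nd_less[OF assms(2)] in simp)
  then show ?thesis
    using derivable_iff_no_win[of n "sp P E" 0 A] assms nd_fsz[OF assms(2)] equiv_table_iff by simp
qed

text \<open>Provable equivalence itself fills the table, so the search in \<open>decision\<close>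
  never comes up empty on a parsed word.\<close>

lemma ex_equiv_table: "\<exists>E<P ^ Suc (len P). equiv_table idf N P T E"
proof -
  obtain E where E: "E < P ^ Suc (len P)"
    "\<And>i j. sp P E i j \<longleftrightarrow> i < n \<and> j \<le> n \<and> (\<forall>A B. nd i A \<and> nd j B \<longrightarrow> R \<turnstile>\<^sub>H A \<^bold>\<longleftrightarrow> B)"
    using ex_table[of "\<lambda>i j. \<forall>A B. nd i A \<and> nd j B \<longrightarrow> R \<turnstile>\<^sub>H A \<^bold>\<longleftrightarrow> B"] by blast
  have "equiv_spec n (sp P E)"
  proof (rule equiv_spec_exists)
    fix i j A B assume A: "nd i A" and B: "nd j B"
    have "i < n" "j \<le> n" using nd_less[OF A] nd_less[OF B] by simp_all
    then show "sp P E i j \<longleftrightarrow> R \<turnstile>\<^sub>H A \<^bold>\<longleftrightarrow> B"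
      unfolding E(2) using nd_unique[OF A] nd_unique[OF B] A B by blast
  qed
  then show ?thesis using E(1) equiv_table_iff by blast
qed

end

theorem decision_correct:
  assumes "word_coding num K"
  shows "decision idf K (wcode w) (2 ^ length w) \<longleftrightarrow> (\<exists>A. w = encode num A \<and> logic idf \<turnstile>\<^sub>H A)"
proof -
  interpret word_coding num K w by (rule assms)
  have pw: "parsed_word num K w T" if "span_table K N P T" for T
    by unfold_locales (rule that)
  show ?thesis
  proof
    assume "decision idf K N P"
    then obtain T E where T: "span_table K N P T" "sp P T 0 (len P)" and E: "equiv_table idf N P T E"
      "\<not> (\<exists>V<P. coh_num N P T V \<and> \<not> bit V 0 \<and> win_num idf N P T E V (len P))"
      unfolding decision_def by blast
    obtain A where A: "nd 0 A" "n = fsz A"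
      using T span_table_unique[OF T(1)] by (auto simp: span_def)
    have "logic idf \<turnstile>\<^sub>H A" using parsed_word.derivable_iff_table[OF pw[OF T(1)] E(1) A(1)] E(2) by blast
    moreover have "w = encode num A" using A by (auto simp: nd_def fsz_def)
    ultimately show "\<exists>A. w = encode num A \<and> logic idf \<turnstile>\<^sub>H A" by blast
  next
    assume "\<exists>A. w = encode num A \<and> logic idf \<turnstile>\<^sub>H A"
    then obtain A where A: "w = encode num A" "logic idf \<turnstile>\<^sub>H A" by blast
    have n: "n = fsz A" using A by (simp add: fsz_def)
    then have nd: "nd 0 A" unfolding nd_def using fsz_pos[of A] A(1)
      by (intro conjI exI[of _ "[]"]) (simp_all add: no_digit_def)
    obtain T where T: "T < P ^ Suc (len P)" "span_table K N P T" using ex_span_table by blast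
    have "span 0 n" unfolding span_def using nd n by auto
    then have "sp P T 0 (len P)" unfolding span_table_unique[OF T(2)] len_P .
    moreover obtain E where E: "E < P ^ Suc (len P)" "equiv_table idf N P T E"
      using parsed_word.ex_equiv_table[OF pw[OF T(2)]] by blast
    moreover have "\<not> (\<exists>V<P. coh_num N P T V \<and> \<not> bit V 0 \<and> win_num idf N P T E V (len P))"
      using parsed_word.derivable_iff_table[OF pw[OF T(2)] E(2) nd] A(2) by blast
    ultimately show "decision idf K N P" unfolding decision_def using T by blast
  qed
qed

section \<open>Assembling the Turing machine\<close>

text \<open>All variables from 1 on read register 1. Thus every entry of the environment obeys the
  size bound, and every variable lies below the scratch registers.\<close>

definition input_regs :: "nat \<Rightarrow> nat" where
  "input_regs i = (if i = 0 then 0 else 1)"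

definition assign :: "nat \<Rightarrow> exp \<Rightarrow> 'a com" where
  "assign r a = Seq (compile a input_regs 2) (Seq (clear r) (move 2 r))"

lemma exec_assign:
  assumes "\<And>i. 2 \<le> i \<Longrightarrow> s i = 0" "r < 2" "vals_below B a (\<lambda>i. s (input_regs i))"
  shows "exec B (assign r a) (s, w) (s(r := eval a (\<lambda>i. s (input_regs i))), w)"
proof -
  let ?x = "eval a (\<lambda>i. s (input_regs i))"
  have 1: "exec B (compile a input_regs 2) (s, w) (s(2 := ?x), w)"
    by (rule compile_correct) (use assms in \<open>auto simp: input_regs_def\<close>)
  have 2: "exec B (clear r) (s(2 := ?x), w) (s(2 := ?x, r := 0), w)" by (rule exec_clear)
  have 3: "exec B (move 2 r) (s(2 := ?x, r := 0), w) (s(r := ?x), w)"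
    by (rule exec_eq[OF exec_move]) (use assms vals_below_eval[OF assms(3)] in \<open>auto simp: fun_eq_iff\<close>)
  show ?thesis unfolding assign_def by (rule exec.Seq[OF 1 exec.Seq[OF 2 3]])
qed

definition input_state :: "letter list \<Rightarrow> env" where
  "input_state u r = (if r = 0 then wcode u else if r = 1 then 2 ^ length u else 0)"

lemma numbering_range:
  assumes "numbering num"
  shows "\<exists>K. \<forall>v. v \<in> range num \<longleftrightarrow> K = 0 \<or> v < K"
proof (cases "range num = UNIV")
  case False
  have init: "v' \<in> range num" if "v \<in> range num" "v' \<le> v" for v v'
  proof -
    have "{..v} \<subseteq> range num" using assms that(1) unfolding numbering_def by blast
    then show ?thesis by (rule subsetD) (use that(2) in simp)
  qed
  define K where "K = (LEAST v. v \<notin> range num)"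
  obtain v0 where "v0 \<notin> range num" using False by auto
  then have K: "K \<notin> range num" unfolding K_def by (rule LeastI)
  \<comment> \<open>The type of variables is nonempty, so 0 is used; a proper initial segment
    therefore has positive \<open>K\<close>, and \<open>K = 0\<close> is free for the other
    case.\<close>
  have "0 \<in> range num" by (rule init[of "num undefined"]) simp_all
  then have "K \<noteq> 0" using K by metis
  moreover have "v \<in> range num \<longleftrightarrow> v < K" for v
  proof
    assume "v \<in> range num"
    then show "v < K" using init[of v K] K not_less by blast
  next
    assume "v < K"
    then show "v \<in> range num" unfolding K_def using not_less_Least[of v "\<lambda>v. v \<notin> range num"] by blast
  qed
  ultimately show ?thesis by blast
qed auto

lemma decision_PSPACE:
  assumes L: "\<And>w. w \<in> L \<longleftrightarrow> decision idf K (wcode w) (2 ^ length w)"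
  shows "L \<in> PSPACE"
proof -
  \<comment> \<open>Register 1 holds 2 to the number of letters read; its cube is the weight of the
    next octal digit. The expression \<open>d\<close> below doubles it.\<close>
  have "\<forall>l. psp (\<lambda>e. e 0 + code l * (e 1 * e 1 * e 1))" by (intro allI psp_basic)
  then have "\<forall>l. \<exists>a (q :: nat poly). \<forall>e. eval a e = e 0 + code l * (e 1 * e 1 * e 1) \<and>
     (\<forall>m. (\<forall>i. e i < 2 ^ m) \<longrightarrow> vals_below (2 ^ poly q m) a e)"
    unfolding psp_def .
  then obtain a and q :: "letter \<Rightarrow> nat poly" where a: "\<And>l e. eval (a l) e = e 0 + code l * (e 1 * e 1 * e 1)"
    "\<And>l e m. \<forall>i. e i < 2 ^ m \<Longrightarrow> vals_below (2 ^ poly (q l) m) (a l) e" by metis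
  have "psp (\<lambda>e. e 1 + e 1)" by (intro psp_basic)
  then obtain d and qd :: "nat poly" where d: "\<And>e. eval d e = e 1 + e 1"
    "\<And>e m. \<forall>i. e i < 2 ^ m \<Longrightarrow> vals_below (2 ^ poly qd m) d e" by (rule pspE) (rule that)
  have "psp (\<lambda>e. of_bool (decision idf K (e 0) (e 1)))" using pspp_decision unfolding pspp_def .
  then obtain c and qc :: "nat poly" where c: "\<And>e. eval c e = of_bool (decision idf K (e 0) (e 1))"
    "\<And>e m. \<forall>i. e i < 2 ^ m \<Longrightarrow> vals_below (2 ^ poly qc m) c e" by (rule pspE) (rule that)
  \<comment> \<open>The summand 1 keeps the register bound at least 2, as the initial
    \<open>Inc\<close> requires.\<close>
  define Q where "Q = sum q UNIV + qd + qc + 1"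
  have Q: "poly (q l) m \<le> poly Q m" "poly qd m \<le> poly Q m" "poly qc m \<le> poly Q m" "0 < poly Q m" for l m
  proof -
    have "poly (q l) m \<le> (\<Sum>l\<in>UNIV. poly (q l) m)" by (rule member_le_sum) auto
    then show "poly (q l) m \<le> poly Q m" by (simp add: Q_def poly_sum)
  qed (simp_all add: Q_def)
  define body :: "letter \<Rightarrow> letter com" where "body = (\<lambda>l. Seq (assign 0 (a l)) (assign 1 d))"
  define main :: "letter com" where "main = Seq (Inc 1) (Seq (ReadLoop body) (compile c input_regs 2))"
  obtain R0 where R0: "regs_less R0 main" using ex_regs_less by blast
  define R where "R = max R0 3"
  interpret counter_tm main 2 R
    by unfold_locales (use regs_less_mono[OF R0] in \<open>auto simp: R_def\<close>)
  \<comment> \<open>For inputs of length \<open>n\<close> the register contents stay below 2 to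
    \<open>3 * n + 1\<close>, so numerals of \<open>poly Q (3 * n + 1)\<close> digits suffice.
    Adding \<open>n + 3\<close> leaves room for the input, the marker and one cell beyond the
    digits.\<close>
  define p where "p = [:3, 1:] + pcompose Q [:1, 3:]"
  have main: "(\<exists>t. fst (run machine w t) = (if w \<in> L then accept machine else reject machine)) \<and>
      space_bounded machine w (poly p (length w))" for w
  proof -
    let ?m = "3 * length w + 1"
    let ?B = "2 ^ poly Q ?m :: nat"
    have small: "input_state u (input_regs i) < 2 ^ ?m" if "length u \<le> length w" for u i
    proof -
      have "wcode u < 8 ^ length u" by (rule wcode_less)
      also have "\<dots> = 2 ^ (3 * length u)" by (simp add: power_mult)
      also have "\<dots> \<le> 2 ^ ?m" by (rule power_increasing) (use that in auto)
      finally have 1: "wcode u < 2 ^ ?m" .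
      have "(2::nat) ^ length u < 2 ^ ?m" by (rule power_strict_increasing) (use that in auto)
      then show ?thesis using 1 by (simp add: input_state_def input_regs_def)
    qed
    have zero: "input_state u i = 0" if "2 \<le> i" for u i using that by (simp add: input_state_def)
    have regs: "input_state u (input_regs 0) = wcode u" "input_state u (input_regs 1) = 2 ^ length u" for u
      by (simp_all add: input_state_def input_regs_def)
    have step: "exec ?B (body l) (input_state u, v) (input_state (u @ [l]), v)" if "length u < length w" for u l v
    proof -
      let ?s = "(input_state u)(0 := wcode (u @ [l]))"
      have ea: "eval (a l) (\<lambda>i. input_state u (input_regs i)) = wcode (u @ [l])"
      proof -
        have "(2::nat) ^ length u * 2 ^ length u * 2 ^ length u = 8 ^ length u"
          by (simp add: power_mult_distrib[symmetric])
        then show ?thesis unfolding a(1) regs wcode_snoc by simp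
      qed
      have ba: "vals_below ?B (a l) (\<lambda>i. input_state u (input_regs i))"
        by (rule vals_below_mono[OF a(2)[of _ ?m]]) (use small[of u] that Q(1) in auto)
      have 1: "exec ?B (assign 0 (a l)) (input_state u, v) (?s, v)"
        using exec_assign[OF zero _ ba, where r = 0 and w = v] unfolding ea by simp
      have e: "?s (input_regs i) = (if i = 0 then wcode (u @ [l]) else 2 ^ length u)" for i
        by (simp add: input_state_def input_regs_def)
      have bd: "vals_below ?B d (\<lambda>i. ?s (input_regs i))"
      proof (rule vals_below_mono[OF d(2)[of _ ?m]])
        show "\<forall>i. ?s (input_regs i) < 2 ^ ?m"
          unfolding e using small[of "u @ [l]" 0] small[of u 1] that unfolding regs by simp
      qed (use Q(2) in simp)
      have "exec ?B (assign 1 d) (?s, v) (?s(1 := eval d (\<lambda>i. ?s (input_regs i))), v)"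
        by (rule exec_assign[OF _ _ bd]) (simp_all add: zero)
      moreover have "?s(1 := eval d (\<lambda>i. ?s (input_regs i))) = input_state (u @ [l])"
        unfolding d(1) e by (simp add: fun_eq_iff input_state_def)
      ultimately have 2: "exec ?B (assign 1 d) (?s, v) (input_state (u @ [l]), v)" by simp
      show ?thesis unfolding body_def by (rule exec.Seq[OF 1 2])
    qed
    have loop: "exec ?B (ReadLoop body) (input_state u, v) (input_state (u @ v), [])"
      if "length (u @ v) \<le> length w" for u v
      using that
    proof (induction v arbitrary: u)
      case Nil
      show ?case by (simp add: exec.ReadE)
    next
      case (Cons l v)
      have "exec ?B (ReadLoop body) (input_state (u @ [l]), v) (input_state ((u @ [l]) @ v), [])"
        by (rule Cons.IH) (use Cons.prems in simp)
      then have 2: "exec ?B (ReadLoop body) (input_state (u @ [l]), v) (input_state (u @ l # v), [])" by simp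
      have 1: "exec ?B (body l) (input_state u, v) (input_state (u @ [l]), v)"
        by (rule step) (use Cons.prems in simp)
      show ?case by (rule exec.ReadC[where g = body, OF 1 2])
    qed
    have "(2::nat) ^ 1 \<le> ?B" by (rule power_increasing) (use Q(4)[of ?m] in auto)
    then have "exec ?B (Inc 1) (\<lambda>_. 0, w) ((\<lambda>_. 0)(1 := Suc 0), w)"
      by (intro exec_eq[OF exec.Inc]) auto
    moreover have "(\<lambda>_. 0)(1 := Suc 0) = input_state []" by (simp add: fun_eq_iff input_state_def)
    ultimately have 1: "exec ?B (Inc 1) (\<lambda>_. 0, w) (input_state [], w)" by simp
    have 2: "exec ?B (ReadLoop body) (input_state [], w) (input_state w, [])" using loop[of "[]" w] by simp
    let ?x = "of_bool (decision idf K (wcode w) (2 ^ length w)) :: nat"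
    have "vals_below ?B c (\<lambda>i. input_state w (input_regs i))"
      by (rule vals_below_mono[OF c(2)[of _ ?m]]) (use small[of w] Q(3) in auto)
    then have "exec ?B (compile c input_regs 2) (input_state w, [])
        ((input_state w)(2 := eval c (\<lambda>i. input_state w (input_regs i))), [])"
      by (intro compile_correct zero) (auto simp: input_regs_def)
    then have 3: "exec ?B (compile c input_regs 2) (input_state w, []) ((input_state w)(2 := ?x), [])"
      unfolding c(1) regs .
    have "exec ?B main (\<lambda>_. 0, w) ((input_state w)(2 := ?x), [])"
      unfolding main_def by (rule exec.Seq[OF 1 exec.Seq[OF 2 3]])
    from machine_run[OF _ _ this order.refl, of "poly p (length w)"]
    show ?thesis using L[of w] by (auto simp: p_def poly_pcompose algebra_simps)
  qed
  then have "decides machine L" unfolding decides_def by blast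
  then show ?thesis unfolding PSPACE_def using wf_machine main by blast
qed

theorem theorem7p9:
  fixes num :: "'v \<Rightarrow> nat"
  assumes "numbering num"
  shows "{encode num A | A. CKMPCEM \<turnstile>\<^sub>H A} \<in> PSPACE \<and>
         {encode num A | A. CKIDMPCEM \<turnstile>\<^sub>H A} \<in> PSPACE"
proof -
  obtain K where K: "\<forall>v. v \<in> range num \<longleftrightarrow> K = 0 \<or> v < K" using numbering_range[OF assms] by blast
  have "word_coding num K" by unfold_locales (use assms K in \<open>auto simp: numbering_def\<close>)
  then have "{encode num A | A. logic idf \<turnstile>\<^sub>H A} \<in> PSPACE" for idf
    by (intro decision_PSPACE[of _ idf K]) (auto simp: decision_correct)
  from this[of False] this[of True] show ?thesis by (simp add: logic_def)
qed

end
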